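(* Let $m\ge3$ and $\beta>\beta_0(m)=\tfrac12\log(10(m-2))+\tfrac16$. Let $r,t\ge1$ be integers and for $n=1,2,\dots$ let $\gamma_n$ be an axis-parallel rectangular loop with side lengths $R_n=rn$ and $T_n=tn$. Then $$\lim_{n\to\infty}-\frac{1}{R_n+T_n}\log\langle W_{\gamma_n}\rangle_\beta=V_\beta,$$ where $V_\beta=\lim_{R\to\infty}V_\beta(R)$ and $V_\beta(R)=\lim_{T\to\infty}-\frac1T\log\langle W_{\gamma_{R,T}}\rangle_\beta$ (both limits exist).
   Context: Identify $\mathbb{Z}_2=\{0,1\}$, $\rho(g)=(-1)^g$. For $N\ge1$ let $B_N=[-N,N]^m\cap\mathbb{Z}^m$, and let $C_1(B_N)$, $C_2(B_N)$ be the oriented edges and oriented plaquettes with all vertices in $B_N$. A $\mathbb{Z}_2$-valued 1-form is a function $\sigma$ on $C_1(B_N)$ with $\sigma(-e)=-\sigma(e)$; $(d\sigma)(p)=\sum_{e\in\partial p}\sigma(e)$. For $\beta\ge0$, $\mu_{\beta,N}(\sigma)\propto\exp(\beta\sum_{p\in C_2(B_N)}\rho((d\sigma)(p)))$, with expectation $\mathbb{E}_{\beta,N}$. For a loop $\gamma$, $W_\gamma=\prod_{e\in\operatorname{supp}\gamma}\rho(\sigma(e))$ and $\langle W_\gamma\rangle_\beta=\lim_{N\to\infty}\mathbb{E}_{\beta,N}[W_\gamma]$. An axis-parallel rectangular loop with side lengths $R,T$ (denoted $\gamma_{R,T}$) is the boundary, traversed once, of a rectangle with those side lengths lying in a coordinate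 plane. *)

theory Defs
  imports "HOL-Analysis.Analysis"
begin

text \<open>Z_2 is modelled as bool, with addition = exclusive or.
  Vertices of Z^m are vectors of type int^'m (m = CARD('m)).\<close>

definition rho :: "bool \<Rightarrow> real" where
  "rho g = (if g then -1 else 1)"

definition off :: "'m::finite \<Rightarrow> int \<Rightarrow> int^'m" where
  "off i k = (\<chi> c. if c = i then k else 0)"

definition lbox :: "nat \<Rightarrow> (int^'m::finite) set" where
  "lbox N = {x. \<forall>k. \<bar>x $ k\<bar> \<le> int N}"

text \<open>Edges with both endpoints in B_N, each represented by its positively
  oriented version (x, i) = (x -> x + e_i).  Since -g = g in Z_2, a Z_2-valued
  1-form is the same as a function on these representatives.\<close>
definition edges :: "nat \<Rightarrow> ((int^'m::finite) \<times> 'm) set" where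
  "edges N = {(x, i). x \<in> lbox N \<and> x + off i 1 \<in> lbox N}"

text \<open>Oriented plaquettes with all vertices in B_N: (x,i,j) with i \<noteq> j is the
  plaquette with boundary x -> x+e_i -> x+e_i+e_j -> x+e_j -> x; (x,j,i) is the
  same plaquette with the opposite orientation.\<close>
definition plaqs :: "nat \<Rightarrow> ((int^'m::finite) \<times> 'm \<times> 'm) set" where
  "plaqs N = {(x, i, j). i \<noteq> j \<and> x \<in> lbox N \<and> x + off i 1 \<in> lbox N
      \<and> x + off j 1 \<in> lbox N \<and> x + off i 1 + off j 1 \<in> lbox N}"

definition configs :: "nat \<Rightarrow> ((int^'m::finite) \<times> 'm \<Rightarrow> bool) set" where
  "configs N = {\<sigma>. \<forall>e. e \<notin> edges N \<longrightarrow> \<sigma> e = False}"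

definition dsig :: "((int^'m::finite) \<times> 'm \<Rightarrow> bool) \<Rightarrow> (int^'m) \<times> 'm \<times> 'm \<Rightarrow> bool" where
  "dsig \<sigma> p = (case p of (x, i, j) \<Rightarrow>
     ((\<sigma> (x, i) \<noteq> \<sigma> (x + off i 1, j)) \<noteq> (\<sigma> (x + off j 1, i) \<noteq> \<sigma> (x, j))))"

definition gibbs_weight :: "real \<Rightarrow> nat \<Rightarrow> ((int^'m::finite) \<times> 'm \<Rightarrow> bool) \<Rightarrow> real" where
  "gibbs_weight \<beta> N \<sigma> = exp (\<beta> * (\<Sum>p\<in>plaqs N. rho (dsig \<sigma> p)))"

definition expect :: "real \<Rightarrow> nat \<Rightarrow> (((int^'m::finite) \<times> 'm \<Rightarrow> bool) \<Rightarrow> real) \<Rightarrow> real" where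
  "expect \<beta> N f = (\<Sum>\<sigma>\<in>configs N. f \<sigma> * gibbs_weight \<beta> N \<sigma>) / (\<Sum>\<sigma>\<in>(configs N :: ((int^'m) \<times> 'm \<Rightarrow> bool) set). gibbs_weight \<beta> N \<sigma>)"

text \<open>Wilson loop observable for a loop with edge support S (each edge traversed once).\<close>
definition wilson :: "((int^'m::finite) \<times> 'm) set \<Rightarrow> ((int^'m) \<times> 'm \<Rightarrow> bool) \<Rightarrow> real" where
  "wilson S \<sigma> = (\<Prod>e\<in>S. rho (\<sigma> e))"

definition wloop :: "real \<Rightarrow> ((int^'m::finite) \<times> 'm) set \<Rightarrow> real" where
  "wloop \<beta> S = lim (\<lambda>N. expect \<beta> N (wilson S))"

definition rect :: "(int^'m::finite) \<Rightarrow> 'm \<Rightarrow> 'm \<Rightarrow> nat \<Rightarrow> nat \<Rightarrow> ((int^'m) \<times> 'm) set" where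
  "rect a i j R T =
     {(a + off i (int k), i) | k. k < R}
   \<union> {(a + off i (int R) + off j (int l), j) | l. l < T}
   \<union> {(a + off j (int T) + off i (int k), i) | k. k < R}
   \<union> {(a + off j (int l), j) | l. l < T}"

definition dirs :: "'m \<times> 'm" where
  "dirs = (SOME (i, j). i \<noteq> j)"

definition ref_rect :: "nat \<Rightarrow> nat \<Rightarrow> ((int^'m::finite) \<times> 'm) set" where
  "ref_rect R T = rect 0 (fst dirs) (snd dirs) R T"

definition Vpot_R :: "'m::finite itself \<Rightarrow> real \<Rightarrow> nat \<Rightarrow> real" where
  "Vpot_R _ \<beta> R = lim (\<lambda>T. - ln (wloop \<beta> (ref_rect R T :: ((int^'m) \<times> 'm) set)) / real T)"

definition Vpot :: "'m::finite itself \<Rightarrow> real \<Rightarrow> real" where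
  "Vpot m \<beta> = lim (Vpot_R m \<beta>)"

end

theory Submission
  imports Defs
begin

text \<open>
  Write \<open>f R T\<close> for minus the logarithm of the expectation of an \<open>R \<times> T\<close> loop. Griffiths'
  inequalities make the finite volume expectations increase with the box, so that \<open>f\<close> exists and
  depends neither on the position nor on the orientation of the loop.

  At low temperature the gauge theory is a gas of closed sets of plaquettes, and a loop reverses
  the sign of the sets meeting the spanned rectangle in an odd number of plaquettes. Removing one
  plaquette \<open>p\<close> from the volume changes \<open>ln Z\<close> by a bounded amount; the way this change depends on
  the signs at distance \<open>d\<close> from \<open>p\<close> decays exponentially in \<open>d\<close>. Two consequences follow.
  First, \<open>f R T \<le> K (R + T)\<close>: after removing all plaquettes in the walls above the loop and in a lid
  at the top of the box, every closed set meets the rectangle evenly. Second, the second difference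
  of \<open>f\<close> in \<open>R\<close> is \<open>O(T c\<^sup>R)\<close> with \<open>c < 1\<close>: it measures the interaction of two strips at distance \<open>R\<close>.

  Hence \<open>f (R + 1) T - f R T\<close> converges to some \<open>v T\<close> with error \<open>O(T c\<^sup>R)\<close>, the second differences of
  \<open>v\<close> are \<open>O(c\<^sup>T)\<close>, and since \<open>v\<close> is bounded it converges to some \<open>V\<close>. Then \<open>f (n+1) (n+1) - f n n\<close>
  tends to \<open>2 V\<close>, and prolonging the square in one direction costs \<open>V\<close> per unit length.
\<close>

section \<open>Sequences with small second differences\<close>

text \<open>The gas has activity x = exp (-4 \<beta>): an unoriented plaquette enters the action
  twice, and reversing its sign lowers the exponent by 4 \<beta>. A plaquette has at most D = 10 (m
  - 2) neighbours, and at most D^(2 (n - 1)) connected sets of n plaquettes contain a given one. The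
  hypothesis on \<beta> says exactly x D^2 < exp (-2/3): it is what this crude count can afford. No
  cluster expansion is summed. The ratios of Z for \<Lambda> and \<Lambda> - {p} are controlled by
  induction over arbitrary finite plaquette sets, because removing the neighbourhood of a polymer
  leaves volumes of any shape. Signed sums, whose positivity is not evident, obey the same bounds as
  unsigned ones, as only absolute values of the polymer terms enter. The second difference carries
  the factor T and not R T, so it stays negligible on the diagonal R = T. A box is not translation
  invariant and has a free boundary: the first is repaired only in the limit, through Griffiths, and
  the second forces the lid.\<close>

lemma cesaro_diff:
  fixes g :: "nat \<Rightarrow> real"
  assumes "(\<lambda>n. g (Suc n) - g n) \<longlonglongrightarrow> L"
  shows "(\<lambda>n. g n / real n) \<longlonglongrightarrow> L"
proof (rule LIMSEQ_I)
  fix e :: real assume e: "e > 0"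
  from LIMSEQ_D[OF assms, of "e/2"] e obtain M
    where M: "\<And>n. n \<ge> M \<Longrightarrow> \<bar>(g (Suc n) - g n) - L\<bar> < e/2" by auto
  have bound: "\<bar>g (M + k) - g M - real k * L\<bar> \<le> real k * (e/2)" for k
  proof (induction k)
    case (Suc k)
    have "\<bar>(g (Suc (M + k)) - g (M + k)) - L\<bar> < e/2" using M by simp
    thus ?case using Suc by (simp add: algebra_simps abs_if split: if_splits)
  qed simp
  define C where "C = \<bar>g M\<bar> + real M * \<bar>L\<bar>"
  obtain n0 :: nat where n0: "real n0 > 2 * C / e" using reals_Archimedean2 by blast
  show "\<exists>no. \<forall>n\<ge>no. norm (g n / real n - L) < e"
  proof (intro exI allI impI)
    fix n assume n: "n \<ge> max (Suc n0) (Suc M)"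
    hence npos: "real n > 0" and nM: "real n \<ge> real M" and nn0: "real n > real n0" by auto
    define k where "k = n - M"
    have nk: "n = M + k" using n unfolding k_def by simp
    have "\<bar>g n - real n * L\<bar> \<le> \<bar>g n - g M - real k * L\<bar> + \<bar>g M\<bar> + \<bar>real M * L\<bar>"
      unfolding nk by (simp add: algebra_simps)
    also have "\<dots> \<le> real k * (e/2) + C" using bound[of k] unfolding C_def nk by (simp add: abs_mult)
    also have "\<dots> \<le> real n * (e/2) + C" using e nk by simp
    also have "C < real n * (e/2)"
    proof -
      have "2 * C / e < real n" using n0 nn0 by linarith
      thus ?thesis using e by (simp add: field_simps)
    qed
    finally have "\<bar>g n - real n * L\<bar> < real n * e" by (simp add: mult.commute)
    moreover have "g n / real n - L = (g n - real n * L) / real n" using npos by (simp add: field_simps)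
    ultimately show "norm (g n / real n - L) < e" using npos by (simp add: field_simps)
  qed
qed

lemma geometric_increments:
  fixes s :: "nat \<Rightarrow> real" and c C :: real
  assumes c: "0 < c" "c < 1" and inc: "\<And>n. n \<ge> 1 \<Longrightarrow> \<bar>s (Suc n) - s n\<bar> \<le> C * c ^ n"
  obtains L where "s \<longlonglongrightarrow> L" "\<And>n. n \<ge> 1 \<Longrightarrow> \<bar>s n - L\<bar> \<le> C / (1 - c) * c ^ n"
proof -
  have C: "C \<ge> 0" using inc[of 1] c by (metis abs_ge_zero dual_order.trans le_refl power_one_right zero_le_mult_iff not_le)
  \<comment> \<open>The factor 1 - c^k is the exact partial geometric sum; it is what lets the
    induction on k close.\<close>
  have part: "\<bar>s (n + k) - s n\<bar> \<le> C / (1 - c) * c ^ n * (1 - c ^ k)" if "n \<ge> 1" for n k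
  proof (induction k)
    case (Suc k)
    have "\<bar>s (n + Suc k) - s n\<bar> \<le> \<bar>s (Suc (n + k)) - s (n + k)\<bar> + \<bar>s (n + k) - s n\<bar>" by simp
    also have "\<dots> \<le> C * c ^ (n + k) + C / (1 - c) * c ^ n * (1 - c ^ k)"
      using inc[of "n + k"] that Suc by (intro add_mono) auto
    also have "C * c ^ (n + k) = C / (1 - c) * c ^ n * ((1 - c) * c ^ k)"
      using c by (simp add: power_add field_simps)
    also have "\<dots> + C / (1 - c) * c ^ n * (1 - c ^ k) = C / (1 - c) * c ^ n * (1 - c ^ Suc k)"
      unfolding distrib_left[symmetric] by (simp add: algebra_simps)
    finally show ?case .
  qed simp
  have part': "\<bar>s (n + k) - s n\<bar> \<le> C / (1 - c) * c ^ n" if "n \<ge> 1" for n k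
  proof -
    have "C / (1 - c) * c ^ n * (1 - c ^ k) \<le> C / (1 - c) * c ^ n * 1"
      using C c by (intro mult_left_mono) auto
    thus ?thesis using part[OF that, of k] by simp
  qed
  have lim0: "(\<lambda>n. C / (1 - c) * c ^ n) \<longlonglongrightarrow> 0"
    using tendsto_mult_right_zero[OF LIMSEQ_power_zero[of c]] c by simp
  have "Cauchy s"
  proof (rule metric_CauchyI)
    fix e :: real assume e: "e > 0"
    obtain M where M: "\<And>n. n \<ge> M \<Longrightarrow> \<bar>C / (1 - c) * c ^ n\<bar> < e / 2"
      using LIMSEQ_D[OF lim0, of "e/2"] e by auto
    let ?M = "max M 1"
    show "\<exists>M. \<forall>m\<ge>M. \<forall>n\<ge>M. dist (s m) (s n) < e"
    proof (intro exI allI impI)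
      fix m n assume mn: "m \<ge> ?M" "n \<ge> ?M"
      have "\<bar>s m - s ?M\<bar> < e/2" if "m \<ge> ?M" for m
      proof -
        have "\<bar>s m - s ?M\<bar> \<le> C / (1 - c) * c ^ ?M" using part'[of ?M "m - ?M"] that by simp
        moreover have "\<bar>C / (1 - c) * c ^ ?M\<bar> < e / 2" using M[of ?M] by simp
        ultimately show ?thesis by linarith
      qed
      from this[OF mn(1)] this[OF mn(2)] show "dist (s m) (s n) < e" unfolding dist_real_def by linarith
    qed
  qed
  then obtain L where L: "s \<longlonglongrightarrow> L" using Cauchy_convergent convergent_def by blast
  have "\<bar>s n - L\<bar> \<le> C / (1 - c) * c ^ n" if "n \<ge> 1" for n
  proof -
    have "(\<lambda>k. \<bar>s (n + k) - s n\<bar>) \<longlonglongrightarrow> \<bar>L - s n\<bar>"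
      using LIMSEQ_ignore_initial_segment[OF L, of n] by (auto intro!: tendsto_intros simp: add.commute)
    hence "\<bar>L - s n\<bar> \<le> C / (1 - c) * c ^ n" using part'[OF that] by (intro LIMSEQ_le_const2) auto
    thus ?thesis by (simp add: abs_minus_commute)
  qed
  thus ?thesis using L that by blast
qed

text \<open>The bound \<open>second\<close> controls one direction with an error proportional to the
  other side, and \<open>sym\<close> transfers it. Dividing by the long side removes that factor in
  the limits \<open>v\<close>, and for comparable sides it is absorbed because n c^n tends to 0;
  this is why the iterated limit and the limit along a fixed shape agree.\<close>

lemma perimeter_asymptotics:
  fixes f :: "nat \<Rightarrow> nat \<Rightarrow> real" and c C K :: real
  assumes c: "0 < c" "c < 1"
    and sym: "\<And>R T. f R T = f T R"
    and nonneg: "\<And>R T. R \<ge> 1 \<Longrightarrow> T \<ge> 1 \<Longrightarrow> 0 \<le> f R T"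
    and perim: "\<And>R T. R \<ge> 1 \<Longrightarrow> T \<ge> 1 \<Longrightarrow> f R T \<le> K * real (R + T)"
    and second: "\<And>R T. R \<ge> 1 \<Longrightarrow> T \<ge> 1 \<Longrightarrow> \<bar>f (R + 2) T - 2 * f (R + 1) T + f R T\<bar> \<le> C * real T * c ^ R"
  obtains v V where "\<And>T. T \<ge> 1 \<Longrightarrow> (\<lambda>R. f T R / real R) \<longlonglongrightarrow> v T" "v \<longlonglongrightarrow> V"
    "\<And>r t. r \<ge> 1 \<Longrightarrow> t \<ge> 1 \<Longrightarrow> (\<lambda>n. f (r * n) (t * n) / real (r * n + t * n)) \<longlonglongrightarrow> V"
proof -
  define g where "g T R = f (Suc R) T - f R T" for T R
  define C' where "C' = C / (1 - c)"
  have "\<exists>L. (g T \<longlonglongrightarrow> L) \<and> (\<forall>R\<ge>1. \<bar>g T R - L\<bar> \<le> C' * real T * c ^ R)" if T: "T \<ge> 1" for T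
  proof -
    have "\<bar>g T (Suc R) - g T R\<bar> \<le> C * real T * c ^ R" if "R \<ge> 1" for R
      using second[OF that T] by (simp add: g_def)
    from geometric_increments[OF c this] obtain L where "g T \<longlonglongrightarrow> L"
      "\<And>n. n \<ge> 1 \<Longrightarrow> \<bar>g T n - L\<bar> \<le> C * real T / (1 - c) * c ^ n" by blast
    thus ?thesis unfolding C'_def by auto
  qed
  then obtain v where v: "\<And>T. T \<ge> 1 \<Longrightarrow> g T \<longlonglongrightarrow> v T"
    and gv: "\<And>T R. T \<ge> 1 \<Longrightarrow> R \<ge> 1 \<Longrightarrow> \<bar>g T R - v T\<bar> \<le> C' * real T * c ^ R" by metis
  have fv: "(\<lambda>R. f R T / real R) \<longlonglongrightarrow> v T" if "T \<ge> 1" for T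
    using v[OF that] unfolding g_def by (rule cesaro_diff)
  have fv': "(\<lambda>R. f T R / real R) \<longlonglongrightarrow> v T" if "T \<ge> 1" for T
    using fv[OF that] by (subst sym)
  have v_bounds: "0 \<le> v T" "v T \<le> K" if T: "T \<ge> 1" for T
  proof -
    show "0 \<le> v T"
      using nonneg[OF _ T] by (intro LIMSEQ_le_const[OF fv[OF T]] exI[of _ 1]) auto
    have "(\<lambda>R. K * (1 + real T / real R)) \<longlonglongrightarrow> K * (1 + 0)"
      by (intro tendsto_intros lim_const_over_n)
    moreover have "f R T / real R \<le> K * (1 + real T / real R)" if "R \<ge> 1" for R
      using perim[OF that T] that by (simp add: field_simps)
    ultimately show "v T \<le> K" using LIMSEQ_le[OF fv[OF T]] by force
  qed
  \<comment> \<open>With the sides exchanged, \<open>second\<close> bounds a second difference in T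
    by C R c^T; division by R cancels the factor R before R grows.\<close>
  have v2: "\<bar>(v (T + 2) - v (T + 1)) - (v (T + 1) - v T)\<bar> \<le> C * c ^ T" if T: "T \<ge> 1" for T
  proof -
    have "(\<lambda>R. \<bar>(f R (T + 2) / real R - f R (T + 1) / real R) - (f R (T + 1) / real R - f R T / real R)\<bar>)
       \<longlonglongrightarrow> \<bar>(v (T + 2) - v (T + 1)) - (v (T + 1) - v T)\<bar>"
      using T by (intro tendsto_intros fv) auto
    moreover have "\<bar>(f R (T + 2) / real R - f R (T + 1) / real R) - (f R (T + 1) / real R - f R T / real R)\<bar> \<le> C * c ^ T"
      if "R \<ge> 1" for R
    proof -
      have "(f R (T + 2) / real R - f R (T + 1) / real R) - (f R (T + 1) / real R - f R T / real R)
        = (f (T + 2) R - 2 * f (T + 1) R + f T R) / real R"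
        by (simp add: sym[of R] diff_divide_distrib add_divide_distrib)
      also have "\<bar>\<dots>\<bar> = \<bar>f (T + 2) R - 2 * f (T + 1) R + f T R\<bar> / real R" by simp
      finally show ?thesis using second[OF T that] that by (simp add: field_simps)
    qed
    ultimately show ?thesis by (intro LIMSEQ_le_const2) auto
  qed
  \<comment> \<open>\<delta> is the limiting slope of \<open>v\<close>. Boundedness of
    \<open>v\<close> forces it to be 0, and only then are the first differences of \<open>v\<close>
    themselves geometrically small.\<close>
  obtain \<delta> where \<delta>: "(\<lambda>T. v (Suc T) - v T) \<longlonglongrightarrow> \<delta>"
    "\<And>T. T \<ge> 1 \<Longrightarrow> \<bar>(v (Suc T) - v T) - \<delta>\<bar> \<le> C' * c ^ T"
    using geometric_increments[OF c, of "\<lambda>T. v (Suc T) - v T" C] v2 unfolding C'_def by auto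
  have "(\<lambda>T. v T / real T) \<longlonglongrightarrow> 0"
  proof (rule tendsto_sandwich[where f = "\<lambda>_. 0" and h = "\<lambda>T. K / real T"])
    show "\<forall>\<^sub>F T in sequentially. 0 \<le> v T / real T"
      using eventually_ge_at_top[of 1] by eventually_elim (use v_bounds in auto)
    show "\<forall>\<^sub>F T in sequentially. v T / real T \<le> K / real T"
      using eventually_ge_at_top[of 1] by eventually_elim (use v_bounds in \<open>auto intro: divide_right_mono\<close>)
  qed (auto intro: lim_const_over_n)
  hence "\<delta> = 0" using cesaro_diff[OF \<delta>(1)] LIMSEQ_unique by blast
  hence "\<bar>v (Suc T) - v T\<bar> \<le> C' * c ^ T" if "T \<ge> 1" for T using \<delta>(2)[OF that] by simp
  then obtain V where V: "v \<longlonglongrightarrow> V" using geometric_increments[OF c, of v C'] by blast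
  have err: "(\<lambda>n. real (Suc n) * c ^ n) \<longlonglongrightarrow> 0"
  proof -
    have "(\<lambda>n. real n * c ^ n) \<longlonglongrightarrow> 0" using powser_times_n_limit_0[of c] c by simp
    moreover have "(\<lambda>n. c ^ n) \<longlonglongrightarrow> 0" using LIMSEQ_power_zero[of c] c by simp
    ultimately have "(\<lambda>n. real n * c ^ n + c ^ n) \<longlonglongrightarrow> 0 + 0" by (rule tendsto_add)
    thus ?thesis by (simp add: algebra_simps)
  qed
  \<comment> \<open>Going from the n x n to the (n + 1) x (n + 1) square prolongs once at width n
    and once at width n + 1; these are k = 0 and k = 1.\<close>
  have diag_err: "(\<lambda>n. g (n + k) n - v (n + k)) \<longlonglongrightarrow> 0" if "k \<le> 1" for k
  proof (rule Lim_null_comparison[where g = "\<lambda>n. \<bar>C'\<bar> * (real (Suc n) * c ^ n)"])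
    show "(\<lambda>n. \<bar>C'\<bar> * (real (Suc n) * c ^ n)) \<longlonglongrightarrow> 0" using tendsto_mult_right_zero[OF err] by simp
    show "\<forall>\<^sub>F n in sequentially. norm (g (n + k) n - v (n + k)) \<le> \<bar>C'\<bar> * (real (Suc n) * c ^ n)"
      using eventually_ge_at_top[of 1]
    proof eventually_elim
      case (elim n)
      have "\<bar>g (n + k) n - v (n + k)\<bar> \<le> C' * real (n + k) * c ^ n" using gv[of "n + k" n] elim by simp
      also have "\<dots> \<le> \<bar>C'\<bar> * real (Suc n) * c ^ n" using that c by (intro mult_right_mono mult_mono) auto
      finally show ?case by (simp add: mult.assoc)
    qed
  qed
  have "(\<lambda>n. f (Suc n) (Suc n) - f n n) \<longlonglongrightarrow> 2 * V"
  proof -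
    have Vk: "(\<lambda>n. v (n + k)) \<longlonglongrightarrow> V" for k using LIMSEQ_ignore_initial_segment[OF V] .
    have "(\<lambda>n. (g (n + 1) n - v (n + 1)) + v (n + 1) + ((g (n + 0) n - v (n + 0)) + v (n + 0))) \<longlonglongrightarrow> 0 + V + (0 + V)"
      by (intro tendsto_add diag_err Vk) auto
    moreover have "(g (n + 1) n - v (n + 1)) + v (n + 1) + ((g (n + 0) n - v (n + 0)) + v (n + 0)) = f (Suc n) (Suc n) - f n n" for n
      using sym[of n "Suc n"] by (simp add: g_def)
    ultimately show ?thesis by simp
  qed
  hence diag: "(\<lambda>n. f n n / real n) \<longlonglongrightarrow> 2 * V" by (rule cesaro_diff)
  \<comment> \<open>The shorter side is t n. The square contributes about 2 V t n and each of the k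
    n further unit steps about \<open>v (t * n)\<close>, hence V; the total (2 t + k) n V is V times
    the half perimeter.\<close>
  have main: "(\<lambda>n. f ((t + k) * n) (t * n) / real ((t + k) * n + t * n)) \<longlonglongrightarrow> V" if t: "t \<ge> 1" for t k
  proof -
    have tn: "filterlim (\<lambda>n. t * n) sequentially sequentially"
      using t by (intro filterlim_subseq) (auto simp: strict_mono_def)
    have lin: "\<bar>f (m + j) m - f m m - real j * v m\<bar> \<le> real j * (\<bar>C'\<bar> * (real (Suc m) * c ^ m))" if "m \<ge> 1" for m j
    proof (induction j)
      case (Suc j)
      have "\<bar>g m (m + j) - v m\<bar> \<le> C' * real m * c ^ (m + j)" using gv that by simp
      also have "\<dots> \<le> \<bar>C'\<bar> * real (Suc m) * c ^ m"
        using c by (intro mult_mono power_decreasing) auto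
      finally have "\<bar>g m (m + j) - v m\<bar> \<le> \<bar>C'\<bar> * (real (Suc m) * c ^ m)" by (simp add: mult.assoc)
      moreover have "f (m + Suc j) m - f m m - real (Suc j) * v m = (f (m + j) m - f m m - real j * v m) + (g m (m + j) - v m)"
        by (simp add: g_def algebra_simps)
      moreover have "real (Suc j) * (\<bar>C'\<bar> * (real (Suc m) * c ^ m)) = real j * (\<bar>C'\<bar> * (real (Suc m) * c ^ m)) + \<bar>C'\<bar> * (real (Suc m) * c ^ m)"
        by (simp add: algebra_simps)
      ultimately show ?case using Suc by linarith
    qed simp
    have e0: "(\<lambda>n. (f (t * n + k * n) (t * n) - f (t * n) (t * n) - real (k * n) * v (t * n)) / real n) \<longlonglongrightarrow> 0"
    proof (rule Lim_null_comparison[where g = "\<lambda>n. real k * (\<bar>C'\<bar> * (real (Suc (t * n)) * c ^ (t * n)))"])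
      have "(\<lambda>n. real (Suc (t * n)) * c ^ (t * n)) \<longlonglongrightarrow> 0" using filterlim_compose[OF err tn] .
      thus "(\<lambda>n. real k * (\<bar>C'\<bar> * (real (Suc (t * n)) * c ^ (t * n)))) \<longlonglongrightarrow> 0"
        by (intro tendsto_mult_right_zero)
      show "\<forall>\<^sub>F n in sequentially. norm ((f (t * n + k * n) (t * n) - f (t * n) (t * n) - real (k * n) * v (t * n)) / real n)
          \<le> real k * (\<bar>C'\<bar> * (real (Suc (t * n)) * c ^ (t * n)))"
        using eventually_ge_at_top[of 1]
      proof eventually_elim
        case (elim n)
        have "\<bar>f (t * n + k * n) (t * n) - f (t * n) (t * n) - real (k * n) * v (t * n)\<bar>
          \<le> real (k * n) * (\<bar>C'\<bar> * (real (Suc (t * n)) * c ^ (t * n)))"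
          using elim t by (intro lin) simp
        also have "\<dots> = real k * (\<bar>C'\<bar> * (real (Suc (t * n)) * c ^ (t * n))) * real n" by simp
        finally show ?case using elim by (simp add: divide_le_eq)
      qed
    qed
    have d: "(\<lambda>n. f (t * n) (t * n) / real (t * n)) \<longlonglongrightarrow> 2 * V" using filterlim_compose[OF diag tn] .
    have vt: "(\<lambda>n. v (t * n)) \<longlonglongrightarrow> V" using filterlim_compose[OF V tn] .
    have "(\<lambda>n. ((f (t * n + k * n) (t * n) - f (t * n) (t * n) - real (k * n) * v (t * n)) / real n
        + real t * (f (t * n) (t * n) / real (t * n)) + real k * v (t * n)) / real (2 * t + k))
        \<longlonglongrightarrow> (0 + real t * (2 * V) + real k * V) / real (2 * t + k)"
      using t by (intro tendsto_intros e0 d vt) auto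
    also have "(0 + real t * (2 * V) + real k * V) / real (2 * t + k) = V"
      using t by (simp add: field_simps)
    finally show ?thesis
    proof (rule Lim_transform_eventually)
      show "\<forall>\<^sub>F n in sequentially. ((f (t * n + k * n) (t * n) - f (t * n) (t * n) - real (k * n) * v (t * n)) / real n
        + real t * (f (t * n) (t * n) / real (t * n)) + real k * v (t * n)) / real (2 * t + k)
        = f ((t + k) * n) (t * n) / real ((t + k) * n + t * n)"
        using eventually_ge_at_top[of 1]
      proof eventually_elim
        case (elim n)
        let ?x = "f (t * n + k * n) (t * n)" and ?y = "f (t * n) (t * n)"
        have n: "real n > 0" and tp: "real t > 0" using elim t by auto
        have "(?x - ?y - real (k * n) * v (t * n)) / real n + real t * (?y / real (t * n)) + real k * v (t * n) = ?x / real n"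
          using n tp by (simp add: field_simps)
        moreover have "real ((t + k) * n + t * n) = real n * real (2 * t + k)" by (simp add: algebra_simps)
        ultimately show ?case by (simp add: distrib_right)
      qed
    qed
  qed
  show ?thesis
  proof (rule that[OF fv' V])
    fix r t :: nat assume rt: "r \<ge> 1" "t \<ge> 1"
    show "(\<lambda>n. f (r * n) (t * n) / real (r * n + t * n)) \<longlonglongrightarrow> V"
    proof (cases "t \<le> r")
      case True
      thus ?thesis using main[OF rt(2), of "r - t"] by simp
    next
      case False
      hence "(\<lambda>n. f (t * n) (r * n) / real (t * n + r * n)) \<longlonglongrightarrow> V" using main[OF rt(1), of "t - r"] by simp
      thus ?thesis by (subst sym) (simp add: add.commute)
    qed
  qed
qed

section \<open>Griffiths' inequalities\<close>

lemma rho_sq [simp]: "rho s * rho s = 1"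
  by (simp add: rho_def)

lemma rho_left_sq [simp]: "rho s * (rho s * y) = y"
  by (simp add: rho_def)

lemma rho_xor: "rho (a \<noteq> b) = rho a * rho b"
  by (simp add: rho_def)

definition spins :: "'e set \<Rightarrow> ('e \<Rightarrow> bool) set" where
  "spins E = {\<sigma>. \<forall>e. e \<notin> E \<longrightarrow> \<sigma> e = False}"

text \<open>Configurations form a group under \<open>flip\<close>, and the functions
  \<open>chi A\<close> are its characters.\<close>

definition chi :: "'e set \<Rightarrow> ('e \<Rightarrow> bool) \<Rightarrow> real" where
  "chi A \<sigma> = (\<Prod>e\<in>A. rho (\<sigma> e))"

definition flip :: "('e \<Rightarrow> bool) \<Rightarrow> ('e \<Rightarrow> bool) \<Rightarrow> 'e \<Rightarrow> bool" where
  "flip \<tau> \<sigma> = (\<lambda>e. \<tau> e \<noteq> \<sigma> e)"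

text \<open>The unnormalised correlation of \<open>chi A\<close> in an Ising model with many-body
  interactions: p couples the spins in \<open>B p\<close> with strength \<open>J p\<close>. Left
  undivided, it is linear under the expansion of a single interaction.\<close>

definition corr_sum :: "'e set \<Rightarrow> ('p \<Rightarrow> 'e set) \<Rightarrow> ('p \<Rightarrow> real) \<Rightarrow> 'p set \<Rightarrow> 'e set \<Rightarrow> real" where
  "corr_sum E B J P A = (\<Sum>\<sigma>\<in>spins E. chi A \<sigma> * exp (\<Sum>p\<in>P. J p * chi (B p) \<sigma>))"

lemma finite_spins: "finite E \<Longrightarrow> finite (spins E)"
proof -
  assume "finite E"
  moreover have "Collect ` spins E \<subseteq> Pow E" unfolding spins_def by auto
  ultimately have "finite (Collect ` spins E)" by (meson finite_Pow_iff finite_subset)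
  thus ?thesis by (rule finite_imageD) (auto simp: inj_on_def)
qed

lemma spins_nonempty: "spins E \<noteq> {}"
  unfolding spins_def by auto

lemma card_spins_pos: "finite E \<Longrightarrow> card (spins E) > 0"
  using finite_spins[of E] spins_nonempty[of E] by (simp add: card_gt_0_iff)

lemma flip_flip [simp]: "flip \<tau> (flip \<tau> \<sigma>) = \<sigma>"
  by (auto simp: flip_def)

lemma flip_commute: "flip \<sigma> \<tau> = flip \<tau> \<sigma>"
  by (auto simp: flip_def)

lemma flip_spins: "\<tau> \<in> spins E \<Longrightarrow> \<sigma> \<in> spins E \<Longrightarrow> flip \<tau> \<sigma> \<in> spins E"
  by (auto simp: flip_def spins_def)

lemma sum_flip: "\<tau> \<in> spins E \<Longrightarrow> (\<Sum>\<sigma>\<in>spins E. h (flip \<tau> \<sigma>)) = (\<Sum>\<sigma>\<in>spins E. h \<sigma>)"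
  by (rule sum.reindex_bij_witness[where i = "flip \<tau>" and j = "flip \<tau>"]) (auto intro: flip_spins)

lemma chi_flip: "chi A (flip \<tau> \<sigma>) = chi A \<tau> * chi A \<sigma>"
  unfolding chi_def flip_def rho_xor by (rule prod.distrib)

lemma chi_sq [simp]: "chi A \<sigma> * chi A \<sigma> = 1"
  unfolding chi_def prod.distrib[symmetric] by simp

lemma chi_cases: "chi A \<sigma> = 1 \<or> chi A \<sigma> = -1"
  using chi_sq[of A \<sigma>] by (metis square_eq_1_iff)

lemma chi_le_1: "chi A \<sigma> \<le> 1" and chi_ge: "chi A \<sigma> \<ge> -1"
  using chi_cases[of A \<sigma>] by auto

lemma chi_empty [simp]: "chi {} \<sigma> = 1"
  by (simp add: chi_def)

lemma chi_sym_diff: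
  assumes "finite A" "finite B"
  shows "chi (sym_diff A B) \<sigma> = chi A \<sigma> * chi B \<sigma>"
proof -
  have "chi A \<sigma> = chi (A - B) \<sigma> * chi (A \<inter> B) \<sigma>" "chi B \<sigma> = chi (B - A) \<sigma> * chi (A \<inter> B) \<sigma>"
    unfolding chi_def using assms
    by (subst prod.union_disjoint[symmetric]; auto intro!: prod.cong)+
  moreover have "chi (sym_diff A B) \<sigma> = chi (A - B) \<sigma> * chi (B - A) \<sigma>"
    unfolding chi_def using assms by (subst prod.union_disjoint) auto
  moreover have "chi (A - B) \<sigma> * chi (A \<inter> B) \<sigma> * (chi (B - A) \<sigma> * chi (A \<inter> B) \<sigma>)
     = chi (A - B) \<sigma> * chi (B - A) \<sigma> * (chi (A \<inter> B) \<sigma> * chi (A \<inter> B) \<sigma>)" by (simp only: mult_ac)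
  ultimately show ?thesis by simp
qed

text \<open>Orthogonality of characters: flipping one spin of A reverses the sign of
  \<open>chi A\<close> and permutes the configurations.\<close>

lemma corr_sum_no_interaction:
  assumes "A \<subseteq> E"
  shows "corr_sum E B J {} A = (if A = {} then real (card (spins E)) else 0)"
proof (cases "A = {} \<or> infinite A")
  case True
  show ?thesis
  proof (cases "A = {}")
    case False
    \<comment> \<open>An infinite A forces infinitely many configurations, and a sum over an
      infinite set is 0 by convention.\<close>
    hence "infinite E" using True assms finite_subset by blast
    moreover have "inj (\<lambda>e. (\<lambda>x. x = (e::'a)))" by (auto simp: inj_def fun_eq_iff)
    ultimately have "infinite ((\<lambda>e. (\<lambda>x. x = e)) ` E)" by (simp add: finite_image_iff inj_on_subset)
    moreover have "(\<lambda>e. (\<lambda>x. x = e)) ` E \<subseteq> spins E" unfolding spins_def by auto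
    ultimately have "infinite (spins E)" using finite_subset by blast
    thus ?thesis using False unfolding corr_sum_def by simp
  qed (simp add: corr_sum_def)
next
  case False
  then obtain e where e: "e \<in> A" "finite A" "A \<noteq> {}" by auto
  let ?t = "\<lambda>x. x = e"
  have t: "?t \<in> spins E" using e assms unfolding spins_def by auto
  have "chi A ?t = (\<Prod>x\<in>A. if x = e then -1 else 1)" unfolding chi_def rho_def by simp
  hence "chi A ?t = -1" using e by simp
  hence "corr_sum E B J {} A = - corr_sum E B J {} A"
    using sum_flip[OF t, of "chi A"] by (simp add: corr_sum_def chi_flip sum_negf)
  thus ?thesis using e by simp
qed

text \<open>For s = 1 or s = -1, exp (J s) = cosh J + s sinh J, and multiplication by
  \<open>chi (B p)\<close> replaces A by its symmetric difference with \<open>B p\<close>. The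
  inductions over interactions rest on this step.\<close>

lemma corr_sum_insert:
  assumes "finite P" "p \<notin> P" "finite A" "finite (B p)"
  shows "corr_sum E B J (insert p P) A = cosh (J p) * corr_sum E B J P A
    + sinh (J p) * corr_sum E B J P (sym_diff A (B p))"
proof -
  have "exp (J p * s) = cosh (J p) + s * sinh (J p)" if "s = 1 \<or> s = -1" for s :: real
    using that by (auto simp: cosh_plus_sinh cosh_minus_sinh)
  hence e: "exp (J p * chi (B p) \<sigma>) = cosh (J p) + chi (B p) \<sigma> * sinh (J p)" for \<sigma>
    using chi_cases by blast
  have "chi A \<sigma> * exp (\<Sum>q\<in>insert p P. J q * chi (B q) \<sigma>)
     = cosh (J p) * (chi A \<sigma> * exp (\<Sum>q\<in>P. J q * chi (B q) \<sigma>))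
     + sinh (J p) * (chi (sym_diff A (B p)) \<sigma> * exp (\<Sum>q\<in>P. J q * chi (B q) \<sigma>))" for \<sigma>
    using assms by (simp add: exp_add e chi_sym_diff algebra_simps)
  thus ?thesis unfolding corr_sum_def by (simp add: sum.distrib sum_distrib_left)
qed

text \<open>Griffiths' first inequality: for J \<ge> 0 the expansion has nonnegative coefficients,
  and it ends in sums without interaction, which are 0 or a cardinality.\<close>

lemma corr_sum_nonneg:
  assumes "finite P" "finite E" "A \<subseteq> E" "\<And>p. p \<in> P \<Longrightarrow> B p \<subseteq> E" "\<And>p. p \<in> P \<Longrightarrow> J p \<ge> 0"
  shows "corr_sum E B J P A \<ge> 0"
  using assms(1,3-)
proof (induction P arbitrary: A rule: finite_induct)
  case empty
  thus ?case by (simp add: corr_sum_no_interaction)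
next
  case (insert p P)
  have fin: "finite A" "finite (B p)" using insert.prems assms(2) finite_subset by blast+
  show ?case
    unfolding corr_sum_insert[where B = B, OF insert.hyps fin]
    using insert.prems by (intro add_nonneg_nonneg mult_nonneg_nonneg insert.IH) auto
qed

lemma corr_sum_pos: "finite E \<Longrightarrow> corr_sum E B J P {} > 0"
  unfolding corr_sum_def using finite_spins spins_nonempty by (auto intro!: sum_pos)

text \<open>Griffiths' second inequality, by duplicating the spins: with \<open>\<sigma>' = \<tau>\<sigma>\<close> the difference
  becomes a combination, with weights \<open>1 - chi B' \<tau> \<ge> 0\<close>, of sums with the ferromagnetic couplings
  \<open>J p * (1 + chi (B p) \<tau>)\<close>.\<close>

lemma griffiths:
  assumes "finite P" "finite E" "A \<subseteq> E" "B' \<subseteq> E" "\<And>p. p \<in> P \<Longrightarrow> B p \<subseteq> E" "\<And>p. p \<in> P \<Longrightarrow> J p \<ge> 0"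
  shows "corr_sum E B J P A * corr_sum E B J P B' \<le> corr_sum E B J P (sym_diff A B') * corr_sum E B J P {}"
proof -
  let ?H = "\<lambda>\<sigma>. \<Sum>p\<in>P. J p * chi (B p) \<sigma>"
  let ?S = "spins E"
  have fin: "finite A" "finite B'" using finite_subset[OF assms(3,2)] finite_subset[OF assms(4,2)] .
  have H: "exp (?H \<sigma>) * exp (?H (flip \<tau> \<sigma>)) = exp (\<Sum>p\<in>P. J p * (1 + chi (B p) \<tau>) * chi (B p) \<sigma>)" for \<sigma> \<tau>
    by (simp add: exp_add[symmetric] chi_flip sum.distrib[symmetric] algebra_simps)
  have prod: "(\<Sum>\<sigma>\<in>?S. f \<sigma> * exp (?H \<sigma>)) * (\<Sum>\<sigma>'\<in>?S. g \<sigma>' * exp (?H \<sigma>'))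
      = (\<Sum>\<tau>\<in>?S. \<Sum>\<sigma>\<in>?S. f \<sigma> * g (flip \<tau> \<sigma>) * exp (\<Sum>p\<in>P. J p * (1 + chi (B p) \<tau>) * chi (B p) \<sigma>))" for f g
  proof -
    have "(\<Sum>\<sigma>\<in>?S. f \<sigma> * exp (?H \<sigma>)) * (\<Sum>\<sigma>'\<in>?S. g \<sigma>' * exp (?H \<sigma>'))
      = (\<Sum>\<sigma>\<in>?S. f \<sigma> * exp (?H \<sigma>) * (\<Sum>\<tau>\<in>?S. g (flip \<sigma> \<tau>) * exp (?H (flip \<sigma> \<tau>))))"
      unfolding sum_distrib_right by (intro sum.cong refl) (simp add: sum_flip[where h = "\<lambda>s. g s * exp (?H s)"])
    also have "\<dots> = (\<Sum>\<sigma>\<in>?S. \<Sum>\<tau>\<in>?S. f \<sigma> * g (flip \<tau> \<sigma>) * (exp (?H \<sigma>) * exp (?H (flip \<tau> \<sigma>))))"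
      unfolding sum_distrib_left by (intro sum.cong refl) (simp add: flip_commute mult_ac)
    also have "\<dots> = (\<Sum>\<tau>\<in>?S. \<Sum>\<sigma>\<in>?S. f \<sigma> * g (flip \<tau> \<sigma>) * (exp (?H \<sigma>) * exp (?H (flip \<tau> \<sigma>))))"
      by (rule sum.swap)
    finally show ?thesis unfolding H .
  qed
  let ?C = "\<lambda>\<tau>. corr_sum E B (\<lambda>p. J p * (1 + chi (B p) \<tau>)) P (sym_diff A B')"
  have "corr_sum E B J P (sym_diff A B') * corr_sum E B J P {} = (\<Sum>\<tau>\<in>?S. ?C \<tau>)"
    using prod[of "chi (sym_diff A B')" "chi {}"] by (simp add: corr_sum_def)
  moreover have "corr_sum E B J P A * corr_sum E B J P B' = (\<Sum>\<tau>\<in>?S. chi B' \<tau> * ?C \<tau>)"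
    unfolding corr_sum_def prod
    by (intro sum.cong refl) (simp add: sum_distrib_left chi_sym_diff[OF fin] chi_flip mult_ac)
  ultimately have "corr_sum E B J P (sym_diff A B') * corr_sum E B J P {} - corr_sum E B J P A * corr_sum E B J P B'
    = (\<Sum>\<tau>\<in>?S. (1 - chi B' \<tau>) * ?C \<tau>)"
    by (simp add: sum_subtractf left_diff_distrib)
  also have "\<dots> \<ge> 0"
  proof (intro sum_nonneg mult_nonneg_nonneg corr_sum_nonneg)
    fix \<tau> p assume "p \<in> P"
    thus "0 \<le> J p" "0 \<le> 1 + chi (B p) \<tau>" "B p \<subseteq> E" using assms chi_ge[of "B p" \<tau>] by auto
  qed (use assms chi_le_1 in auto)
  finally show ?thesis by simp
qed

text \<open>Interactions are added one at a time. After cross-multiplication the cosh terms cancel,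
  and what remains for a new p is sinh (J p) times Griffiths' second inequality for A and
  \<open>B p\<close>.\<close>

lemma correlation_mono:
  assumes "finite P'" "P \<subseteq> P'" "finite E" "A \<subseteq> E" "\<And>p. p \<in> P' \<Longrightarrow> B p \<subseteq> E" "\<And>p. p \<in> P' \<Longrightarrow> J p \<ge> 0"
  shows "corr_sum E B J P A / corr_sum E B J P {} \<le> corr_sum E B J P' A / corr_sum E B J P' {}"
proof -
  have finP: "finite (P' - P)" "finite P" using assms(1) finite_subset[OF assms(2,1)] by auto
  have *: "corr_sum E B J P A / corr_sum E B J P {} \<le> corr_sum E B J (P \<union> Q) A / corr_sum E B J (P \<union> Q) {}"
    if "Q \<subseteq> P' - P" "finite Q" for Q
    using that(2,1)
  proof (induction Q rule: finite_induct)
    case (insert p Q)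
    let ?Z = "corr_sum E B J (P \<union> Q)"
    have p: "p \<in> P'" "p \<notin> P \<union> Q" using insert by auto
    have "B p \<subseteq> E" using assms(5) p by blast
    hence fin: "finite (P \<union> Q)" "finite A" "finite (B p)"
      using insert.hyps finP assms(3,4) finite_subset by auto
    have "?Z A * ?Z (B p) \<le> ?Z (sym_diff A (B p)) * ?Z {}"
    proof (rule griffiths)
      fix q assume "q \<in> P \<union> Q"
      hence "q \<in> P'" using insert.prems assms(2) by auto
      thus "B q \<subseteq> E" "J q \<ge> 0" using assms by auto
    qed (use fin assms(3,4) \<open>B p \<subseteq> E\<close> in auto)
    hence "sinh (J p) * (?Z A * ?Z (B p)) \<le> sinh (J p) * (?Z (sym_diff A (B p)) * ?Z {})"
      using assms p by (intro mult_left_mono) auto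
    moreover have pos: "?Z {} > 0" "corr_sum E B J (insert p (P \<union> Q)) {} > 0"
      using corr_sum_pos assms by auto
    ultimately have "?Z A / ?Z {} \<le> corr_sum E B J (insert p (P \<union> Q)) A / corr_sum E B J (insert p (P \<union> Q)) {}"
      using fin p by (simp add: divide_simps corr_sum_insert) (simp add: algebra_simps)
    thus ?case using insert by simp
  qed simp
  show ?thesis using *[of "P' - P"] assms(2) finP by (simp add: Un_absorb1)
qed

text \<open>The spins outside E are free and contribute the same factor to every sum. It is the
  quotient of the two cardinalities, written cross-multiplied so that the expansion in one
  interaction applies termwise.\<close>

lemma corr_sum_enlarge:
  assumes "finite P" "finite E'" "E \<subseteq> E'" "A \<subseteq> E" "\<And>p. p \<in> P \<Longrightarrow> B p \<subseteq> E"
  shows "corr_sum E' B J P A * real (card (spins E)) = corr_sum E B J P A * real (card (spins E'))"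
  using assms(1,4,5)
proof (induction P arbitrary: A rule: finite_induct)
  case empty
  thus ?case using assms(3) by (simp add: corr_sum_no_interaction order.trans)
next
  case (insert p P)
  have fin: "finite A" "finite (B p)" using insert.prems assms(2,3) by (meson finite_subset insertI1)+
  have "sym_diff A (B p) \<subseteq> E" using insert.prems by auto
  from insert.IH[OF insert.prems(1)] insert.IH[OF this] insert.prems(2) show ?case
    unfolding corr_sum_insert[where B = B, OF insert.hyps fin] by (simp add: distrib_right mult.assoc)
qed

lemma correlation_enlarge:
  assumes "finite P" "finite E'" "E \<subseteq> E'" "A \<subseteq> E" "\<And>p. p \<in> P \<Longrightarrow> B p \<subseteq> E"
  shows "corr_sum E' B J P A / corr_sum E' B J P {} = corr_sum E B J P A / corr_sum E B J P {}"
proof -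
  have fE: "finite E" using assms finite_subset by blast
  define k where "k = real (card (spins E')) / real (card (spins E))"
  have pos: "real (card (spins E)) > 0" "k > 0"
    using card_spins_pos[OF fE] card_spins_pos[OF assms(2)] unfolding k_def by auto
  have "corr_sum E' B J P A' = k * corr_sum E B J P A'" if "A' \<subseteq> E" for A'
    using corr_sum_enlarge[where B = B and J = J, OF assms(1-3) that assms(5)] pos(1)
    unfolding k_def by (simp add: field_simps)
  from this[OF assms(4)] this[of "{}"] show ?thesis using pos(2) by simp
qed

section \<open>Gases of closed sets at low activity\<close>

text \<open>Telescoping over M. The step bound is demanded for all subsets of \<Lambda> because at
  the intermediate stages a part of M is already gone.\<close>

lemma abs_diff_le_sum_removed:
  fixes F :: "'p set \<Rightarrow> real"
  assumes "finite M" "M \<subseteq> \<Lambda>"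
    and step: "\<And>\<Lambda>' p. \<Lambda>' \<subseteq> \<Lambda> \<Longrightarrow> p \<in> \<Lambda>' \<Longrightarrow> \<bar>F \<Lambda>' - F (\<Lambda>' - {p})\<bar> \<le> \<delta> p"
  shows "\<bar>F \<Lambda> - F (\<Lambda> - M)\<bar> \<le> (\<Sum>p\<in>M. \<delta> p)"
  using assms(1,2)
proof (induction M rule: finite_induct)
  case (insert p M)
  have "\<bar>F (\<Lambda> - M) - F (\<Lambda> - M - {p})\<bar> \<le> \<delta> p"
    using insert by (intro step) auto
  moreover have "\<Lambda> - insert p M = \<Lambda> - M - {p}" by auto
  ultimately show ?case using insert by simp
qed simp

section \<open>Lipschitz bounds for exp and ln, finite geometric sums\<close>

lemma abs_exp_diff_le:
  fixes u v :: real
  shows "\<bar>exp u - exp v\<bar> \<le> exp (max u v) * \<bar>u - v\<bar>"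
proof -
  have *: "exp b - exp a \<le> exp b * (b - a)" for a b :: real
  proof -
    have "1 + (a - b) \<le> exp (a - b)" by (rule exp_ge_add_one_self)
    hence "exp b * (1 + (a - b)) \<le> exp b * exp (a - b)" by (intro mult_left_mono) auto
    also have "\<dots> = exp a" by (simp add: exp_add [symmetric])
    finally show ?thesis by (simp add: algebra_simps)
  qed
  show ?thesis
    using *[of u v] *[of v u] by (cases "u \<le> v") (auto simp: max_def abs_if)
qed

lemma abs_ln_diff_le:
  fixes u v :: real
  assumes "u \<ge> exp (-b)" "v \<ge> exp (-b)"
  shows "\<bar>ln u - ln v\<bar> \<le> exp b * \<bar>u - v\<bar>"
proof -
  have *: "ln v - ln u \<le> exp b * \<bar>u - v\<bar>" if "u \<ge> exp (-b)" "v \<ge> exp (-b)" for u v :: real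
  proof -
    have pos: "u > 0" "v > 0" using that by (auto intro: less_le_trans[OF exp_gt_zero])
    have "ln v - ln u = ln (v / u)" using pos by (simp add: ln_div)
    also have "\<dots> \<le> v / u - 1" using pos by (intro ln_le_minus_one) auto
    also have "\<dots> = (v - u) * (1 / u)" using pos by (simp add: field_simps)
    also have "\<dots> \<le> \<bar>u - v\<bar> * (1 / u)" using pos by (intro mult_right_mono) auto
    also have "1 / u \<le> exp b"
      using that(1) pos by (simp add: exp_minus field_simps)
    hence "\<bar>u - v\<bar> * (1 / u) \<le> \<bar>u - v\<bar> * exp b" by (intro mult_left_mono) auto
    finally show ?thesis by (simp add: mult.commute)
  qed
  from *[OF assms] *[OF assms(2,1)] show ?thesis by (simp add: abs_if split: if_splits)
qed

lemma sum_power_le: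
  fixes y :: real assumes "0 \<le> y" "y < 1"
  shows "(\<Sum>n=1..M. y ^ n) \<le> y / (1 - y)"
proof -
  have "(\<Sum>n=1..M. y ^ n) * (1 - y) = y - y ^ Suc M"
  proof (induction M)
    case (Suc M)
    have e: "(\<Sum>n=1..Suc M. y ^ n) * (1 - y) = (\<Sum>n=1..M. y ^ n) * (1 - y) + y ^ Suc M * (1 - y)"
      by (simp add: distrib_right)
    show ?case unfolding e Suc by (simp add: algebra_simps)
  qed simp
  hence "(\<Sum>n=1..M. y ^ n) * (1 - y) \<le> y" using assms by simp
  thus ?thesis using assms by (simp add: field_simps)
qed

lemma sum_nat_power_le:
  fixes y :: real assumes "0 \<le> y" "y < 1"
  shows "(\<Sum>n=1..M. real n * y ^ n) \<le> y / (1 - y)\<^sup>2"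
proof -
  have "(\<Sum>n=1..M. real n * y ^ n) * (1 - y)\<^sup>2 = y - y ^ Suc M * (1 + real M * (1 - y))"
  proof (induction M)
    case (Suc M)
    have e: "(\<Sum>n=1..Suc M. real n * y ^ n) * (1 - y)\<^sup>2
        = (\<Sum>n=1..M. real n * y ^ n) * (1 - y)\<^sup>2 + real (Suc M) * y ^ Suc M * (1 - y)\<^sup>2"
      by (simp add: distrib_right)
    show ?case unfolding e Suc by (simp add: algebra_simps power2_eq_square)
  qed simp
  moreover have "y ^ Suc M * (1 + real M * (1 - y)) \<ge> 0" using assms by simp
  ultimately have "(\<Sum>n=1..M. real n * y ^ n) * (1 - y)\<^sup>2 \<le> y" by linarith
  thus ?thesis using assms by (simp add: pos_le_divide_eq)
qed

text \<open>The lattice enters only through the number of points that share a cube with a given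
  point. The product x deg^2 is the ratio of the geometric series that weighs connected sets by
  their size; \<open>deg_ge\<close> supplies the room for the numerical inequalities that close the
  inductions.\<close>

locale parity_gas =
  fixes cubes :: "'p set set" and deg :: nat and x :: real
  assumes finite_neighbours: "finite {q. q \<noteq> p \<and> (\<exists>c\<in>cubes. p \<in> c \<and> q \<in> c)}"
    and card_neighbours: "card {q. q \<noteq> p \<and> (\<exists>c\<in>cubes. p \<in> c \<and> q \<in> c)} \<le> deg"
    and deg_ge: "deg \<ge> 10"
    and x_pos: "x > 0"
    and x_small: "x * real deg ^ 2 \<le> exp (-2/3)"
begin

definition adj :: "'p \<Rightarrow> 'p \<Rightarrow> bool" where
  "adj p q \<longleftrightarrow> q \<noteq> p \<and> (\<exists>c\<in>cubes. p \<in> c \<and> q \<in> c)"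

text \<open>Every cube imposes its constraint, also one that reaches outside the volume. Taking p
  out of the volume therefore forbids p; it does not delete the cubes through p.\<close>

definition even_on_cubes :: "'p set \<Rightarrow> bool" where
  "even_on_cubes \<omega> \<longleftrightarrow> (\<forall>c\<in>cubes. even (card (\<omega> \<inter> c)))"

text \<open>Only the endpoint of a step has to lie in \<omega>. Thus p belongs to
  \<open>comp p \<omega>\<close> in any case, and for p in \<omega> this is its connected
  component.\<close>

definition comp :: "'p \<Rightarrow> 'p set \<Rightarrow> 'p set" where
  "comp p \<omega> = {q. (\<lambda>u v. adj u v \<and> v \<in> \<omega>)\<^sup>*\<^sup>* p q}"

definition nbhd :: "'p set \<Rightarrow> 'p set" where
  "nbhd \<gamma> = \<gamma> \<union> {q. \<exists>p\<in>\<gamma>. adj p q}"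

definition polymers :: "'p \<Rightarrow> 'p set \<Rightarrow> 'p set set" where
  "polymers p \<Lambda> = {\<gamma>. \<gamma> \<subseteq> \<Lambda> \<and> p \<in> \<gamma> \<and> even_on_cubes \<gamma> \<and> comp p \<gamma> = \<gamma>}"

text \<open>For q = {} this is the partition function of the gas; for a spanned rectangle q it is,
  up to a common factor, the numerator of the loop expectation.\<close>

definition Z :: "'p set \<Rightarrow> 'p set \<Rightarrow> real" where
  "Z q \<Lambda> = (\<Sum>\<omega> | \<omega> \<subseteq> \<Lambda> \<and> even_on_cubes \<omega>. (-1) ^ card (\<omega> \<inter> q) * x ^ card \<omega>)"

section \<open>Connected components and the removal of one point\<close>

lemma adj_sym: "adj p q \<longleftrightarrow> adj q p"
  unfolding adj_def by blast

lemma finite_adj: "finite {q. adj p q}" and card_adj: "card {q. adj p q} \<le> deg"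
  using finite_neighbours[of p] card_neighbours[of p] unfolding adj_def by auto

lemma comp_self: "p \<in> comp p \<omega>"
  unfolding comp_def by auto

lemma comp_subset: "p \<in> \<omega> \<Longrightarrow> comp p \<omega> \<subseteq> \<omega>"
  unfolding comp_def by (auto elim: rtranclp.cases)

lemma comp_step: "u \<in> comp p \<omega> \<Longrightarrow> adj u v \<Longrightarrow> v \<in> \<omega> \<Longrightarrow> v \<in> comp p \<omega>"
  unfolding comp_def by (auto intro: rtranclp.rtrancl_into_rtrancl)

lemma comp_least:
  assumes "p \<in> T" "\<And>u v. u \<in> T \<Longrightarrow> adj u v \<Longrightarrow> v \<in> \<omega> \<Longrightarrow> v \<in> T"
  shows "comp p \<omega> \<subseteq> T"
proof
  fix q assume "q \<in> comp p \<omega>"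
  hence "(\<lambda>u v. adj u v \<and> v \<in> \<omega>)\<^sup>*\<^sup>* p q" unfolding comp_def by simp
  thus "q \<in> T" using assms by (induction rule: rtranclp_induct) auto
qed

lemma comp_mono: "\<omega> \<subseteq> \<omega>' \<Longrightarrow> comp p \<omega> \<subseteq> comp p \<omega>'"
  by (rule comp_least) (auto intro: comp_self comp_step)

lemma comp_idem: "comp p (comp p \<omega>) = comp p \<omega>" if "p \<in> \<omega>"
proof
  show "comp p (comp p \<omega>) \<subseteq> comp p \<omega>" using comp_self by (intro comp_subset)
  show "comp p \<omega> \<subseteq> comp p (comp p \<omega>)"
    by (rule comp_least)
       (meson comp_self comp_step comp_mono comp_subset subsetD that)+
qed

text \<open>If a cube meets the component in u, all its other points are neighbours of u. So it
  contains the same points of the component as of \<omega>, and the parity is inherited.\<close>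

lemma even_on_cubes_comp:
  assumes "even_on_cubes \<omega>" "p \<in> \<omega>"
  shows "even_on_cubes (comp p \<omega>)"
  unfolding even_on_cubes_def
proof
  fix c assume c: "c \<in> cubes"
  show "even (card (comp p \<omega> \<inter> c))"
  proof (cases "comp p \<omega> \<inter> c = {}")
    case False
    then obtain u where u: "u \<in> comp p \<omega>" "u \<in> c" by auto
    have "v \<in> comp p \<omega>" if "v \<in> \<omega>" "v \<in> c" for v
      using comp_step[OF u(1), of v] u c that unfolding adj_def by (cases "u = v") auto
    hence "comp p \<omega> \<inter> c = \<omega> \<inter> c" using comp_subset[OF assms(2)] by auto
    thus ?thesis using assms(1) c unfolding even_on_cubes_def by simp
  qed simp
qed

lemma even_on_cubes_Un:
  assumes "even_on_cubes \<omega>" "even_on_cubes \<omega>'" "\<omega> \<inter> \<omega>' = {}" "finite \<omega>" "finite \<omega>'"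
  shows "even_on_cubes (\<omega> \<union> \<omega>')"
  unfolding even_on_cubes_def
proof
  fix c assume c: "c \<in> cubes"
  have "card ((\<omega> \<union> \<omega>') \<inter> c) = card (\<omega> \<inter> c) + card (\<omega>' \<inter> c)"
    using assms by (subst card_Un_disjoint[symmetric]) (auto simp: Int_Un_distrib2)
  thus "even (card ((\<omega> \<union> \<omega>') \<inter> c))"
    using assms c unfolding even_on_cubes_def by simp
qed

lemma even_on_cubes_Diff:
  assumes "even_on_cubes \<omega>" "even_on_cubes \<gamma>" "\<gamma> \<subseteq> \<omega>" "finite \<omega>"
  shows "even_on_cubes (\<omega> - \<gamma>)"
  unfolding even_on_cubes_def
proof
  fix c assume c: "c \<in> cubes"
  have fin: "finite \<gamma>" using assms finite_subset by blast
  have "card (\<omega> \<inter> c) = card ((\<omega> - \<gamma>) \<inter> c) + card (\<gamma> \<inter> c)"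
    using assms fin by (subst card_Un_disjoint[symmetric]) (auto intro: arg_cong[where f=card])
  thus "even (card ((\<omega> - \<gamma>) \<inter> c))"
    using assms c unfolding even_on_cubes_def by (metis even_add)
qed

lemma finite_polymers: "finite \<Lambda> \<Longrightarrow> finite (polymers p \<Lambda>)"
  by (rule finite_subset[of _ "Pow \<Lambda>"]) (auto simp: polymers_def)

text \<open>A closed set through p splits uniquely into the component of p and a closed set that
  avoids the neighbourhood of this component; sign and weight are multiplicative over the split. The
  closed sets avoiding p give the first term.\<close>

lemma Z_remove:
  assumes fin: "finite \<Lambda>" and p: "p \<in> \<Lambda>"
  shows "Z q \<Lambda> = Z q (\<Lambda> - {p}) +
    (\<Sum>\<gamma>\<in>polymers p \<Lambda>. (-1) ^ card (\<gamma> \<inter> q) * x ^ card \<gamma> * Z q (\<Lambda> - nbhd \<gamma>))"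
proof -
  let ?w = "\<lambda>\<omega>. (-1) ^ card (\<omega> \<inter> q) * x ^ card \<omega>"
  let ?S = "\<lambda>\<Lambda>. {\<omega>. \<omega> \<subseteq> \<Lambda> \<and> even_on_cubes \<omega>}"
  let ?T = "{\<omega>. \<omega> \<subseteq> \<Lambda> \<and> even_on_cubes \<omega> \<and> p \<in> \<omega>}"
  have finS: "finite (?S L)" if "L \<subseteq> \<Lambda>" for L
    using fin that by (intro finite_subset[of "?S L" "Pow \<Lambda>"]) auto
  have "?S \<Lambda> = ?S (\<Lambda> - {p}) \<union> ?T" by auto
  hence "Z q \<Lambda> = sum ?w (?S (\<Lambda> - {p}) \<union> ?T)" unfolding Z_def by simp
  also have "\<dots> = sum ?w (?S (\<Lambda> - {p})) + sum ?w ?T"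
    using finS[of "\<Lambda> - {p}"] finS[of \<Lambda>]
    by (intro sum.union_disjoint) (auto intro: finite_subset[of ?T "?S \<Lambda>"])
  also have "sum ?w ?T = (\<Sum>(\<gamma>, \<omega>)\<in>(SIGMA \<gamma>:polymers p \<Lambda>. ?S (\<Lambda> - nbhd \<gamma>)). ?w \<gamma> * ?w \<omega>)"
  proof (rule sum.reindex_bij_witness[where j = "\<lambda>\<omega>. (comp p \<omega>, \<omega> - comp p \<omega>)" and i = "\<lambda>(\<gamma>, \<omega>). \<gamma> \<union> \<omega>"])
    fix \<omega> assume w: "\<omega> \<in> ?T"
    let ?c = "comp p \<omega>"
    have sub: "?c \<subseteq> \<omega>" and finw: "finite \<omega>"
      using w comp_subset fin finite_subset by auto
    show "(case (?c, \<omega> - ?c) of (\<gamma>, \<omega>) \<Rightarrow> \<gamma> \<union> \<omega>) = \<omega>" using sub by auto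
    have "?c \<in> polymers p \<Lambda>"
      using w sub comp_self comp_idem[of p \<omega>] even_on_cubes_comp[of \<omega> p] unfolding polymers_def by auto
    moreover have "\<omega> - ?c \<subseteq> \<Lambda> - nbhd ?c"
      using w comp_step unfolding nbhd_def by blast
    moreover have "even_on_cubes (\<omega> - ?c)"
      using w sub finw even_on_cubes_comp by (intro even_on_cubes_Diff) auto
    ultimately show "(?c, \<omega> - ?c) \<in> (SIGMA \<gamma>:polymers p \<Lambda>. ?S (\<Lambda> - nbhd \<gamma>))" by auto
    have finc: "finite ?c" using finw sub finite_subset by auto
    have e: "\<omega> = ?c \<union> (\<omega> - ?c)" using sub by auto
    have c1: "card \<omega> = card ?c + card (\<omega> - ?c)"
      using sub finw finc by (metis add_diff_inverse_nat card_Diff_subset card_mono not_le)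
    have "card (\<omega> \<inter> q) = card (?c \<inter> q) + card ((\<omega> - ?c) \<inter> q)"
      using sub finw finc by (subst card_Un_disjoint[symmetric]) (auto intro: arg_cong[where f=card])
    thus "(case (?c, \<omega> - ?c) of (\<gamma>, \<omega>) \<Rightarrow> ?w \<gamma> * ?w \<omega>) = ?w \<omega>"
      using c1 by (simp add: power_add)
  next
    fix b assume "b \<in> (SIGMA \<gamma>:polymers p \<Lambda>. ?S (\<Lambda> - nbhd \<gamma>))"
    then obtain \<gamma> \<omega> where b: "b = (\<gamma>, \<omega>)" and g: "\<gamma> \<in> polymers p \<Lambda>" and w: "\<omega> \<subseteq> \<Lambda> - nbhd \<gamma>" "even_on_cubes \<omega>"
      by auto
    have g': "\<gamma> \<subseteq> \<Lambda>" "p \<in> \<gamma>" "even_on_cubes \<gamma>" "comp p \<gamma> = \<gamma>" using g unfolding polymers_def by auto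
    have disj: "\<gamma> \<inter> \<omega> = {}" using w unfolding nbhd_def by auto
    have "comp p (\<gamma> \<union> \<omega>) \<subseteq> \<gamma>"
      using g' w unfolding nbhd_def by (intro comp_least) auto
    moreover have "\<gamma> \<subseteq> comp p (\<gamma> \<union> \<omega>)" using comp_mono[of \<gamma> "\<gamma> \<union> \<omega>" p] g' by auto
    ultimately have c: "comp p (\<gamma> \<union> \<omega>) = \<gamma>" by auto
    show "(comp p (case b of (\<gamma>, \<omega>) \<Rightarrow> \<gamma> \<union> \<omega>), (case b of (\<gamma>, \<omega>) \<Rightarrow> \<gamma> \<union> \<omega>) - comp p (case b of (\<gamma>, \<omega>) \<Rightarrow> \<gamma> \<union> \<omega>)) = b"
      using b c disj by auto
    have "finite \<gamma>" "finite \<omega>" using fin g' w finite_subset by blast+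
    thus "(case b of (\<gamma>, \<omega>) \<Rightarrow> \<gamma> \<union> \<omega>) \<in> ?T"
      using b g' w disj even_on_cubes_Un[of \<gamma> \<omega>] by auto
  qed
  also have "\<dots> = (\<Sum>\<gamma>\<in>polymers p \<Lambda>. \<Sum>\<omega>\<in>?S (\<Lambda> - nbhd \<gamma>). ?w \<gamma> * ?w \<omega>)"
    using finite_polymers[OF fin] finS by (subst sum.Sigma) auto
  finally show ?thesis unfolding Z_def by (simp add: sum_distrib_left)
qed

section \<open>Counting connected sets by walks\<close>

text \<open>Every connected set containing \<open>p\<close> is traced out by a walk that goes along each edge of
  a spanning tree twice.\<close>

fun walks :: "'p \<Rightarrow> nat \<Rightarrow> 'p list set" where
  "walks p 0 = {[p]}"
| "walks p (Suc k) = (\<Union>q\<in>{q. adj p q}. (#) p ` walks q k)"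

lemma finite_walks: "finite (walks p k)"
  by (induction k arbitrary: p) (auto intro: finite_adj)

lemma card_walks: "card (walks p k) \<le> deg ^ k"
proof (induction k arbitrary: p)
  case (Suc k)
  have "card (walks p (Suc k)) \<le> (\<Sum>q\<in>{q. adj p q}. card ((#) p ` walks q k))"
    using finite_adj by (simp add: card_UN_le)
  also have "\<dots> \<le> (\<Sum>q\<in>{q. adj p q}. deg ^ k)"
    by (intro sum_mono order.trans[OF card_image_le Suc.IH] finite_walks)
  also have "\<dots> \<le> deg * deg ^ k" using card_adj by simp
  finally show ?case by simp
qed simp

lemma walks_hd: "xs \<in> walks p k \<Longrightarrow> \<exists>ys. xs = p # ys"
  by (cases k) auto

lemma walks_Cons: "adj p q \<Longrightarrow> xs \<in> walks q l \<Longrightarrow> p # xs \<in> walks p (Suc l)"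
  by auto

text \<open>An excursion w, u, w at a visited point costs two steps and keeps the rest of the walk;
  a spanning tree is grown in this way one leaf at a time.\<close>

lemma walks_detour:
  assumes "xs @ w # ys \<in> walks p k" "adj w u"
  shows "xs @ w # u # w # ys \<in> walks p (k + 2)"
  using assms(1)
proof (induction xs arbitrary: p k)
  case Nil
  hence "p = w" using walks_hd by fastforce
  thus ?case using Nil assms(2) adj_sym[of w u] by auto
next
  case (Cons z xs)
  show ?case
  proof (cases k)
    case 0
    thus ?thesis using Cons.prems by simp
  next
    case (Suc l)
    then obtain q where q: "adj p q" "xs @ w # ys \<in> walks q l" "z = p" using Cons.prems by auto
    show ?thesis using walks_Cons[OF q(1) Cons.IH[OF q(2)]] q(3) Suc by (simp del: walks.simps)
  qed
qed

text \<open>Converts the length of a walk, and so the size of a polymer, into a bound on how far it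
  reaches; \<open>d\<close> will be a lattice coordinate up to sign and shift.\<close>

lemma walk_lipschitz:
  fixes d :: "'p \<Rightarrow> real"
  assumes "\<And>u v. adj u v \<Longrightarrow> d u \<le> d v + 1"
    and "xs \<in> walks p k" "v \<in> set xs"
  shows "d p \<le> d v + real k"
  using assms(2,3)
proof (induction k arbitrary: p xs)
  case (Suc k)
  then obtain q ys where q: "adj p q" "ys \<in> walks q k" "xs = p # ys" by auto
  show ?case
  proof (cases "v = p")
    case False
    hence "d q \<le> d v + real k" using Suc q by auto
    thus ?thesis using assms(1)[OF q(1)] by simp
  qed auto
qed simp

lemma spanning_walk:
  assumes "finite \<gamma>" "p \<in> \<gamma>" "comp p \<gamma> = \<gamma>"
  shows "\<exists>xs\<in>walks p (2 * (card \<gamma> - 1)). set xs = \<gamma>"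
proof -
  have *: "\<exists>T\<subseteq>\<gamma>. card T = Suc k \<and> p \<in> T \<and> (\<exists>xs\<in>walks p (2 * k). set xs = T)" if "k < card \<gamma>" for k
    using that
  proof (induction k)
    case 0
    show ?case using assms(2) by (intro exI[of _ "{p}"]) auto
  next
    case (Suc k)
    then obtain T xs where T: "T \<subseteq> \<gamma>" "card T = Suc k" "p \<in> T" "xs \<in> walks p (2 * k)" "set xs = T"
      by auto
    have "\<not> \<gamma> \<subseteq> T" using T Suc.prems assms(1) by (metis card_mono finite_subset leD)
    \<comment> \<open>If no point of \<gamma> outside T were adjacent to T, then
      \<open>comp_least\<close> would put all of \<gamma> inside T.\<close>
    then obtain w u where wu: "w \<in> T" "adj w u" "u \<in> \<gamma>" "u \<notin> T"
      using comp_least[of p T \<gamma>] T(3) assms(3) by auto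
    obtain as bs where ab: "xs = as @ w # bs" using wu T by (metis split_list)
    have fT: "finite T" using T(1) assms(1) finite_subset by blast
    have "as @ w # u # w # bs \<in> walks p (2 * Suc k)" using walks_detour[of as w bs p "2 * k" u] T ab wu by simp
    moreover have "set (as @ w # u # w # bs) = insert u T" using T ab by auto
    moreover have "card (insert u T) = Suc (Suc k)" using T wu fT by simp
    ultimately show ?case using T(1,3) wu(3)
      by (intro exI[of _ "insert u T"] conjI bexI[of _ "as @ w # u # w # bs"]) auto
  qed
  have pos: "card \<gamma> > 0" using assms card_gt_0_iff by blast
  obtain T where T: "T \<subseteq> \<gamma>" "card T = Suc (card \<gamma> - 1)" "\<exists>xs\<in>walks p (2 * (card \<gamma> - 1)). set xs = T"
    using *[of "card \<gamma> - 1"] pos by (meson diff_less zero_less_one)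
  have "T = \<gamma>" using pos T assms(1) by (intro card_subset_eq) auto
  thus ?thesis using T(3) by simp
qed

text \<open>A polymer is the set of points on its spanning walk. The exponent is 2 (n - 1) rather
  than 2 n, and the factor deg^2 saved here is the denominator in \<open>sum_polymers_le\<close> on
  which the later inductions depend.\<close>

lemma card_polymers:
  assumes "finite \<Lambda>"
  shows "card {\<gamma>\<in>polymers p \<Lambda>. card \<gamma> = n} \<le> deg ^ (2 * (n - 1))"
proof -
  have "{\<gamma>\<in>polymers p \<Lambda>. card \<gamma> = n} \<subseteq> set ` walks p (2 * (n - 1))"
  proof
    fix \<gamma> assume "\<gamma> \<in> {\<gamma>\<in>polymers p \<Lambda>. card \<gamma> = n}"
    hence "p \<in> \<gamma>" "comp p \<gamma> = \<gamma>" "finite \<gamma>" "card \<gamma> = n"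
      using assms finite_subset unfolding polymers_def by auto
    thus "\<gamma> \<in> set ` walks p (2 * (n - 1))" using spanning_walk[of \<gamma> p] by auto
  qed
  hence "card {\<gamma>\<in>polymers p \<Lambda>. card \<gamma> = n} \<le> card (set ` walks p (2 * (n - 1)))"
    by (intro card_mono finite_imageI finite_walks)
  also have "\<dots> \<le> deg ^ (2 * (n - 1))"
    using card_image_le[OF finite_walks] card_walks le_trans by blast
  finally show ?thesis .
qed

text \<open>Of the factor \<open>exp (-2/3)\<close> per plaquette that the entropy leaves over, \<open>exp (-1/4)\<close> pays for
  removing the neighbourhood of a polymer, at cost \<open>1 / (4 (deg + 1))\<close> per plaquette, and
  \<open>exp (-1/60)\<close> for the decay; so \<open>4/15 = 1/4 + 1/60\<close>, and \<open>exp (-2/5)\<close> remains.\<close>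

lemma sum_polymers_le:
  assumes fin: "finite \<Lambda>" and nn: "\<kappa>0 \<ge> 0" "\<kappa>1 \<ge> 0"
  shows "(\<Sum>\<gamma>\<in>polymers p \<Lambda>. (x * exp (4/15)) ^ card \<gamma> * (\<kappa>1 * real (card \<gamma>) + \<kappa>0))
    \<le> (\<kappa>1 * (25/4) + \<kappa>0 * (41/20)) / real deg ^ 2"
proof -
  define y :: real where "y = exp (-2/5)"
  \<comment> \<open>Two cases occur later: \<kappa>1 = 0, \<kappa>0 = 1 for the size of a ratio, and
    \<kappa>1 = deg + 1, \<kappa>0 = 2 for its dependence on the signs.\<close>
  define h where "h n = (x * exp (4/15)) ^ n * (\<kappa>1 * real n + \<kappa>0)" for n
  have h_nn: "h n \<ge> 0" for n using nn x_pos unfolding h_def by simp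
  have D: "real deg > 0" using deg_ge by simp
  \<comment> \<open>Four terms of the exponential series give 1.4906..., so y \<le> 1 / 1.49 <
    0.672.\<close>
  have "(\<Sum>n\<le>3. inverse (fact n) * (2/5::real) ^ n) \<le> exp (2/5)"
    using sum_le_suminf[of "\<lambda>n. inverse (fact n) * (2/5::real) ^ n" "{..3}"]
    by (auto simp: exp_def summable_exp)
  hence e: "exp (2/5::real) \<ge> 1.49" by (simp add: numeral_eq_Suc fact_numeral)
  have y: "y \<ge> 0" "y \<le> 0.672"
  proof -
    have "y = 1 / exp (2/5)" unfolding y_def by (simp add: exp_minus field_simps)
    also have "\<dots> \<le> 1 / 1.49" using e by (intro divide_left_mono) auto
    finally show "y \<le> 0.672" by simp
  qed (simp add: y_def)
  \<comment> \<open>41/20 and 25/4 are the values of y / (1 - y) and y / (1 - y)^2 at y = 0.672,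
    rounded up.\<close>
  have S0: "(\<Sum>n=1..M. y ^ n) \<le> (41/20)" for M
  proof -
    have "(\<Sum>n=1..M. y ^ n) \<le> y / (1 - y)" using y by (intro sum_power_le) auto
    also have "\<dots> \<le> (41/20)" using y by (simp add: field_simps)
    finally show ?thesis .
  qed
  have S1: "(\<Sum>n=1..M. real n * y ^ n) \<le> (25/4)" for M
  proof -
    have "(\<Sum>n=1..M. real n * y ^ n) \<le> y / (1 - y)\<^sup>2" using y by (intro sum_nat_power_le) auto
    also have "\<dots> \<le> 0.672 / (0.328)\<^sup>2"
      using y by (intro frac_le power_mono) auto
    also have "\<dots> \<le> (25/4)" by (simp add: power2_eq_square)
    finally show ?thesis .
  qed
  have xy: "x * exp (4/15) * real deg ^ 2 \<le> y"
  proof -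
    have "x * exp (4/15) * real deg ^ 2 = (x * real deg ^ 2) * exp (4/15)" by simp
    also have "\<dots> \<le> exp (-2/3) * exp (4/15)" using x_small by (intro mult_right_mono) auto
    also have "\<dots> = y" unfolding y_def by (simp add: exp_add[symmetric])
    finally show ?thesis .
  qed
  have summand: "real deg ^ (2 * (n - 1)) * h n \<le> (\<kappa>1 * (real n * y ^ n) + \<kappa>0 * y ^ n) / real deg ^ 2"
    if "n \<ge> 1" for n
  proof -
    obtain l where l: "n = Suc l" using \<open>n \<ge> 1\<close> by (cases n) auto
    have "real deg ^ (2 * (n - 1)) * h n * real deg ^ 2 = (x * exp (4/15) * real deg ^ 2) ^ n * (\<kappa>1 * real n + \<kappa>0)"
      unfolding h_def l by (simp add: power_mult_distrib power_mult[symmetric] mult_ac)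
    also have "\<dots> \<le> y ^ n * (\<kappa>1 * real n + \<kappa>0)"
      using xy x_pos nn by (intro mult_right_mono power_mono) auto
    finally show ?thesis using D by (simp add: field_simps)
  qed
  have "(\<Sum>\<gamma>\<in>polymers p \<Lambda>. h (card \<gamma>)) = (\<Sum>n\<in>{1..card \<Lambda>}. \<Sum>\<gamma>\<in>{\<gamma>\<in>polymers p \<Lambda>. card \<gamma> = n}. h (card \<gamma>))"
  proof (rule sum.group[symmetric])
    show "card ` polymers p \<Lambda> \<subseteq> {1..card \<Lambda>}"
      using fin by (auto simp: polymers_def Suc_le_eq card_gt_0_iff intro: card_mono dest: finite_subset)
  qed (use fin finite_polymers in auto)
  also have "\<dots> = (\<Sum>n\<in>{1..card \<Lambda>}. real (card {\<gamma>\<in>polymers p \<Lambda>. card \<gamma> = n}) * h n)"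
    by (intro sum.cong refl) simp
  also have "\<dots> \<le> (\<Sum>n\<in>{1..card \<Lambda>}. real deg ^ (2 * (n - 1)) * h n)"
  proof (intro sum_mono mult_right_mono h_nn)
    fix n
    show "real (card {\<gamma> \<in> polymers p \<Lambda>. card \<gamma> = n}) \<le> real deg ^ (2 * (n - 1))"
      using card_polymers[OF fin, of p n] by (metis of_nat_le_iff of_nat_power)
  qed
  also have "\<dots> \<le> (\<Sum>n\<in>{1..card \<Lambda>}. (\<kappa>1 * (real n * y ^ n) + \<kappa>0 * y ^ n) / real deg ^ 2)"
    using summand by (intro sum_mono) auto
  also have "\<dots> = (\<kappa>1 * (\<Sum>n\<in>{1..card \<Lambda>}. real n * y ^ n) + \<kappa>0 * (\<Sum>n\<in>{1..card \<Lambda>}. y ^ n)) / real deg ^ 2"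
    by (simp add: sum_divide_distrib[symmetric] sum.distrib sum_distrib_left)
  also have "\<dots> \<le> (\<kappa>1 * (25/4) + \<kappa>0 * (41/20)) / real deg ^ 2"
    using S0 S1 nn D by (intro divide_right_mono add_mono mult_left_mono) auto
  finally show ?thesis unfolding h_def .
qed

section \<open>Ratios of partition functions\<close>

lemma card_nbhd_le:
  assumes "finite \<gamma>"
  shows "finite (nbhd \<gamma>)" "card (nbhd \<gamma>) \<le> (deg + 1) * card \<gamma>"
proof -
  have e: "nbhd \<gamma> = (\<Union>p\<in>\<gamma>. insert p {q. adj p q})" unfolding nbhd_def by auto
  show "finite (nbhd \<gamma>)" unfolding e using assms finite_adj by auto
  have "card (nbhd \<gamma>) \<le> (\<Sum>p\<in>\<gamma>. card (insert p {q. adj p q}))" unfolding e by (rule card_UN_le[OF assms])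
  also have "\<dots> \<le> (\<Sum>p\<in>\<gamma>. deg + 1)"
    by (intro sum_mono) (use card_adj in \<open>simp add: card_insert_if finite_adj le_SucI\<close>)
  finally show "card (nbhd \<gamma>) \<le> (deg + 1) * card \<gamma>" by (simp add: mult.commute)
qed

definition b :: real where "b = 1 / (4 * (real deg + 1))"

lemma b_nonneg: "b \<ge> 0" unfolding b_def by simp

lemma b_card_nbhd:
  assumes "finite \<gamma>" "M \<subseteq> nbhd \<gamma>"
  shows "b * real (card M) \<le> real (card \<gamma>) / 4"
proof -
  have "card M \<le> (deg + 1) * card \<gamma>"
    using card_mono[OF card_nbhd_le(1)[OF assms(1)] assms(2)] card_nbhd_le(2)[OF assms(1)] by simp
  hence "real (card M) \<le> (real deg + 1) * real (card \<gamma>)"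
    by (metis of_nat_1 of_nat_add of_nat_le_iff of_nat_mult)
  thus ?thesis unfolding b_def by (simp add: field_simps)
qed

text \<open>The inequality that closes the induction for the ratios. Since exp (-b) \<le> 1 / (1 +
  b), the right side is at least b / (1 + b) = 1 / (4 deg + 5); at deg = 10 this amounts to 92.25
  \<le> 100.\<close>

lemma b_small: "(41/20) / real deg ^ 2 \<le> 1 - exp (-b)"
proof -
  have D: "real deg \<ge> 10" using deg_ge by simp
  have "exp (-b) \<le> 1 / (1 + b)"
    using exp_ge_add_one_self[of b] b_nonneg by (simp add: exp_minus field_simps)
  hence "1 - exp (-b) \<ge> b / (1 + b)" using b_nonneg by (simp add: field_simps)
  moreover have "b / (1 + b) = 1 / (4 * real deg + 5)"
    unfolding b_def using D by (simp add: field_simps)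
  moreover have "(41/20) * (4 * real deg + 5) \<le> real deg ^ 2"
    using mult_right_mono[OF D of_nat_0_le_iff[of deg]] D unfolding power2_eq_square by argo
  hence "(41/20) / real deg ^ 2 \<le> 1 / (4 * real deg + 5)"
    using D by (simp add: field_simps)
  ultimately show ?thesis by linarith
qed

text \<open>Positivity and the ratio bound go together: the step takes logarithms in smaller
  volumes, and a signed sum might cancel. In \<open>Z_remove\<close>, divided by the sum without p,
  the term of a polymer with n points is at most x^n exp (n / 4) in absolute value, because the
  induction hypothesis prices the removal of its neighbourhood plaquette by plaquette.\<close>

lemma Z_ratio_bounds:
  assumes "finite \<Lambda>"
  shows "Z q \<Lambda> > 0 \<and> (\<forall>p\<in>\<Lambda>. \<bar>ln (Z q \<Lambda>) - ln (Z q (\<Lambda> - {p}))\<bar> \<le> b)"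
  using assms
proof (induction \<Lambda> rule: finite_psubset_induct)
  case (psubset \<Lambda>)
  have ratio: "\<bar>Z q \<Lambda> / Z q (\<Lambda> - {p}) - 1\<bar> \<le> 1 - exp (-b)" and pos': "Z q (\<Lambda> - {p}) > 0" if p: "p \<in> \<Lambda>" for p
  proof -
    let ?L = "\<Lambda> - {p}"
    have good: "Z q L > 0" "\<And>p'. p' \<in> L \<Longrightarrow> \<bar>ln (Z q L) - ln (Z q (L - {p'}))\<bar> \<le> b" if "L \<subseteq> ?L" for L
      using psubset.IH[of L] that p by auto
    show pos: "Z q ?L > 0" using good by auto
    have rho: "Z q (\<Lambda> - nbhd \<gamma>) / Z q ?L \<le> exp (real (card \<gamma>) / 4)"
              "Z q (\<Lambda> - nbhd \<gamma>) > 0" if "\<gamma> \<in> polymers p \<Lambda>" for \<gamma>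
    proof -
      let ?M = "nbhd \<gamma> \<inter> ?L"
      have fing: "finite \<gamma>" and pin: "p \<in> nbhd \<gamma>"
        using that psubset.hyps finite_subset unfolding polymers_def nbhd_def by auto
      \<comment> \<open>As p lies in its own polymer, the volume is reached from \<Lambda> - {p},
        where the induction hypothesis is available.\<close>
      have e: "\<Lambda> - nbhd \<gamma> = ?L - ?M" using pin by auto
      show pos2: "Z q (\<Lambda> - nbhd \<gamma>) > 0" unfolding e by (rule good(1)) auto
      have "\<bar>ln (Z q ?L) - ln (Z q (?L - ?M))\<bar> \<le> (\<Sum>p\<in>?M. b)"
        using psubset.hyps by (intro abs_diff_le_sum_removed[where F = "\<lambda>L. ln (Z q L)"] good(2)) auto
      also have "\<dots> = b * real (card ?M)" by simp
      also have "\<dots> \<le> real (card \<gamma>) / 4" using fing by (intro b_card_nbhd) auto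
      finally have "ln (Z q (\<Lambda> - nbhd \<gamma>)) - ln (Z q ?L) \<le> real (card \<gamma>) / 4" unfolding e by linarith
      hence "ln (Z q (\<Lambda> - nbhd \<gamma>) / Z q ?L) \<le> real (card \<gamma>) / 4"
        using pos pos2 by (simp add: ln_div)
      hence "exp (ln (Z q (\<Lambda> - nbhd \<gamma>) / Z q ?L)) \<le> exp (real (card \<gamma>) / 4)" by simp
      thus "Z q (\<Lambda> - nbhd \<gamma>) / Z q ?L \<le> exp (real (card \<gamma>) / 4)" using pos pos2 by simp
    qed
    have eq: "Z q \<Lambda> / Z q ?L - 1 = (\<Sum>\<gamma>\<in>polymers p \<Lambda>. (-1) ^ card (\<gamma> \<inter> q) * x ^ card \<gamma> * (Z q (\<Lambda> - nbhd \<gamma>) / Z q ?L))"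
      using pos by (subst Z_remove[OF psubset.hyps p]) (simp add: field_simps sum_divide_distrib)
    have "\<bar>Z q \<Lambda> / Z q ?L - 1\<bar> \<le> (\<Sum>\<gamma>\<in>polymers p \<Lambda>. \<bar>(-1) ^ card (\<gamma> \<inter> q) * x ^ card \<gamma> * (Z q (\<Lambda> - nbhd \<gamma>) / Z q ?L)\<bar>)"
      unfolding eq by (rule sum_abs)
    also have "\<dots> \<le> (\<Sum>\<gamma>\<in>polymers p \<Lambda>. (x * exp (4/15)) ^ card \<gamma> * (0 * real (card \<gamma>) + 1))"
    proof (intro sum_mono)
      fix \<gamma> assume g: "\<gamma> \<in> polymers p \<Lambda>"
      have "\<bar>(-1) ^ card (\<gamma> \<inter> q) * x ^ card \<gamma> * (Z q (\<Lambda> - nbhd \<gamma>) / Z q ?L)\<bar> = x ^ card \<gamma> * (Z q (\<Lambda> - nbhd \<gamma>) / Z q ?L)"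
        using x_pos pos rho(2)[OF g] by (simp add: abs_mult)
      also have "\<dots> \<le> x ^ card \<gamma> * exp (real (card \<gamma>) / 4)"
        using rho(1)[OF g] x_pos by (intro mult_left_mono) simp_all
      \<comment> \<open>Weakening 1/4 to 4/15 brings the sum into the form of
        \<open>sum_polymers_le\<close>, which is shared with the decay estimate.\<close>
      also have "\<dots> \<le> x ^ card \<gamma> * exp (real (card \<gamma>) * (4/15))"
        using x_pos by (intro mult_left_mono) auto
      also have "\<dots> = (x * exp (4/15)) ^ card \<gamma>"
        by (simp only: power_mult_distrib exp_of_nat_mult)
      finally show "\<bar>(-1) ^ card (\<gamma> \<inter> q) * x ^ card \<gamma> * (Z q (\<Lambda> - nbhd \<gamma>) / Z q ?L)\<bar> \<le> (x * exp (4/15)) ^ card \<gamma> * (0 * real (card \<gamma>) + 1)"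
        by simp
    qed
    also have "\<dots> \<le> (0 * (25/4) + 1 * (41/20)) / real deg ^ 2"
      by (rule sum_polymers_le[OF psubset.hyps]) auto
    also have "\<dots> \<le> 1 - exp (-b)" using b_small by simp
    finally show "\<bar>Z q \<Lambda> / Z q ?L - 1\<bar> \<le> 1 - exp (-b)" .
  qed
  show ?case
  proof (cases "\<Lambda> = {}")
    case True
    have "{\<omega>. \<omega> = {} \<and> even_on_cubes \<omega>} = {{}}" by (auto simp: even_on_cubes_def)
    thus ?thesis using True by (simp add: Z_def)
  next
    case False
    have r: "Z q \<Lambda> / Z q (\<Lambda> - {p}) \<ge> exp (-b)" "Z q \<Lambda> / Z q (\<Lambda> - {p}) \<le> exp b" if "p \<in> \<Lambda>" for p
    proof -
      \<comment> \<open>Turns the upper bound 2 - exp (-b) on the ratio into exp b.\<close>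
      have "exp (-b) + exp b \<ge> 2"
      proof -
        have "0 \<le> (exp (b/2) - exp (-b/2))\<^sup>2" by simp
        also have "\<dots> = exp (-b) + exp b - 2"
          by (simp add: power2_eq_square algebra_simps exp_add[symmetric])
        finally show ?thesis by simp
      qed
      thus "Z q \<Lambda> / Z q (\<Lambda> - {p}) \<ge> exp (-b)" "Z q \<Lambda> / Z q (\<Lambda> - {p}) \<le> exp b"
        using ratio[OF that] by auto
    qed
    have pos: "Z q \<Lambda> > 0"
    proof -
      obtain p where p: "p \<in> \<Lambda>" using False by auto
      have "Z q \<Lambda> / Z q (\<Lambda> - {p}) > 0" using r(1)[OF p] by (rule less_le_trans[OF exp_gt_zero])
      thus ?thesis using pos'[OF p] by (simp add: zero_less_divide_iff)
    qed
    have "\<bar>ln (Z q \<Lambda>) - ln (Z q (\<Lambda> - {p}))\<bar> \<le> b" if p: "p \<in> \<Lambda>" for p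
    proof -
      have q: "Z q \<Lambda> / Z q (\<Lambda> - {p}) > 0" using pos pos'[OF p] by simp
      have "- b \<le> ln (Z q \<Lambda> / Z q (\<Lambda> - {p}))" using r(1)[OF p] q by (simp add: ln_ge_iff)
      moreover have "ln (Z q \<Lambda> / Z q (\<Lambda> - {p})) \<le> b"
        using r(2)[OF p] q by (metis exp_gt_zero ln_exp ln_le_cancel_iff)
      ultimately show ?thesis using pos pos'[OF p] by (simp add: ln_div abs_le_iff)
    qed
    thus ?thesis using pos by auto
  qed
qed

lemma Z_pos: "finite \<Lambda> \<Longrightarrow> Z q \<Lambda> > 0"
  and ln_Z_remove: "finite \<Lambda> \<Longrightarrow> p \<in> \<Lambda> \<Longrightarrow> \<bar>ln (Z q \<Lambda>) - ln (Z q (\<Lambda> - {p}))\<bar> \<le> b"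
  using Z_ratio_bounds by auto

text \<open>Both ratios are expanded over the same polymers. A polymer that misses the difference of
  q1 and q2 has equal signs, and its two factors differ only through smaller volumes, where the
  induction hypothesis applies; one that meets the difference must be large if d p is. From p to the
  neighbourhood of a polymer with n points \<open>d\<close> drops by at most 2 n, so the rate 1/120
  costs exp (n / 60). The bound has constant 1, and the induction must reproduce it without
  loss.\<close>

lemma ln_Z_ratio_decay:
  fixes d :: "'p \<Rightarrow> real"
  assumes fin: "finite \<Lambda>" and p: "p \<in> \<Lambda>"
    and lip: "\<And>u v. adj u v \<Longrightarrow> d u \<le> d v + 1"
    and far: "\<And>u. u \<in> sym_diff q1 q2 \<Longrightarrow> d u \<le> 0"
  shows "\<bar>(ln (Z q1 \<Lambda>) - ln (Z q2 \<Lambda>)) - (ln (Z q1 (\<Lambda> - {p})) - ln (Z q2 (\<Lambda> - {p})))\<bar> \<le> exp (- d p / 120)"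
  using fin p
proof (induction \<Lambda> arbitrary: p rule: finite_psubset_induct)
  case (psubset \<Lambda>)
  note p = psubset.prems
  let ?F = "\<lambda>L. ln (Z q1 L) - ln (Z q2 L)"
  let ?L = "\<Lambda> - {p}"
  define \<rho> where "\<rho> q \<gamma> = Z q (\<Lambda> - nbhd \<gamma>) / Z q ?L" for q \<gamma>
  define r where "r q = Z q \<Lambda> / Z q ?L" for q
  have finL: "finite ?L" using psubset.hyps by simp
  have pos: "Z q L > 0" if "L \<subseteq> \<Lambda>" for q L using that psubset.hyps Z_pos finite_subset by blast
  have step: "\<bar>?F L - ?F (L - {u})\<bar> \<le> exp (- d u / 120)" if "L \<subseteq> ?L" "u \<in> L" for L u
    using psubset.IH[of L u] that p by auto
  \<comment> \<open>At most 2 (n - 1) steps inside \<gamma>, and one more into its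
    neighbourhood.\<close>
  have dist: "d p \<le> d v + 2 * real (card \<gamma>)" if g: "\<gamma> \<in> polymers p \<Lambda>" and v: "v \<in> nbhd \<gamma>" for \<gamma> v
  proof -
    have g': "finite \<gamma>" "p \<in> \<gamma>" "comp p \<gamma> = \<gamma>"
      using g psubset.hyps finite_subset unfolding polymers_def by auto
    obtain xs where xs: "xs \<in> walks p (2 * (card \<gamma> - 1))" "set xs = \<gamma>" using spanning_walk[OF g'] by auto
    have c: "card \<gamma> \<ge> 1" using g' by (auto simp: Suc_le_eq card_gt_0_iff)
    hence c': "real (2 * (card \<gamma> - 1)) = 2 * real (card \<gamma>) - 2" by simp
    obtain w where w: "w \<in> \<gamma>" "d w \<le> d v + 1" using v lip unfolding nbhd_def by force
    show ?thesis using walk_lipschitz[where d = d and v = w, OF lip xs(1)] w xs(2) c' by simp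
  qed
  have lnrho: "ln (\<rho> q \<gamma>) = ln (Z q (\<Lambda> - nbhd \<gamma>)) - ln (Z q ?L)" and rhopos: "\<rho> q \<gamma> > 0" for q \<gamma>
    using pos[of "\<Lambda> - nbhd \<gamma>" q] pos[of ?L q] unfolding \<rho>_def by (auto simp: ln_div)
  have rho_le: "ln (\<rho> q \<gamma>) \<le> real (card \<gamma>) / 4" if g: "\<gamma> \<in> polymers p \<Lambda>" for q \<gamma>
  proof -
    let ?M = "nbhd \<gamma> \<inter> ?L"
    have fing: "finite \<gamma>" and pin: "p \<in> nbhd \<gamma>"
      using g psubset.hyps finite_subset unfolding polymers_def nbhd_def by auto
    have e: "\<Lambda> - nbhd \<gamma> = ?L - ?M" using pin by auto
    have "\<bar>ln (Z q ?L) - ln (Z q (?L - ?M))\<bar> \<le> (\<Sum>p\<in>?M. b)"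
    proof (rule abs_diff_le_sum_removed[where F = "\<lambda>L. ln (Z q L)"])
      fix L u assume "L \<subseteq> ?L" "u \<in> L"
      thus "\<bar>ln (Z q L) - ln (Z q (L - {u}))\<bar> \<le> b" using finL finite_subset by (intro ln_Z_remove) blast+
    qed (use finL in auto)
    also have "\<dots> = b * real (card ?M)" by simp
    also have "\<dots> \<le> real (card \<gamma>) / 4" using fing by (intro b_card_nbhd) auto
    finally show ?thesis unfolding lnrho e by linarith
  qed
  have rho_diff: "\<bar>ln (\<rho> q1 \<gamma>) - ln (\<rho> q2 \<gamma>)\<bar> \<le> real (deg + 1) * real (card \<gamma>) * exp (- d p / 120 + real (card \<gamma>) / 60)"
    if g: "\<gamma> \<in> polymers p \<Lambda>" for \<gamma>
  proof -
    let ?M = "nbhd \<gamma> \<inter> ?L"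
    have fing: "finite \<gamma>" and pin: "p \<in> nbhd \<gamma>"
      using g psubset.hyps finite_subset unfolding polymers_def nbhd_def by auto
    have e: "\<Lambda> - nbhd \<gamma> = ?L - ?M" using pin by auto
    have "\<bar>ln (\<rho> q1 \<gamma>) - ln (\<rho> q2 \<gamma>)\<bar> = \<bar>?F ?L - ?F (?L - ?M)\<bar>" unfolding lnrho e by simp
    also have "\<dots> \<le> (\<Sum>u\<in>?M. exp (- d u / 120))"
      using finL by (intro abs_diff_le_sum_removed[where F = ?F] step) auto
    also have "\<dots> \<le> (\<Sum>u\<in>?M. exp (- d p / 120 + real (card \<gamma>) / 60))"
    proof (intro sum_mono)
      fix u assume "u \<in> ?M"
      hence "d p \<le> d u + 2 * real (card \<gamma>)" using dist[OF g] by auto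
      thus "exp (- d u / 120) \<le> exp (- d p / 120 + real (card \<gamma>) / 60)" by simp
    qed
    also have "\<dots> = real (card ?M) * exp (- d p / 120 + real (card \<gamma>) / 60)" by simp
    also have "\<dots> \<le> real ((deg + 1) * card \<gamma>) * exp (- d p / 120 + real (card \<gamma>) / 60)"
      using order.trans[OF card_mono[OF card_nbhd_le(1)[OF fing] Int_lower1] card_nbhd_le(2)[OF fing]]
      by (intro mult_right_mono) (simp_all only: of_nat_le_iff exp_ge_zero)
    finally show ?thesis by (simp only: of_nat_mult)
  qed
  \<comment> \<open>The product of deg + 1 and n counts the removed plaquettes, each of which adds
    to the difference of logarithms. The summand 2 covers the two terms of a polymer that reaches
    the sign change.\<close>
  have tm: "\<bar>(-1) ^ card (\<gamma> \<inter> q1) * x ^ card \<gamma> * \<rho> q1 \<gamma> - (-1) ^ card (\<gamma> \<inter> q2) * x ^ card \<gamma> * \<rho> q2 \<gamma>\<bar>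
      \<le> exp (- d p / 120) * ((x * exp (4/15)) ^ card \<gamma> * (real (deg + 1) * real (card \<gamma>) + 2))"
    if g: "\<gamma> \<in> polymers p \<Lambda>" for \<gamma>
  proof -
    let ?n = "card \<gamma>"
    have rl: "\<rho> q \<gamma> \<le> exp (real ?n / 4)" for q
      using rho_le[OF g, of q] rhopos[of q \<gamma>] by (metis exp_le_cancel_iff exp_ln)
    have ex: "exp (real ?n / 4) * exp (- d p / 120 + real ?n / 60) = exp (- d p / 120) * exp (4/15) ^ ?n"
      by (simp add: exp_add[symmetric] exp_of_nat_mult[symmetric]) 
    have "\<bar>(-1) ^ card (\<gamma> \<inter> q1) * \<rho> q1 \<gamma> - (-1) ^ card (\<gamma> \<inter> q2) * \<rho> q2 \<gamma>\<bar>
      \<le> exp (- d p / 120) * exp (4/15) ^ ?n * (real (deg + 1) * real ?n + 2)"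
    proof (cases "\<gamma> \<inter> sym_diff q1 q2 = {}")
      case True
      hence "\<gamma> \<inter> q1 = \<gamma> \<inter> q2" by auto
      hence "\<bar>(-1) ^ card (\<gamma> \<inter> q1) * \<rho> q1 \<gamma> - (-1) ^ card (\<gamma> \<inter> q2) * \<rho> q2 \<gamma>\<bar> = \<bar>\<rho> q1 \<gamma> - \<rho> q2 \<gamma>\<bar>"
        by (simp add: right_diff_distrib[symmetric] abs_mult power_abs)
      also have "\<dots> = \<bar>exp (ln (\<rho> q1 \<gamma>)) - exp (ln (\<rho> q2 \<gamma>))\<bar>" using rhopos by simp
      also have "\<dots> \<le> exp (max (ln (\<rho> q1 \<gamma>)) (ln (\<rho> q2 \<gamma>))) * \<bar>ln (\<rho> q1 \<gamma>) - ln (\<rho> q2 \<gamma>)\<bar>"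
        by (rule abs_exp_diff_le)
      also have "\<dots> \<le> exp (real ?n / 4) * (real (deg + 1) * real ?n * exp (- d p / 120 + real ?n / 60))"
        using rho_le[OF g, of q1] rho_le[OF g, of q2] rho_diff[OF g]
        by (intro mult_mono) (auto simp: max_def)
      also have "\<dots> = (exp (real ?n / 4) * exp (- d p / 120 + real ?n / 60)) * (real (deg + 1) * real ?n)"
        by (simp add: mult_ac)
      also have "\<dots> = exp (- d p / 120) * exp (4/15) ^ ?n * (real (deg + 1) * real ?n)" unfolding ex by simp
      also have "\<dots> \<le> exp (- d p / 120) * exp (4/15) ^ ?n * (real (deg + 1) * real ?n + 2)"
        by (intro mult_left_mono) auto
      finally show ?thesis .
    next
      case False
      then obtain u where u: "u \<in> \<gamma>" "d u \<le> 0" using far by blast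
      hence "d p \<le> 2 * real ?n" using dist[OF g, of u] unfolding nbhd_def by auto
      hence "exp (real ?n / 4) \<le> exp (real ?n / 4) * exp (- d p / 120 + real ?n / 60)"
        by (simp add: exp_add[symmetric])
      hence rl': "\<rho> q \<gamma> \<le> exp (- d p / 120) * exp (4/15) ^ ?n" for q using rl[of q] unfolding ex by simp
      have "\<bar>(-1) ^ card (\<gamma> \<inter> q1) * \<rho> q1 \<gamma> - (-1) ^ card (\<gamma> \<inter> q2) * \<rho> q2 \<gamma>\<bar>
        \<le> \<bar>(-1) ^ card (\<gamma> \<inter> q1) * \<rho> q1 \<gamma>\<bar> + \<bar>(-1) ^ card (\<gamma> \<inter> q2) * \<rho> q2 \<gamma>\<bar>" by (rule abs_triangle_ineq4)
      also have "\<dots> = \<rho> q1 \<gamma> + \<rho> q2 \<gamma>" using rhopos[of q1 \<gamma>] rhopos[of q2 \<gamma>] by (simp add: abs_mult)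
      also have "\<dots> \<le> exp (- d p / 120) * exp (4/15) ^ ?n * 2" using rl'[of q1] rl'[of q2] by simp
      also have "\<dots> \<le> exp (- d p / 120) * exp (4/15) ^ ?n * (real (deg + 1) * real ?n + 2)"
        by (intro mult_left_mono) auto
      finally show ?thesis .
    qed
    hence "x ^ ?n * \<bar>(-1) ^ card (\<gamma> \<inter> q1) * \<rho> q1 \<gamma> - (-1) ^ card (\<gamma> \<inter> q2) * \<rho> q2 \<gamma>\<bar>
      \<le> x ^ ?n * (exp (- d p / 120) * exp (4/15) ^ ?n * (real (deg + 1) * real ?n + 2))"
      using x_pos by (intro mult_left_mono) auto
    moreover have "x ^ ?n * \<bar>(-1) ^ card (\<gamma> \<inter> q1) * \<rho> q1 \<gamma> - (-1) ^ card (\<gamma> \<inter> q2) * \<rho> q2 \<gamma>\<bar>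
      = \<bar>(-1) ^ card (\<gamma> \<inter> q1) * x ^ card \<gamma> * \<rho> q1 \<gamma> - (-1) ^ card (\<gamma> \<inter> q2) * x ^ card \<gamma> * \<rho> q2 \<gamma>\<bar>"
    proof -
      have "\<bar>x ^ ?n * ((-1) ^ card (\<gamma> \<inter> q1) * \<rho> q1 \<gamma> - (-1) ^ card (\<gamma> \<inter> q2) * \<rho> q2 \<gamma>)\<bar> = x ^ ?n * \<bar>(-1) ^ card (\<gamma> \<inter> q1) * \<rho> q1 \<gamma> - (-1) ^ card (\<gamma> \<inter> q2) * \<rho> q2 \<gamma>\<bar>"
        unfolding abs_mult using x_pos by simp
      thus ?thesis by (simp add: algebra_simps)
    qed
    ultimately show ?thesis by (simp add: power_mult_distrib mult_ac)
  qed
  have r_eq: "r q = 1 + (\<Sum>\<gamma>\<in>polymers p \<Lambda>. (-1) ^ card (\<gamma> \<inter> q) * x ^ card \<gamma> * \<rho> q \<gamma>)" for q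
    using pos[of ?L q] unfolding r_def \<rho>_def
    by (subst Z_remove[OF psubset.hyps p]) (simp add: add_divide_distrib sum_divide_distrib)
  have lnr: "ln (r q) = ln (Z q \<Lambda>) - ln (Z q ?L)" and rpos: "r q > 0" for q
    using pos[of \<Lambda> q] pos[of ?L q] unfolding r_def by (auto simp: ln_div)
  have r_ge: "r q \<ge> exp (-b)" for q
  proof -
    have "ln (r q) \<ge> -b" using ln_Z_remove[OF psubset.hyps p, of q] unfolding lnr by simp
    thus ?thesis using rpos[of q] by (simp add: ln_ge_iff)
  qed
  have "\<bar>r q1 - r q2\<bar> = \<bar>\<Sum>\<gamma>\<in>polymers p \<Lambda>. (-1) ^ card (\<gamma> \<inter> q1) * x ^ card \<gamma> * \<rho> q1 \<gamma> - (-1) ^ card (\<gamma> \<inter> q2) * x ^ card \<gamma> * \<rho> q2 \<gamma>\<bar>"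
    unfolding r_eq by (simp add: sum_subtractf)
  also have "\<dots> \<le> (\<Sum>\<gamma>\<in>polymers p \<Lambda>. exp (- d p / 120) * ((x * exp (4/15)) ^ card \<gamma> * (real (deg + 1) * real (card \<gamma>) + 2)))"
    by (rule order.trans[OF sum_abs sum_mono[OF tm]])
  also have "\<dots> = exp (- d p / 120) * (\<Sum>\<gamma>\<in>polymers p \<Lambda>. (x * exp (4/15)) ^ card \<gamma> * (real (deg + 1) * real (card \<gamma>) + 2))"
    by (simp add: sum_distrib_left)
  also have "\<dots> \<le> exp (- d p / 120) * ((real (deg + 1) * (25/4) + 2 * (41/20)) / real deg ^ 2)"
    by (intro mult_left_mono sum_polymers_le psubset.hyps) auto
  finally have rd: "\<bar>r q1 - r q2\<bar> \<le> exp (- d p / 120) * ((real (deg + 1) * (25/4) + 2 * (41/20)) / real deg ^ 2)" .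
  have D: "real deg \<ge> 10" using deg_ge by simp
  \<comment> \<open>At deg = 10, with 11/10 in place of exp b, the left side is about 0.80, and it
    decreases in deg.\<close>
  have const: "exp b * ((real (deg + 1) * (25/4) + 2 * (41/20)) / real deg ^ 2) \<le> 1"
  proof -
    have "b \<le> 1/44" unfolding b_def using D by (simp add: field_simps)
    hence "exp b \<le> 1 + 1/44 + (1/44)\<^sup>2"
      using exp_bound[of b] b_nonneg power_mono[of b "1/44" 2] by linarith
    hence eb: "exp b \<le> 11/10" by (simp add: power2_eq_square)
    have "(11/10) * (real (deg + 1) * (25/4) + 2 * (41/20)) \<le> real deg ^ 2"
      using mult_right_mono[OF D of_nat_0_le_iff[of deg]] D unfolding power2_eq_square of_nat_add of_nat_1 by argo
    hence "(11/10) * ((real (deg + 1) * (25/4) + 2 * (41/20)) / real deg ^ 2) \<le> 1"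
      using D by (simp add: field_simps)
    moreover have "exp b * ((real (deg + 1) * (25/4) + 2 * (41/20)) / real deg ^ 2) \<le> (11/10) * ((real (deg + 1) * (25/4) + 2 * (41/20)) / real deg ^ 2)"
      using eb by (intro mult_right_mono) auto
    ultimately show ?thesis by linarith
  qed
  have "\<bar>?F \<Lambda> - ?F ?L\<bar> = \<bar>ln (r q1) - ln (r q2)\<bar>" unfolding lnr by simp
  also have "\<dots> \<le> exp b * \<bar>r q1 - r q2\<bar>" by (rule abs_ln_diff_le[OF r_ge r_ge])
  also have "\<dots> \<le> exp b * (exp (- d p / 120) * ((real (deg + 1) * (25/4) + 2 * (41/20)) / real deg ^ 2))"
    using rd by (intro mult_left_mono) auto
  also have "\<dots> = exp (- d p / 120) * (exp b * ((real (deg + 1) * (25/4) + 2 * (41/20)) / real deg ^ 2))" by simp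
  also have "\<dots> \<le> exp (- d p / 120) * 1" using const by (intro mult_left_mono) auto
  finally show ?case by simp
qed

end

section \<open>The Poincare lemma in a box\<close>

text \<open>A cell is given by its lowest corner x and the set S of its edge directions;
  orientations disappear and the dimension is \<open>card S\<close>.\<close>

definition cell :: "nat \<Rightarrow> int^'m::finite \<Rightarrow> 'm set \<Rightarrow> bool" where
  "cell N x S \<longleftrightarrow> (\<forall>k. - int N \<le> x $ k \<and> x $ k + (if k \<in> S then 1 else 0) \<le> int N)"

text \<open>The coboundary over Z_2 in multiplicative form: a product over the facets of the cell,
  two for each direction c.\<close>

definition cob :: "(int^'m::finite \<Rightarrow> 'm set \<Rightarrow> real) \<Rightarrow> int^'m \<Rightarrow> 'm set \<Rightarrow> real" where
  "cob F x S = (\<Prod>c\<in>S. F x (S - {c}) * F (x + off c 1) (S - {c}))"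

definition setc :: "int^'m::finite \<Rightarrow> 'm \<Rightarrow> int \<Rightarrow> int^'m" where
  "setc x c t = (\<chi> k. if k = c then t else x $ k)"

lemma off_nth: "off i k $ c = (if c = i then k else 0)"
  by (simp add: off_def)

lemma setc_nth: "setc x c t $ k = (if k = c then t else x $ k)"
  by (simp add: setc_def)

lemma setc_simps:
  "setc x c (x $ c) = x"
  "setc x c t + off c 1 = setc x c (t + 1)"
  "setc (x + off c s) c t = setc x c t"
  "i \<noteq> c \<Longrightarrow> setc (x + off i s) c t = setc x c t + off i s"
  by (auto simp: vec_eq_iff setc_nth off_nth)

lemma prod_telescope_int:
  fixes u :: "int \<Rightarrow> real"
  assumes "\<And>t. u t * u t = 1" "a \<le> b"
  shows "(\<Prod>t\<in>{a..<b}. u t * u (t + 1)) = u a * u b"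
  using assms(2)
proof (induction b rule: int_ge_induct)
  case base
  show ?case by (simp add: assms(1))
next
  case (step b)
  have "{a..<b + 1} = insert b {a..<b}" using step by auto
  hence "(\<Prod>t\<in>{a..<b+1}. u t * u (t + 1)) = (u b * u (b + 1)) * (u a * u b)" using step by simp
  also have "\<dots> = u a * u (b + 1) * (u b * u b)" by (simp only: mult_ac)
  finally show ?case by (simp add: assms(1))
qed

text \<open>Cochains are written multiplicatively, with values \<open>\<plusminus>1\<close>; \<open>cone\<close> is the homotopy operator that
  integrates along direction \<open>c\<close> and joins the identity to the restriction \<open>slice\<close> to the face
  \<open>x $ c = - N\<close> of the box.\<close>

definition slice :: "nat \<Rightarrow> 'm \<Rightarrow> (int^'m::finite \<Rightarrow> 'm set \<Rightarrow> real) \<Rightarrow> int^'m \<Rightarrow> 'm set \<Rightarrow> real" where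
  "slice N c F x S = (if c \<in> S then 1 else F (setc x c (- int N)) S)"

definition cone :: "nat \<Rightarrow> 'm \<Rightarrow> (int^'m::finite \<Rightarrow> 'm set \<Rightarrow> real) \<Rightarrow> int^'m \<Rightarrow> 'm set \<Rightarrow> real" where
  "cone N c F x S = (if c \<in> S then 1 else \<Prod>t\<in>{- int N..<x $ c}. F (setc x c t) (insert c S))"

text \<open>The homotopy formula. If c is in S, only the two facets orthogonal to c matter, and the
  cones over them differ by the factor \<open>F x S\<close>. Otherwise closedness on the cells
  \<open>insert c S\<close> stacked between the face and x makes the coboundary of the cone
  telescope.\<close>

lemma slice_cone:
  assumes sq: "\<And>x S. F x S * F x S = 1"
    and closed: "\<And>x S. card S = 3 \<Longrightarrow> cell N x S \<Longrightarrow> cob F x S = 1"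
    and S: "card S = 2" "cell N x S"
  shows "F x S = slice N c F x S * cob (cone N c F) x S"
proof (cases "c \<in> S")
  case True
  have le: "- int N \<le> x $ c" using S(2) unfolding cell_def by auto
  have fS: "finite S" by simp
  have "cob (cone N c F) x S = (\<Prod>i\<in>S. if i = c then cone N c F x (S - {c}) * cone N c F (x + off c 1) (S - {c}) else 1)"
    unfolding cob_def using True by (intro prod.cong refl) (auto simp: cone_def)
  also have "\<dots> = cone N c F x (S - {c}) * cone N c F (x + off c 1) (S - {c})"
    using True fS by simp
  also have "\<dots> = (\<Prod>t\<in>{- int N..<x $ c}. F (setc x c t) S) * (\<Prod>t\<in>{- int N..<x $ c + 1}. F (setc x c t) S)"
    using True by (simp add: cone_def insert_absorb setc_simps off_nth)
  also have "{- int N..<x $ c + 1} = insert (x $ c) {- int N..<x $ c}" using le by auto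
  also have "(\<Prod>t\<in>\<dots>. F (setc x c t) S) = F x S * (\<Prod>t\<in>{- int N..<x $ c}. F (setc x c t) S)"
    by (simp add: setc_simps)
  also have "(\<Prod>t\<in>{- int N..<x $ c}. F (setc x c t) S) * \<dots>
      = F x S * (\<Prod>t\<in>{- int N..<x $ c}. F (setc x c t) S * F (setc x c t) S)"
    unfolding prod.distrib by (simp only: mult_ac)
  finally show ?thesis using True by (simp add: slice_def sq)
next
  case False
  have le: "- int N \<le> x $ c" using S(2) unfolding cell_def by auto
  define u where "u t = F (setc x c t) S" for t
  have side: "(\<Prod>i\<in>S. F (setc x c t) (insert c (S - {i})) * F (setc x c t + off i 1) (insert c (S - {i}))) = u t * u (t + 1)"
    (is "?P = _") if t: "t \<in> {- int N..<x $ c}" for t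
  proof -
    let ?y = "setc x c t"
    have "cell N ?y (insert c S)"
      using S(2) t False unfolding cell_def by (auto simp: setc_nth dest: spec[where x = c] split: if_splits)
    moreover have "card (insert c S) = 3" using S(1) False by (simp add: card_insert_if)
    ultimately have "1 = cob F ?y (insert c S)" using closed by metis
    also have "\<dots> = u t * u (t + 1) * ?P"
    proof -
      have "(\<Prod>i\<in>S. F ?y (insert c S - {i}) * F (?y + off i 1) (insert c S - {i})) = ?P"
        using False by (intro prod.cong refl) (auto simp: insert_Diff_if)
      thus ?thesis using False unfolding cob_def u_def
        by (subst prod.insert) (auto simp: setc_simps)
    qed
    finally have "u t * u (t + 1) = u t * u (t + 1) * (u t * u (t + 1) * ?P)" by simp
    also have "\<dots> = (u t * u t) * (u (t + 1) * u (t + 1)) * ?P" by (simp only: mult_ac)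
    finally show ?thesis by (simp add: u_def sq)
  qed
  have "cob (cone N c F) x S = (\<Prod>i\<in>S. \<Prod>t\<in>{- int N..<x $ c}.
      F (setc x c t) (insert c (S - {i})) * F (setc x c t + off i 1) (insert c (S - {i})))"
    unfolding cob_def
  proof (intro prod.cong refl)
    fix i assume i: "i \<in> S"
    hence "i \<noteq> c" using False by auto
    thus "cone N c F x (S - {i}) * cone N c F (x + off i 1) (S - {i}) = (\<Prod>t\<in>{- int N..<x $ c}.
      F (setc x c t) (insert c (S - {i})) * F (setc x c t + off i 1) (insert c (S - {i})))"
      using False by (simp add: cone_def setc_simps off_nth prod.distrib)
  qed
  also have "\<dots> = (\<Prod>t\<in>{- int N..<x $ c}. u t * u (t + 1))"
    by (subst prod.swap) (simp add: side)
  also have "\<dots> = u (- int N) * u (x $ c)"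
    using le by (intro prod_telescope_int) (auto simp: u_def sq)
  finally have "slice N c F x S * cob (cone N c F) x S = (u (- int N) * u (- int N)) * u (x $ c)"
    using False by (simp add: slice_def u_def)
  thus ?thesis by (simp add: u_def sq setc_simps)
qed

text \<open>For c in S the two facets orthogonal to c project to the same cell and cancel, and all
  others carry 1. Otherwise the claim is closedness at the projected cell.\<close>

lemma slice_closed:
  assumes sq: "\<And>x S. F x S * F x S = 1"
    and closed: "\<And>x S. card S = 3 \<Longrightarrow> cell N x S \<Longrightarrow> cob F x S = 1"
    and S: "card S = 3" "cell N x S"
  shows "cob (slice N c F) x S = 1"
proof (cases "c \<in> S")
  case True
  have "cob (slice N c F) x S = (\<Prod>i\<in>S. 1)"
    unfolding cob_def using True by (intro prod.cong refl) (auto simp: slice_def setc_simps sq)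
  thus ?thesis by simp
next
  case False
  have "cob (slice N c F) x S = cob F (setc x c (- int N)) S"
    unfolding cob_def
  proof (intro prod.cong refl)
    fix i assume "i \<in> S"
    hence "i \<noteq> c" using False by auto
    thus "slice N c F x (S - {i}) * slice N c F (x + off i 1) (S - {i})
      = F (setc x c (- int N)) (S - {i}) * F (setc x c (- int N) + off i 1) (S - {i})"
      using False by (simp add: slice_def setc_simps)
  qed
  moreover have "cell N (setc x c (- int N)) S"
    using S(2) False unfolding cell_def by (auto simp: setc_nth)
  ultimately show ?thesis using closed S(1) by simp
qed

text \<open>C holds the directions in which F may still be nontrivial. Slicing along c takes c out
  of C at the price of the coboundary of a cone; once C is empty, F is 1 on all 2-cells.\<close>

lemma poincare_aux:
  fixes F :: "int^'m::finite \<Rightarrow> 'm set \<Rightarrow> real"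
  assumes "finite C"
    and "\<And>x S. F x S * F x S = 1"
    and "\<And>x S. card S = 3 \<Longrightarrow> cell N x S \<Longrightarrow> cob F x S = 1"
    and "\<And>x S. card S = 2 \<Longrightarrow> cell N x S \<Longrightarrow> \<not> S \<subseteq> C \<Longrightarrow> F x S = 1"
  shows "\<exists>G. (\<forall>x S. G x S * G x S = 1) \<and> (\<forall>x S. card S = 2 \<longrightarrow> cell N x S \<longrightarrow> F x S = cob G x S)"
  using assms
proof (induction C arbitrary: F rule: finite_induct)
  case empty
  have "F x S = cob (\<lambda>_ _. 1) x S" if "card S = 2" "cell N x S" for x S
    using empty(3)[OF that] that by (cases "S = {}") (auto simp: cob_def)
  thus ?case by (intro exI[of _ "\<lambda>_ _. 1"]) auto
next
  case (insert c C)
  have "\<exists>G. (\<forall>x S. G x S * G x S = 1) \<and> (\<forall>x S. card S = 2 \<longrightarrow> cell N x S \<longrightarrow> slice N c F x S = cob G x S)"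
  proof (rule insert.IH)
    show "slice N c F x S * slice N c F x S = 1" for x S using insert.prems(1) by (simp add: slice_def)
    show "cob (slice N c F) x S = 1" if "card S = 3" "cell N x S" for x S
      using slice_closed[OF insert.prems(1,2) that] .
    show "slice N c F x S = 1" if S: "card S = 2" "cell N x S" "\<not> S \<subseteq> C" for x S
    proof (cases "c \<in> S")
      case False
      have "cell N (setc x c (- int N)) S" using S(2) False unfolding cell_def by (auto simp: setc_nth)
      moreover have "\<not> S \<subseteq> insert c C" using S(3) False by auto
      ultimately show ?thesis using insert.prems(3) S(1) False by (simp add: slice_def)
    qed (simp add: slice_def)
  qed
  then obtain G where G: "\<And>x S. G x S * G x S = 1"
    "\<And>x S. card S = 2 \<Longrightarrow> cell N x S \<Longrightarrow> slice N c F x S = cob G x S" by blast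
  let ?G = "\<lambda>x S. G x S * cone N c F x S"
  have cone_sq: "cone N c F x S * cone N c F x S = 1" for x S
    unfolding cone_def using insert.prems(1) by (simp add: prod.distrib[symmetric])
  have "?G x S * ?G x S = (G x S * G x S) * (cone N c F x S * cone N c F x S)" for x S by (simp only: mult_ac)
  hence "?G x S * ?G x S = 1" for x S using G(1) cone_sq by simp
  moreover have "F x S = cob ?G x S" if "card S = 2" "cell N x S" for x S
  proof -
    have "cob ?G x S = cob G x S * cob (cone N c F) x S"
      unfolding cob_def prod.distrib[symmetric] by (intro prod.cong refl) (simp only: mult_ac)
    thus ?thesis using slice_cone[OF insert.prems(1,2) that, of c] G(2)[OF that] by simp
  qed
  ultimately show ?case by (intro exI[of _ ?G]) auto
qed

lemma poincare:
  fixes F :: "int^'m::finite \<Rightarrow> 'm set \<Rightarrow> real"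
  assumes "\<And>x S. F x S * F x S = 1"
    and "\<And>x S. card S = 3 \<Longrightarrow> cell N x S \<Longrightarrow> cob F x S = 1"
  obtains G where "\<And>x S. G x S * G x S = 1"
    "\<And>x S. card S = 2 \<Longrightarrow> cell N x S \<Longrightarrow> F x S = cob G x S"
  using poincare_aux[of UNIV F N] assms by auto

section \<open>From spins to closed sets of plaquettes\<close>

text \<open>Plaquettes without orientation: \<open>(x, i, j)\<close> and \<open>(x, j, i)\<close>
  become the same pair.\<close>

definition plaqs2 :: "nat \<Rightarrow> ((int^'m::finite) \<times> 'm set) set" where
  "plaqs2 N = {(x, S). card S = 2 \<and> cell N x S}"

definition cube_faces :: "int^'m::finite \<Rightarrow> 'm set \<Rightarrow> ((int^'m) \<times> 'm set) set" where
  "cube_faces x S = (\<Union>c\<in>S. {(x, S - {c}), (x + off c 1, S - {c})})"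

definition cubes :: "nat \<Rightarrow> ((int^'m::finite) \<times> 'm set) set set" where
  "cubes N = {cube_faces x S | x S. card S = 3 \<and> cell N x S}"

definition sgnset :: "((int^'m::finite) \<times> 'm set) set \<Rightarrow> int^'m \<Rightarrow> 'm set \<Rightarrow> real" where
  "sgnset \<omega> x S = (if (x, S) \<in> \<omega> then -1 else 1)"

definition edge_sign :: "((int^'m::finite) \<times> 'm \<Rightarrow> bool) \<Rightarrow> int^'m \<Rightarrow> 'm set \<Rightarrow> real" where
  "edge_sign \<sigma> x S = rho (\<sigma> (x, the_elem S))"

definition flux :: "nat \<Rightarrow> ((int^'m::finite) \<times> 'm \<Rightarrow> bool) \<Rightarrow> ((int^'m) \<times> 'm set) set" where
  "flux N \<sigma> = {(x, S) \<in> plaqs2 N. cob (edge_sign \<sigma>) x S = -1}"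

section \<open>Finiteness, and membership in the box\<close>

lemma off_ne_0: "off c 1 \<noteq> 0"
  by (auto simp: vec_eq_iff off_nth)

lemma cell_imp_nth: "cell N x S \<Longrightarrow> - int N \<le> x $ k \<and> x $ k \<le> int N"
  unfolding cell_def by (drule spec[of _ k]) (auto split: if_splits)

lemma finite_vecs_box: "finite {x :: int^'m::finite. \<forall>k. - int N \<le> x $ k \<and> x $ k \<le> int N}"
proof -
  have "finite (vec_nth ` {x :: int^'m. \<forall>k. - int N \<le> x $ k \<and> x $ k \<le> int N})"
  proof (rule finite_subset)
    show "vec_nth ` {x :: int^'m. \<forall>k. - int N \<le> x $ k \<and> x $ k \<le> int N} \<subseteq> PiE UNIV (\<lambda>_. {- int N..int N})"
      by auto
    show "finite (PiE (UNIV :: 'm set) (\<lambda>_. {- int N..int N}))" by (intro finite_PiE) auto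
  qed
  thus ?thesis by (rule finite_imageD) (auto simp: inj_on_def vec_eq_iff)
qed

lemma finite_plaqs2: "finite (plaqs2 N :: ((int^'m::finite) \<times> 'm set) set)"
proof (rule finite_subset)
  show "plaqs2 N \<subseteq> {x :: int^'m. \<forall>k. - int N \<le> x $ k \<and> x $ k \<le> int N} \<times> UNIV"
    unfolding plaqs2_def using cell_imp_nth by fastforce
  show "finite ({x :: int^'m. \<forall>k. - int N \<le> x $ k \<and> x $ k \<le> int N} \<times> (UNIV :: 'm set set))"
    by (rule finite_cartesian_product[OF finite_vecs_box finite])
qed

lemma lbox_iff: "x \<in> lbox N \<longleftrightarrow> (\<forall>k. - int N \<le> x $ k \<and> x $ k \<le> int N)"
  unfolding lbox_def by (auto simp: abs_le_iff minus_le_iff)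

lemma finite_lbox: "finite (lbox N :: (int^'m::finite) set)"
proof -
  have "(lbox N :: (int^'m) set) = {x. \<forall>k. - int N \<le> x $ k \<and> x $ k \<le> int N}" using lbox_iff by blast
  thus ?thesis using finite_vecs_box by simp
qed

lemma finite_edges: "finite (edges N :: ((int^'m::finite) \<times> 'm) set)"
  by (rule finite_subset[of _ "lbox N \<times> UNIV"]) (auto simp: edges_def finite_lbox)

lemma finite_plaqs: "finite (plaqs N :: ((int^'m::finite) \<times> 'm \<times> 'm) set)"
  by (rule finite_subset[of _ "lbox N \<times> UNIV"]) (auto simp: plaqs_def finite_lbox)

lemma edges_iff: "(x, i) \<in> edges N \<longleftrightarrow> cell N x {i}"
proof -
  have "(x, i) \<in> edges N \<longleftrightarrow> (\<forall>k. (- int N \<le> x $ k \<and> x $ k \<le> int N) \<and>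
      (- int N \<le> (x + off i 1) $ k \<and> (x + off i 1) $ k \<le> int N))"
    unfolding edges_def lbox_iff by auto
  also have "\<dots> \<longleftrightarrow> cell N x {i}"
    unfolding cell_def by (rule iff_allI) (auto simp: off_nth)
  finally show ?thesis .
qed

lemma plaqs_iff: "(x, i, j) \<in> plaqs N \<longleftrightarrow> i \<noteq> j \<and> cell N x {i, j}"
proof (cases "i = j")
  case False
  hence "(x, i, j) \<in> plaqs N \<longleftrightarrow> (\<forall>k. (- int N \<le> x $ k \<and> x $ k \<le> int N) \<and>
      (- int N \<le> (x + off i 1) $ k \<and> (x + off i 1) $ k \<le> int N) \<and>
      (- int N \<le> (x + off j 1) $ k \<and> (x + off j 1) $ k \<le> int N) \<and>
      (- int N \<le> (x + off i 1 + off j 1) $ k \<and> (x + off i 1 + off j 1) $ k \<le> int N))"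
    unfolding plaqs_def lbox_iff by auto
  also have "\<dots> \<longleftrightarrow> cell N x {i, j}"
    unfolding cell_def using False by (intro iff_allI) (auto simp: off_nth)
  finally show ?thesis using False by simp
qed (simp add: plaqs_def)

lemma configs_eq: "configs N = spins (edges N)"
  by (simp add: configs_def spins_def)

lemma wilson_eq: "wilson A = chi A"
  by (simp add: fun_eq_iff wilson_def chi_def)

lemma cob_pair:
  assumes "i \<noteq> j"
  shows "cob F x {i, j} = F x {j} * F (x + off i 1) {j} * (F x {i} * F (x + off j 1) {i})"
proof -
  have "{i, j} - {i} = {j}" "{i, j} - {j} = {i}" using assms by auto
  thus ?thesis using assms by (simp add: cob_def)
qed

lemma cob_edge_sign:
  assumes "i \<noteq> j"
  shows "cob (edge_sign \<sigma>) x {i, j} = rho (dsig \<sigma> (x, i, j))"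
  unfolding cob_pair[OF assms]
  by (simp only: edge_sign_def dsig_def prod.case rho_xor the_elem_eq mult_ac)

lemma edge_sign_sq [simp]: "edge_sign \<sigma> x S * edge_sign \<sigma> x S = 1"
  "edge_sign \<sigma> x S * (edge_sign \<sigma> x S * y) = y"
  by (simp_all add: edge_sign_def)

lemma card_2_doubleton:
  assumes "card S = 2" obtains i j where "i \<noteq> j" "S = {i, j}"
  using assms by (auto simp: card_2_iff)

text \<open>The Bianchi identity: every edge of a 3-cell borders two of its faces.\<close>

lemma cob_cob:
  assumes "card S = 3"
  shows "cob (cob (edge_sign \<sigma>)) x S = 1"
proof -
  obtain i j k where ijk: "S = {i, j, k}" "i \<noteq> j" "i \<noteq> k" "j \<noteq> k" using assms by (auto simp: card_3_iff)
  have "S - {i} = {j, k}" "S - {j} = {i, k}" "S - {k} = {i, j}" using ijk by auto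
  hence "cob (cob (edge_sign \<sigma>)) x S = cob (edge_sign \<sigma>) x {j, k} * cob (edge_sign \<sigma>) (x + off i 1) {j, k}
    * (cob (edge_sign \<sigma>) x {i, k} * cob (edge_sign \<sigma>) (x + off j 1) {i, k}
    * (cob (edge_sign \<sigma>) x {i, j} * cob (edge_sign \<sigma>) (x + off k 1) {i, j}))"
    unfolding cob_def[of "cob (edge_sign \<sigma>)"] ijk(1) using ijk(2-) by simp
  also have "\<dots> = 1"
    using ijk by (simp add: cob_pair add_ac mult_ac)
  finally show ?thesis .
qed

lemma cob_sign_cases:
  assumes "\<And>x S. F x S * F x S = (1 :: real)"
  shows "cob F x S = 1 \<or> cob F x S = -1"
proof -
  have "cob F x S * cob F x S = (\<Prod>c\<in>S. (F x (S - {c}) * F x (S - {c})) * (F (x + off c 1) (S - {c}) * F (x + off c 1) (S - {c})))"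
    unfolding cob_def prod.distrib[symmetric] by (intro prod.cong refl) (simp only: mult_ac)
  hence "cob F x S * cob F x S = 1" using assms by simp
  thus ?thesis by (metis square_eq_1_iff)
qed

section \<open>Closed plaquette sets as fluxes of configurations\<close>

lemma prod_sgnset: "finite q \<Longrightarrow> (\<Prod>(x, S)\<in>q. sgnset \<omega> x S) = (-1) ^ card (\<omega> \<inter> q)"
proof -
  assume fin: "finite q"
  have "(\<Prod>(x, S)\<in>q. sgnset \<omega> x S) = (\<Prod>p\<in>q. if p \<in> \<omega> then -1 else 1)"
    by (intro prod.cong refl) (auto simp: sgnset_def)
  also have "\<dots> = (\<Prod>p\<in>q \<inter> \<omega>. -1)" by (rule prod.inter_restrict[OF fin, symmetric])
  finally show ?thesis by (simp add: Int_commute)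
qed

lemma cob_sgnset: "cob (sgnset \<omega>) x S = (-1) ^ card (\<omega> \<inter> cube_faces x S)"
proof -
  have "(-1) ^ card (\<omega> \<inter> cube_faces x S) = (\<Prod>(y, T)\<in>cube_faces x S. sgnset \<omega> y T)"
    by (subst prod_sgnset) (auto simp: cube_faces_def)
  also have "\<dots> = (\<Prod>c\<in>S. \<Prod>(y, T)\<in>{(x, S - {c}), (x + off c 1, S - {c})}. sgnset \<omega> y T)"
    unfolding cube_faces_def by (rule prod.UNION_disjoint) auto
  also have "\<dots> = cob (sgnset \<omega>) x S"
    unfolding cob_def
  proof (intro prod.cong refl)
    fix c
    have "(x, S - {c}) \<noteq> (x + off c 1, S - {c})" using off_ne_0[of c] by simp
    thus "(\<Prod>(y, T)\<in>{(x, S - {c}), (x + off c 1, S - {c})}. sgnset \<omega> y T)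
      = sgnset \<omega> x (S - {c}) * sgnset \<omega> (x + off c 1) (S - {c})" by simp
  qed
  finally show ?thesis ..
qed

lemma cube_faces_cases:
  assumes "(x, S) \<in> cube_faces y T"
  obtains c where "c \<in> T" "S = T - {c}" "x = y \<or> x = y + off c 1"
  using assms unfolding cube_faces_def by auto

lemma cell_face:
  assumes "cell N y T" "c \<in> T" "x = y \<or> x = y + off c 1"
  shows "cell N x (T - {c})"
  unfolding cell_def
proof
  fix k
  have "- int N \<le> y $ k \<and> y $ k + (if k \<in> T then 1 else 0) \<le> int N"
    using assms(1) unfolding cell_def by blast
  thus "- int N \<le> x $ k \<and> x $ k + (if k \<in> T - {c} then 1 else 0) \<le> int N"
    using assms(2,3) by (auto simp: off_nth split: if_splits)
qed

lemma cube_faces_plaqs2: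
  assumes "card T = 3" "cell N y T"
  shows "cube_faces y T \<subseteq> plaqs2 N"
proof
  fix p assume p: "p \<in> cube_faces y T"
  obtain x S where xS: "p = (x, S)" by (cases p)
  obtain c where c: "c \<in> T" "S = T - {c}" "x = y \<or> x = y + off c 1"
    using cube_faces_cases p xS by metis
  have "card S = 2" using c assms by simp
  moreover have "cell N x S" using cell_face[OF assms(2) c(1,3)] c(2) by simp
  ultimately show "p \<in> plaqs2 N" using xS unfolding plaqs2_def by simp
qed

lemma closed_iff: "(\<forall>c\<in>cubes N. even (card (\<omega> \<inter> c))) \<longleftrightarrow>
    (\<forall>x S. card S = 3 \<longrightarrow> cell N x S \<longrightarrow> cob (sgnset \<omega>) x S = 1)"
proof -
  have e: "(-1) ^ n = (1 :: real) \<longleftrightarrow> even n" for n :: nat by (cases "even n") auto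
  show ?thesis unfolding cob_sgnset e cubes_def by blast
qed

lemma sgnset_flux: "(x, S) \<in> plaqs2 N \<Longrightarrow> sgnset (flux N \<sigma>) x S = cob (edge_sign \<sigma>) x S"
  using cob_sign_cases[of "edge_sign \<sigma>" x S] by (auto simp: sgnset_def flux_def)

lemma flux_closed:
  fixes \<sigma> :: "(int^'m::finite) \<times> 'm \<Rightarrow> bool"
  shows "\<forall>c\<in>cubes N. even (card (flux N \<sigma> \<inter> c))"
  unfolding closed_iff
proof (intro allI impI)
  fix x :: "int^'m" and S assume S: "card S = 3" "cell N x S"
  have "cob (sgnset (flux N \<sigma>)) x S = cob (cob (edge_sign \<sigma>)) x S"
    unfolding cob_def[of "sgnset _"] cob_def[of "cob _"]
  proof (intro prod.cong refl)
    fix c assume "c \<in> S"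
    hence "(x, S - {c}) \<in> plaqs2 N" "(x + off c 1, S - {c}) \<in> plaqs2 N"
      using cube_faces_plaqs2[OF S] unfolding cube_faces_def by auto
    thus "sgnset (flux N \<sigma>) x (S - {c}) * sgnset (flux N \<sigma>) (x + off c 1) (S - {c})
      = cob (edge_sign \<sigma>) x (S - {c}) * cob (edge_sign \<sigma>) (x + off c 1) (S - {c})"
      by (simp add: sgnset_flux)
  qed
  thus "cob (sgnset (flux N \<sigma>)) x S = 1" using cob_cob[OF S(1)] by simp
qed

text \<open>The topology of the box enters here: a closed sign function on plaquettes has a
  potential on edges, and this potential, cut off outside the box, is the configuration.\<close>

lemma flux_surj:
  assumes "\<omega> \<subseteq> plaqs2 N" "\<forall>c\<in>cubes N. even (card (\<omega> \<inter> c))"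
  shows "\<exists>\<sigma>\<in>configs N. flux N \<sigma> = \<omega>"
proof -
  obtain G where G: "\<And>x S. G x S * G x S = 1"
    "\<And>x S. card S = 2 \<Longrightarrow> cell N x S \<Longrightarrow> sgnset \<omega> x S = cob G x S"
  proof (rule poincare[of "sgnset \<omega>" N])
    show "sgnset \<omega> x S * sgnset \<omega> x S = 1" for x S by (simp add: sgnset_def)
    show "cob (sgnset \<omega>) x S = 1" if "card S = 3" "cell N x S" for x S
      using assms(2) that unfolding closed_iff by blast
  qed auto
  define \<sigma> where "\<sigma> = (\<lambda>(x, i). (x, i) \<in> edges N \<and> G x {i} = -1)"
  have sigma: "edge_sign \<sigma> x {i} = G x {i}" if "cell N x {i}" for x i
  proof -
    have "G x {i} = 1 \<or> G x {i} = -1" using G(1) by (metis square_eq_1_iff)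
    thus ?thesis using that unfolding edge_sign_def \<sigma>_def rho_def by (auto simp: edges_iff)
  qed
  have "cob (edge_sign \<sigma>) x S = sgnset \<omega> x S" if p: "(x, S) \<in> plaqs2 N" for x S
  proof -
    have S: "card S = 2" "cell N x S" using p unfolding plaqs2_def by auto
    obtain i j where ij: "i \<noteq> j" "S = {i, j}" using S card_2_doubleton by metis
    have "cell N x {i}" "cell N x {j}" "cell N (x + off i 1) {j}" "cell N (x + off j 1) {i}"
      using cell_face[OF S(2), of j x] cell_face[OF S(2), of i x] cell_face[OF S(2), of i "x + off i 1"]
        cell_face[OF S(2), of j "x + off j 1"] ij by (simp_all add: insert_Diff_if)
    hence "cob (edge_sign \<sigma>) x S = cob G x S" using ij by (simp add: cob_pair sigma)
    thus ?thesis using G(2)[OF S] by simp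
  qed
  hence "flux N \<sigma> = \<omega>" using assms(1) unfolding flux_def by (auto simp: sgnset_def split: if_splits)
  moreover have "\<sigma> \<in> configs N" unfolding configs_def \<sigma>_def by auto
  ultimately show ?thesis by blast
qed

lemma flux_flip: "flux N (flip \<tau> \<sigma>) = sym_diff (flux N \<tau>) (flux N \<sigma>)"
proof -
  have "edge_sign (flip \<tau> \<sigma>) x S = edge_sign \<tau> x S * edge_sign \<sigma> x S" for x S
    by (simp only: edge_sign_def flip_def rho_xor)
  hence mult: "cob (edge_sign (flip \<tau> \<sigma>)) x S = cob (edge_sign \<tau>) x S * cob (edge_sign \<sigma>) x S" for x S
    unfolding cob_def prod.distrib[symmetric] by (intro prod.cong refl) (simp only: mult_ac)
  have cases: "cob (edge_sign \<tau>) x S = 1 \<or> cob (edge_sign \<tau>) x S = -1" for \<tau> x S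
    by (rule cob_sign_cases) simp
  show ?thesis
  proof (rule set_eqI)
    fix p :: "(int^'a) \<times> 'a set"
    obtain x S where p: "p = (x, S)" by (cases p)
    show "p \<in> flux N (flip \<tau> \<sigma>) \<longleftrightarrow> p \<in> sym_diff (flux N \<tau>) (flux N \<sigma>)"
      using mult[of x S] cases[of \<tau> x S] cases[of \<sigma> x S] unfolding p flux_def by auto
  qed
qed

text \<open>By \<open>flux_flip\<close> the map \<open>flux\<close> is a homomorphism, so its fibres
  are translates of the kernel and equally large.\<close>

lemma sum_over_flux:
  fixes H :: "((int^'m::finite) \<times> 'm set) set \<Rightarrow> real"
  shows "(\<Sum>\<sigma>\<in>configs N. H (flux N \<sigma>)) = real (card {\<sigma> :: (int^'m) \<times> 'm \<Rightarrow> bool. \<sigma> \<in> configs N \<and> flux N \<sigma> = {}}) *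
    (\<Sum>\<omega> | \<omega> \<subseteq> plaqs2 N \<and> (\<forall>c\<in>cubes N. even (card (\<omega> \<inter> c))). H \<omega>)"
proof -
  let ?C = "{\<omega> :: ((int^'m) \<times> 'm set) set. \<omega> \<subseteq> plaqs2 N \<and> (\<forall>c\<in>cubes N. even (card (\<omega> \<inter> c)))}"
  let ?K = "{\<sigma> :: (int^'m) \<times> 'm \<Rightarrow> bool. \<sigma>\<in>configs N \<and> flux N \<sigma> = {}}"
  have finC: "finite (configs N :: ((int^'m) \<times> 'm \<Rightarrow> bool) set)"
    unfolding configs_eq by (intro finite_spins finite_edges)
  have "finite ?C" by (rule finite_subset[of _ "Pow (plaqs2 N)"]) (auto simp: finite_plaqs2)
  have fib: "card {\<sigma>\<in>configs N. flux N \<sigma> = \<omega>} = card ?K" if \<omega>: "\<omega> \<in> ?C" for \<omega>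
  proof -
    obtain \<sigma>0 where s0: "\<sigma>0 \<in> configs N" "flux N \<sigma>0 = \<omega>" using flux_surj \<omega> by blast
    have "bij_betw (flip \<sigma>0) {\<sigma>\<in>configs N. flux N \<sigma> = \<omega>} ?K"
      by (rule bij_betw_byWitness[where f' = "flip \<sigma>0"])
         (use s0 in \<open>auto simp: flux_flip configs_eq flip_spins\<close>)
    thus ?thesis by (rule bij_betw_same_card)
  qed
  have "(\<Sum>\<sigma>\<in>configs N. H (flux N \<sigma>)) = (\<Sum>\<omega>\<in>?C. \<Sum>\<sigma>\<in>{\<sigma>\<in>configs N. flux N \<sigma> = \<omega>}. H (flux N \<sigma>))"
  proof (rule sum.group[symmetric])
    show "flux N ` configs N \<subseteq> ?C" using flux_closed by (auto simp: flux_def)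
  qed (use finC \<open>finite ?C\<close> in auto)
  also have "\<dots> = (\<Sum>\<omega>\<in>?C. real (card ?K) * H \<omega>)"
  proof (intro sum.cong refl)
    fix \<omega> assume \<omega>: "\<omega> \<in> ?C"
    have "(\<Sum>\<sigma>\<in>{\<sigma>\<in>configs N. flux N \<sigma> = \<omega>}. H (flux N \<sigma>)) = (\<Sum>\<sigma>\<in>{\<sigma>\<in>configs N. flux N \<sigma> = \<omega>}. H \<omega>)"
      by (intro sum.cong refl) auto
    thus "(\<Sum>\<sigma>\<in>{\<sigma>\<in>configs N. flux N \<sigma> = \<omega>}. H (flux N \<sigma>)) = real (card ?K) * H \<omega>"
      unfolding sum_constant fib[OF \<omega>] .
  qed
  finally show ?thesis by (simp add: sum_distrib_left)
qed

text \<open>Each unoriented plaquette is counted twice, with exponent 2 \<beta> off the flux and -2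
  \<beta> on it; hence the activity exp (-4 \<beta>).\<close>

lemma gibbs_weight_flux:
  "gibbs_weight \<beta> N \<sigma> = exp (2 * \<beta> * real (card (plaqs2 N :: ((int^'m::finite) \<times> 'm set) set))) * exp (-4 * \<beta>) ^ card (flux N (\<sigma> :: (int^'m) \<times> 'm \<Rightarrow> bool))"
proof -
  let ?P = "plaqs2 N :: ((int^'m) \<times> 'm set) set"
  let ?\<pi> = "\<lambda>(x :: int^'m, i :: 'm, j :: 'm). (x, {i, j})"
  let ?h = "\<lambda>(x, S). cob (edge_sign \<sigma>) x S"
  have "(\<Sum>p\<in>plaqs N. rho (dsig \<sigma> p)) = (\<Sum>p\<in>plaqs N. ?h (?\<pi> p))"
    by (intro sum.cong refl) (auto simp: plaqs_iff cob_edge_sign)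
  also have "\<dots> = (\<Sum>q\<in>?P. \<Sum>p\<in>{p\<in>plaqs N. ?\<pi> p = q}. ?h (?\<pi> p))"
    by (rule sum.group[symmetric, OF finite_plaqs finite_plaqs2]) (auto simp: plaqs2_def plaqs_iff)
  also have "\<dots> = (\<Sum>q\<in>?P. 2 * ?h q)"
  proof (intro sum.cong refl)
    fix q assume q: "q \<in> ?P"
    then obtain x i j where ij: "q = (x, {i, j})" "i \<noteq> j" "cell N x {i, j}"
      unfolding plaqs2_def by (auto elim!: card_2_doubleton)
    have "{p\<in>plaqs N. ?\<pi> p = q} = {(x, i, j), (x, j, i)}"
      using ij by (auto simp: plaqs_iff doubleton_eq_iff insert_commute)
    thus "(\<Sum>p\<in>{p\<in>plaqs N. ?\<pi> p = q}. ?h (?\<pi> p)) = 2 * ?h q"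
      using ij by (simp add: insert_commute)
  qed
  also have "\<dots> = 2 * (\<Sum>q\<in>?P. 1 - 2 * (if q \<in> flux N \<sigma> then 1 else 0))"
    unfolding sum_distrib_left
  proof (intro sum.cong refl)
    fix q assume "q \<in> ?P"
    thus "2 * ?h q = 2 * (1 - 2 * (if q \<in> flux N \<sigma> then 1 else 0))"
      using sgnset_flux[of "fst q" "snd q" N \<sigma>] by (auto simp: sgnset_def split: prod.splits)
  qed
  also have "(\<Sum>q\<in>?P. 1 - 2 * (if q \<in> flux N \<sigma> then 1 else (0::real))) = real (card ?P) - 2 * real (card (flux N \<sigma>))"
  proof -
    have "?P \<inter> flux N \<sigma> = flux N \<sigma>" by (auto simp: flux_def)
    moreover have "(\<Sum>q\<in>?P. if q \<in> flux N \<sigma> then 1 else (0::real)) = real (card (?P \<inter> flux N \<sigma>))"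
      by (subst sum.inter_restrict[OF finite_plaqs2, symmetric]) simp
    ultimately show ?thesis by (simp add: sum_subtractf sum_distrib_left[symmetric])
  qed
  finally have e: "(\<Sum>p\<in>plaqs N. rho (dsig \<sigma> p)) = 2 * (real (card ?P) - 2 * real (card (flux N \<sigma>)))" .
  have "\<beta> * (\<Sum>p\<in>plaqs N. rho (dsig \<sigma> p)) = 2 * \<beta> * real (card ?P) + real (card (flux N \<sigma>)) * (-4 * \<beta>)"
    unfolding e by (simp add: algebra_simps)
  thus ?thesis unfolding gibbs_weight_def by (simp only: exp_add exp_of_nat_mult)
qed

text \<open>A plaquette lies in at most 2 (m - 2) cubes, one on either side in each direction
  outside S, and each cube has 5 further faces.\<close>

lemma card_neighbours_cubes:
  fixes p :: "(int^'m::finite) \<times> 'm set"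
  shows "finite {q. q \<noteq> p \<and> (\<exists>c\<in>cubes N. p \<in> c \<and> q \<in> c)}
    \<and> card {q. q \<noteq> p \<and> (\<exists>c\<in>cubes N. p \<in> c \<and> q \<in> c)} \<le> 10 * (CARD('m) - 2)"
proof -
  obtain x S where p: "p = (x, S)" by (cases p)
  let ?N = "{q. q \<noteq> p \<and> (\<exists>c\<in>cubes N. p \<in> c \<and> q \<in> c)}"
  show ?thesis
  proof (cases "card S = 2")
    case False
    have "?N = {}"
    proof (rule ccontr)
      assume "?N \<noteq> {}"
      then obtain c where "c \<in> cubes N" "p \<in> c" by auto
      hence "p \<in> plaqs2 N" using cube_faces_plaqs2 unfolding cubes_def by fast
      thus False using False p unfolding plaqs2_def by simp
    qed
    thus ?thesis by (simp only: finite.emptyI card.empty) simp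
  next
    case True
    define U where "U = (\<Union>c\<in>-S. \<Union>y\<in>{x, x - off c 1}. if p \<in> cube_faces y (insert c S) then cube_faces y (insert c S) - {p} else {})"
    have sub: "?N \<subseteq> U"
    proof
      fix q assume "q \<in> ?N"
      then obtain y T where yT: "q \<noteq> p" "p \<in> cube_faces y T" "q \<in> cube_faces y T" unfolding cubes_def by auto
      obtain c where c: "c \<in> T" "S = T - {c}" "x = y \<or> x = y + off c 1"
        using yT(2) p cube_faces_cases by metis
      have "T = insert c S" "c \<in> -S" "y \<in> {x, x - off c 1}" using c by auto
      thus "q \<in> U" unfolding U_def using yT by force
    qed
    have face_card: "card (cube_faces y (insert c S)) \<le> 6" "finite (cube_faces y (insert c S))" if "c \<in> -S" for y c
    proof -
      have "card (cube_faces y (insert c S)) \<le> (\<Sum>d\<in>insert c S. card {(y, insert c S - {d}), (y + off d 1, insert c S - {d})})"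
        unfolding cube_faces_def by (rule card_UN_le) simp
      also have "\<dots> \<le> (\<Sum>d\<in>insert c S. 2)" by (intro sum_mono) (simp add: card_insert_if)
      also have "\<dots> = 6" using True that by simp
      finally show "card (cube_faces y (insert c S)) \<le> 6" .
      show "finite (cube_faces y (insert c S))" unfolding cube_faces_def by auto
    qed
    have finU: "finite U" unfolding U_def using face_card(2) by auto
    have "card U \<le> (\<Sum>c\<in>-S. card (\<Union>y\<in>{x, x - off c 1}. if p \<in> cube_faces y (insert c S) then cube_faces y (insert c S) - {p} else {}))"
      unfolding U_def by (rule card_UN_le) simp
    also have "\<dots> \<le> (\<Sum>c\<in>-S. 10)"
    proof (intro sum_mono)
      fix c assume c: "c \<in> -S"
      have le5: "card (if p \<in> cube_faces y (insert c S) then cube_faces y (insert c S) - {p} else {}) \<le> 5" for y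
        using face_card[OF c, of y] by (auto simp: card_Diff_singleton)
      have "card (\<Union>y\<in>{x, x - off c 1}. if p \<in> cube_faces y (insert c S) then cube_faces y (insert c S) - {p} else {})
        \<le> (\<Sum>y\<in>{x, x - off c 1}. card (if p \<in> cube_faces y (insert c S) then cube_faces y (insert c S) - {p} else {}))"
        by (rule card_UN_le) simp
      also have "\<dots> \<le> (\<Sum>y\<in>{x, x - off c 1}. 5)" by (intro sum_mono le5)
      also have "\<dots> \<le> 10" by (simp add: card_insert_if)
      finally show "card (\<Union>y\<in>{x, x - off c 1}. if p \<in> cube_faces y (insert c S) then cube_faces y (insert c S) - {p} else {}) \<le> 10" .
    qed
    also have "\<dots> = 10 * (CARD('m) - 2)" using True by (simp add: Compl_eq_Diff_UNIV card_Diff_subset)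
    finally show ?thesis using sub finU card_mono[OF finU sub] finite_subset[OF sub finU] by linarith
  qed
qed

text \<open>The threshold is solved for here: exp (-4 \<beta>) D^2 = exp (-4 \<beta> + 2 ln D), and
  this stays below exp (-2/3) once \<beta> exceeds (1/2) ln D + 1/6.\<close>

lemma parity_gas_cubes:
  assumes "CARD('m::finite) \<ge> 3" "\<beta> > 1/2 * ln (10 * (real CARD('m) - 2)) + 1/6"
  shows "parity_gas (cubes N :: ((int^'m) \<times> 'm set) set set) (10 * (CARD('m) - 2)) (exp (-4 * \<beta>))"
proof
  fix p :: "(int^'m) \<times> 'm set"
  let ?N = "{q. q \<noteq> p \<and> (\<exists>c\<in>cubes N. p \<in> c \<and> q \<in> c)}"
  show "finite ?N" "card ?N \<le> 10 * (CARD('m) - 2)" using card_neighbours_cubes by blast+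
next
  show "10 \<le> 10 * (CARD('m) - 2)" using assms(1) by simp
  show "0 < exp (-4 * \<beta>)" by simp
  let ?D = "10 * (real CARD('m) - 2)"
  have D: "real (10 * (CARD('m) - 2)) = ?D" "?D > 0" using assms(1) by (auto simp: of_nat_diff)
  have "exp (-4 * \<beta>) * ?D ^ 2 = exp (-4 * \<beta>) * exp (ln ?D) ^ 2" using D by simp
  also have "\<dots> = exp (-4 * \<beta> + 2 * ln ?D)" by (simp only: exp_add exp_double)
  also have "\<dots> \<le> exp (-2/3)" using assms(2) by simp
  finally show "exp (-4 * \<beta>) * real (10 * (CARD('m) - 2)) ^ 2 \<le> exp (-2/3)" unfolding D(1) .
qed

section \<open>Rectangular loops in a finite box\<close>

definition sq :: "int^'m::finite \<Rightarrow> 'm \<Rightarrow> 'm \<Rightarrow> nat \<Rightarrow> nat \<Rightarrow> ((int^'m) \<times> 'm set) set" where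
  "sq a i j R T = (\<lambda>(k, l). (a + off i (int k) + off j (int l), {i, j})) ` ({..<R} \<times> {..<T})"

definition line :: "((int^'m::finite) \<times> 'm \<Rightarrow> bool) \<Rightarrow> int^'m \<Rightarrow> 'm \<Rightarrow> nat \<Rightarrow> real" where
  "line \<sigma> a i R = (\<Prod>k<R. rho (\<sigma> (a + off i (int k), i)))"

lemma off_0 [simp]: "off i 0 = 0"
  by (simp add: vec_eq_iff off_nth)

lemma off_add: "off i (s + t) = off i s + off i t"
  by (simp add: vec_eq_iff off_nth)

lemma off_Suc: "off i (int (Suc k)) = off i (int k) + off i 1"
  by (simp add: vec_eq_iff off_nth)

lemma sq_inj:
  assumes "i \<noteq> j"
  shows "inj_on (\<lambda>(k, l). (a + off i (int k) + off j (int l), {i, j})) X"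
proof (rule inj_onI, clarify)
  fix k l k' l' assume e: "a + off i (int k) + off j (int l) = a + off i (int k') + off j (int l')"
  show "k = k' \<and> l = l'"
    using arg_cong[OF e, of "\<lambda>v. v $ i"] arg_cong[OF e, of "\<lambda>v. v $ j"] assms by (simp add: off_nth)
qed

lemma finite_sq: "finite (sq a i j R T)"
  unfolding sq_def by simp

lemma sq_iff: "p \<in> sq a i j R T \<longleftrightarrow> (\<exists>k<R. \<exists>l<T. p = (a + off i (int k) + off j (int l), {i, j}))"
  unfolding sq_def by auto

lemma sq_add: "sq a i j (n + n') T = sq a i j n T \<union> sq (a + off i (int n)) i j n' T"
proof (intro set_eqI iffI)
  fix p assume "p \<in> sq a i j (n + n') T"
  then obtain k l where kl: "k < n + n'" "l < T" "p = (a + off i (int k) + off j (int l), {i, j})"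
    unfolding sq_iff by auto
  show "p \<in> sq a i j n T \<union> sq (a + off i (int n)) i j n' T"
  proof (cases "k < n")
    case True
    thus ?thesis using kl unfolding Un_iff sq_iff by blast
  next
    case False
    hence "off i (int k) = off i (int n) + off i (int (k - n))" "k - n < n'"
      using kl(1) by (simp_all add: off_add[symmetric])
    hence "p = (a + off i (int n) + off i (int (k - n)) + off j (int l), {i, j})" "k - n < n'"
      using kl(3) by (simp_all add: add_ac)
    thus ?thesis using kl(2) unfolding Un_iff sq_iff by blast
  qed
next
  fix p assume "p \<in> sq a i j n T \<union> sq (a + off i (int n)) i j n' T"
  thus "p \<in> sq a i j (n + n') T"
  proof
    assume "p \<in> sq (a + off i (int n)) i j n' T"
    then obtain k l where kl: "k < n'" "l < T" "p = (a + off i (int n) + off i (int k) + off j (int l), {i, j})"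
      unfolding sq_iff by auto
    have "p = (a + off i (int (n + k)) + off j (int l), {i, j})" using kl(3) by (simp add: off_add add_ac)
    moreover have "n + k < n + n'" using kl(1) by simp
    ultimately show ?thesis using kl(2) unfolding sq_iff by blast
  qed (auto simp: sq_iff intro: trans_less_add1)
qed

lemma prod_sq:
  assumes "i \<noteq> j"
  shows "(\<Prod>p\<in>sq a i j R T. h p) = (\<Prod>k<R. \<Prod>l<T. h (a + off i (int k) + off j (int l), {i, j}))"
  unfolding sq_def prod.reindex[OF sq_inj[OF assms]] prod.cartesian_product
  by (intro prod.cong refl) auto

lemma sum_sq:
  assumes "i \<noteq> j"
  shows "(\<Sum>p\<in>sq a i j R T. h p) = (\<Sum>k<R. \<Sum>l<T. h (a + off i (int k) + off j (int l), {i, j}))"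
  unfolding sq_def sum.reindex[OF sq_inj[OF assms]] sum.cartesian_product
  by (intro sum.cong refl) auto

lemma sq_subset_plaqs2:
  assumes "i \<noteq> j" "\<And>c. - int N \<le> a $ c \<and> a $ c + (if c = i then int R else if c = j then int T else 0) \<le> int N"
  shows "sq a i j R T \<subseteq> plaqs2 N"
proof
  fix p assume "p \<in> sq a i j R T"
  then obtain k l where kl: "k < R" "l < T" "p = (a + off i (int k) + off j (int l), {i, j})"
    unfolding sq_def by auto
  have "cell N (a + off i (int k) + off j (int l)) {i, j}"
    unfolding cell_def
  proof
    fix c
    show "- int N \<le> (a + off i (int k) + off j (int l)) $ c \<and>
      (a + off i (int k) + off j (int l)) $ c + (if c \<in> {i, j} then 1 else 0) \<le> int N"
      using assms(1) assms(2)[of c] kl(1,2) by (auto simp: off_nth)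
  qed
  thus "p \<in> plaqs2 N" using kl assms(1) unfolding plaqs2_def by simp
qed

lemma prod_telescope:
  fixes u :: "nat \<Rightarrow> real"
  assumes "\<And>t. u t * u t = 1"
  shows "(\<Prod>t<n. u t * u (Suc t)) = u 0 * u n"
proof (induction n)
  case (Suc n)
  have "(\<Prod>t<Suc n. u t * u (Suc t)) = u 0 * u (Suc n) * (u n * u n)" using Suc by (simp add: mult_ac)
  thus ?case by (simp add: assms)
qed (simp add: assms)

text \<open>An interior edge borders two plaquettes of the rectangle, so vertical edges telescope
  along rows and horizontal ones along columns.\<close>

lemma stokes:
  assumes ij: "i \<noteq> j"
  shows "(\<Prod>(x, S)\<in>sq a i j R T. cob (edge_sign \<sigma>) x S)
    = line \<sigma> a i R * line \<sigma> (a + off j (int T)) i R * (line \<sigma> a j T * line \<sigma> (a + off i (int R)) j T)"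
proof -
  define A where "A k l = rho (\<sigma> (a + off i (int k) + off j (int l), i))" for k l
  define B where "B k l = rho (\<sigma> (a + off i (int k) + off j (int l), j))" for k l
  have AB: "A k l * A k l = 1" "B k l * B k l = 1" for k l by (simp_all add: A_def B_def)
  have c: "cob (edge_sign \<sigma>) (a + off i (int k) + off j (int l)) {i, j} = B k l * B (Suc k) l * (A k l * A k (Suc l))" for k l
    unfolding cob_pair[OF ij] edge_sign_def the_elem_eq A_def B_def off_Suc by (simp add: add_ac)
  have "(\<Prod>(x, S)\<in>sq a i j R T. cob (edge_sign \<sigma>) x S) = (\<Prod>k<R. \<Prod>l<T. B k l * B (Suc k) l * (A k l * A k (Suc l)))"
    by (simp add: prod_sq[OF ij] c)
  also have "\<dots> = (\<Prod>k<R. \<Prod>l<T. B k l * B (Suc k) l) * (\<Prod>k<R. \<Prod>l<T. A k l * A k (Suc l))"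
    by (simp only: prod.distrib)
  also have "(\<Prod>k<R. \<Prod>l<T. B k l * B (Suc k) l) = (\<Prod>l<T. \<Prod>k<R. B k l * B (Suc k) l)" by (rule prod.swap)
  also have "\<dots> = (\<Prod>l<T. B 0 l * B R l)"
    by (intro prod.cong refl prod_telescope[where u = "\<lambda>k. B k _"]) (rule AB)
  also have "(\<Prod>k<R. \<Prod>l<T. A k l * A k (Suc l)) = (\<Prod>k<R. A k 0 * A k T)"
    by (intro prod.cong refl prod_telescope) (rule AB)
  finally show ?thesis unfolding prod.distrib by (simp add: line_def A_def B_def mult_ac add_ac)
qed

text \<open>Since R and T are positive, opposite sides are disjoint and the set \<open>rect\<close>
  lists every edge of the loop once, as Stokes requires.\<close>

lemma chi_rect:
  assumes ij: "i \<noteq> j" and RT: "R \<ge> 1" "T \<ge> 1"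
  shows "chi (rect a i j R T) \<sigma> = (\<Prod>(x, S)\<in>sq a i j R T. cob (edge_sign \<sigma>) x S)"
proof -
  let ?s = "\<lambda>b c n. (\<lambda>k. (b + off c (int k), c)) ` {..<n}"
  have inj: "inj_on (\<lambda>k. (b + off c (int k), c)) X" for b :: "int^'a" and c X
  proof (rule inj_onI)
    fix k k' assume "(b + off c (int k), c) = (b + off c (int k'), c)"
    hence "(b + off c (int k)) $ c = (b + off c (int k')) $ c" by simp
    thus "k = k'" by (simp add: off_nth)
  qed
  have chi_s: "chi (?s b c n) \<sigma> = line \<sigma> b c n" for b c n
    unfolding chi_def line_def prod.reindex[OF inj] by simp
  have Un: "chi (X \<union> Y) \<sigma> = chi X \<sigma> * chi Y \<sigma>" if "finite X" "finite Y" "X \<inter> Y = {}" for X Y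
    unfolding chi_def using that by (rule prod.union_disjoint)
  have e: "rect a i j R T = (?s a i R \<union> ?s (a + off j (int T)) i R) \<union> (?s a j T \<union> ?s (a + off i (int R)) j T)"
    unfolding rect_def by auto
  have d1: "?s a i R \<inter> ?s (a + off j (int T)) i R = {}"
  proof -
    have "a + off i (int k) \<noteq> a + off j (int T) + off i (int k')" for k k'
    proof
      assume "a + off i (int k) = a + off j (int T) + off i (int k')"
      from arg_cong[OF this, of "\<lambda>v. v $ j"] show False using ij RT by (simp add: off_nth)
    qed
    thus ?thesis by auto
  qed
  have d2: "?s a j T \<inter> ?s (a + off i (int R)) j T = {}"
  proof -
    have "a + off j (int k) \<noteq> a + off i (int R) + off j (int k')" for k k'
    proof
      assume "a + off j (int k) = a + off i (int R) + off j (int k')"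
      from arg_cong[OF this, of "\<lambda>v. v $ i"] show False using ij RT by (simp add: off_nth)
    qed
    thus ?thesis by auto
  qed
  have "chi (rect a i j R T) \<sigma> = chi (?s a i R \<union> ?s (a + off j (int T)) i R) \<sigma> * chi (?s a j T \<union> ?s (a + off i (int R)) j T) \<sigma>"
    unfolding e by (rule Un) (use ij in auto)
  also have "\<dots> = line \<sigma> a i R * line \<sigma> (a + off j (int T)) i R * (line \<sigma> a j T * line \<sigma> (a + off i (int R)) j T)"
    using Un[OF _ _ d1] Un[OF _ _ d2] by (simp add: chi_s)
  finally show ?thesis using stokes[OF ij] by simp
qed

lemma prod_cob_flux:
  assumes "q \<subseteq> plaqs2 N"
  shows "(\<Prod>(x, S)\<in>q. cob (edge_sign \<sigma>) x S) = (-1) ^ card (flux N \<sigma> \<inter> q)"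
proof -
  have "(\<Prod>(x, S)\<in>q. cob (edge_sign \<sigma>) x S) = (\<Prod>(x, S)\<in>q. sgnset (flux N \<sigma>) x S)"
    using assms by (intro prod.cong refl) (auto simp: sgnset_flux)
  thus ?thesis using prod_sgnset[OF finite_subset[OF assms finite_plaqs2]] by simp
qed

section \<open>Loop expectations as ratios of gas sums\<close>

context
  fixes \<beta> :: real and N D :: nat and gas_type :: "'m::finite itself"
  assumes gas: "parity_gas (cubes N :: ((int^'m) \<times> 'm set) set set) D (exp (-4 * \<beta>))"
begin

interpretation parity_gas "cubes N :: ((int^'m) \<times> 'm set) set set" D "exp (-4 * \<beta>)"
  by (rule gas)

text \<open>All faces of a cube have their lowest corner within one unit of that of the cube. This
  makes each coordinate an admissible distance function for the decay.\<close>

lemma adj_coord: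
  assumes "adj p q"
  shows "fst p $ k \<le> fst q $ k + 1"
proof -
  obtain y T where yT: "p \<in> cube_faces y T" "q \<in> cube_faces y T"
    using assms unfolding adj_def by (auto simp: cubes_def)
  have "fst r $ k = y $ k \<or> fst r $ k = y $ k + 1" if "r \<in> cube_faces y T" for r
    using that unfolding cube_faces_def by (auto simp: off_nth)
  from this[OF yT(1)] this[OF yT(2)] show ?thesis by auto
qed

text \<open>By Stokes the loop equals the parity of the flux through the rectangle. The factor from
  the ground state energy and the number of flat configurations is common to both sums and
  cancels.\<close>

lemma expect_rect:
  fixes a :: "int^'m"
  assumes ij: "i \<noteq> j" and RT: "R \<ge> 1" "T \<ge> 1" and sub: "sq a i j R T \<subseteq> plaqs2 N"
  shows "expect \<beta> N (wilson (rect a i j R T)) = Z (sq a i j R T) (plaqs2 N) / Z {} (plaqs2 N)"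
proof -
  define c where "c = exp (2 * \<beta> * real (card (plaqs2 N :: ((int^'m) \<times> 'm set) set)))"
  define \<kappa> where "\<kappa> = real (card {\<sigma> :: (int^'m) \<times> 'm \<Rightarrow> bool. \<sigma> \<in> configs N \<and> flux N \<sigma> = {}})"
  have sum: "(\<Sum>\<sigma>\<in>configs N. (-1) ^ card (flux N \<sigma> \<inter> q) * gibbs_weight \<beta> N \<sigma>) = c * \<kappa> * Z q (plaqs2 N)"
    for q :: "((int^'m) \<times> 'm set) set"
  proof -
    have "(\<Sum>\<sigma>\<in>configs N. (-1) ^ card (flux N \<sigma> \<inter> q) * gibbs_weight \<beta> N \<sigma>)
      = c * (\<Sum>\<sigma>\<in>configs N. (-1) ^ card (flux N \<sigma> \<inter> q) * exp (-4 * \<beta>) ^ card (flux N \<sigma>))"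
      unfolding gibbs_weight_flux c_def sum_distrib_left by (intro sum.cong refl) (simp only: mult_ac)
    also have "\<dots> = c * (\<kappa> * Z q (plaqs2 N))"
      unfolding sum_over_flux[where H = "\<lambda>\<omega>. (-1) ^ card (\<omega> \<inter> q) * exp (-4 * \<beta>) ^ card \<omega>"] \<kappa>_def Z_def even_on_cubes_def ..
    finally show ?thesis by simp
  qed
  have num: "(\<Sum>\<sigma>\<in>configs N. wilson (rect a i j R T) \<sigma> * gibbs_weight \<beta> N \<sigma>) = c * \<kappa> * Z (sq a i j R T) (plaqs2 N)"
    unfolding wilson_eq chi_rect[OF ij RT] prod_cob_flux[OF sub] by (rule sum)
  have den: "(\<Sum>\<sigma>\<in>(configs N :: ((int^'m) \<times> 'm \<Rightarrow> bool) set). gibbs_weight \<beta> N \<sigma>) = c * \<kappa> * Z {} (plaqs2 N)"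
    using sum[of "{}"] by simp
  have "(\<Sum>\<sigma>\<in>(configs N :: ((int^'m) \<times> 'm \<Rightarrow> bool) set). gibbs_weight \<beta> N \<sigma>) > 0"
    using finite_spins[OF finite_edges] spins_nonempty
    by (intro sum_pos) (auto simp: configs_eq gibbs_weight_def)
  hence "c * \<kappa> \<noteq> 0" unfolding den by auto
  thus ?thesis unfolding expect_def num den by simp
qed

lemma Z_cong_Int:
  assumes "\<And>\<omega>. \<omega> \<subseteq> \<Lambda> \<Longrightarrow> even_on_cubes \<omega> \<Longrightarrow> (-1) ^ card (\<omega> \<inter> q1) = ((-1) ^ card (\<omega> \<inter> q2) :: real)"
  shows "Z q1 \<Lambda> = Z q2 \<Lambda>"
  unfolding Z_def using assms by (intro sum.cong refl) auto

lemma ln_Z_ratio_remove: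
  fixes d :: "(int^'m) \<times> 'm set \<Rightarrow> real"
  assumes "\<And>u v. adj u v \<Longrightarrow> d u \<le> d v + 1" "\<And>u. u \<in> sym_diff q1 q2 \<Longrightarrow> d u \<le> 0" "M \<subseteq> plaqs2 N"
  shows "\<bar>(ln (Z q1 (plaqs2 N)) - ln (Z q2 (plaqs2 N))) - (ln (Z q1 (plaqs2 N - M)) - ln (Z q2 (plaqs2 N - M)))\<bar>
    \<le> (\<Sum>p\<in>M. exp (- d p / 120))"
proof (rule abs_diff_le_sum_removed[where F = "\<lambda>L. ln (Z q1 L) - ln (Z q2 L)"])
  show "finite M" using assms(3) finite_plaqs2 finite_subset by blast
  fix L :: "((int^'m) \<times> 'm set) set" and p assume "L \<subseteq> plaqs2 N" "p \<in> L"
  thus "\<bar>(ln (Z q1 L) - ln (Z q2 L)) - (ln (Z q1 (L - {p})) - ln (Z q2 (L - {p})))\<bar> \<le> exp (- d p / 120)"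
    using assms finite_subset[OF _ finite_plaqs2] by (intro ln_Z_ratio_decay) auto
qed (use assms in auto)

lemma second_difference:
  fixes i j :: 'm
  assumes ij: "i \<noteq> j" and RT: "R \<ge> 1" "T \<ge> 1" and N: "N \<ge> R + 2" "N \<ge> T"
  shows "\<bar>ln (expect \<beta> N (wilson (rect 0 i j (R + 2) T))) - ln (expect \<beta> N (wilson (rect 0 i j (R + 1) T)))
     - ln (expect \<beta> N (wilson (rect (off i 1) i j (R + 1) T))) + ln (expect \<beta> N (wilson (rect (off i 1) i j R T)))\<bar>
    \<le> 2 * real T * exp (- 1/120) ^ R"
proof -
  let ?P = "plaqs2 N :: ((int^'m) \<times> 'm set) set"
  define W where "W = sq (off i 1) i j R T"
  define A where "A = sq 0 i j 1 T"
  define B where "B = sq (off i (int (R + 1))) i j 1 T"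
  note split = sq_add[where i = i and j = j and T = T]
  have q: "sq 0 i j (R + 2) T = A \<union> W \<union> B" "sq 0 i j (R + 1) T = A \<union> W" "sq (off i 1) i j (R + 1) T = W \<union> B"
  proof -
    show "sq (off i 1) i j (R + 1) T = W \<union> B"
      unfolding W_def B_def split by (simp add: off_add add_ac)
    show "sq 0 i j (R + 1) T = A \<union> W"
      using split[of 0 1 R] unfolding A_def W_def by (simp add: add.commute)
    have "sq 0 i j (R + 2) T = A \<union> sq (off i 1) i j (R + 1) T"
      using split[of 0 1 "R + 1"] unfolding A_def by (simp add: add.commute)
    thus "sq 0 i j (R + 2) T = A \<union> W \<union> B" using \<open>sq (off i 1) i j (R + 1) T = W \<union> B\<close> by auto
  qed
  have all: "sq 0 i j (R + 2) T \<subseteq> ?P" using ij N by (intro sq_subset_plaqs2) auto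
  hence sub: "W \<subseteq> ?P" "A \<subseteq> ?P" "B \<subseteq> ?P" unfolding q by auto
  \<comment> \<open>Nonpositive on the strip B, where the signs differ, and R + 1 on the strip A
    that is removed.\<close>
  define d :: "(int^'m) \<times> 'm set \<Rightarrow> real" where "d p = real (R + 1) - real_of_int (fst p $ i)" for p
  have lip: "d u \<le> d v + 1" if "adj u v" for u v
  proof -
    have "fst v $ i \<le> fst u $ i + 1" using that adj_sym[of u v] by (intro adj_coord) simp
    thus ?thesis unfolding d_def by linarith
  qed
  have dB: "d u \<le> 0" if "u \<in> B" for u
    using that ij unfolding B_def sq_def d_def by (auto simp: off_nth)
  have sumA: "(\<Sum>p\<in>A. exp (- d p / 120)) \<le> real T * exp (- 1/120) ^ R"
  proof -
    have "(\<Sum>p\<in>A. exp (- d p / 120)) = real T * exp (- real (R + 1) / 120)"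
      unfolding A_def sum_sq[OF ij] d_def using ij by (simp add: off_nth)
    also have "\<dots> \<le> real T * exp (real R * (- 1/120))" by (intro mult_left_mono) auto
    finally show ?thesis by (simp only: exp_of_nat_mult)
  qed
  let ?F = "\<lambda>q1 q2 L. ln (Z q1 L) - ln (Z q2 L)"
  have F1: "\<bar>?F (A \<union> W \<union> B) (A \<union> W) ?P - ?F (A \<union> W \<union> B) (A \<union> W) (?P - A)\<bar> \<le> (\<Sum>p\<in>A. exp (- d p / 120))"
    by (rule ln_Z_ratio_remove) (use lip dB sub in auto)
  have F2: "\<bar>?F (W \<union> B) W ?P - ?F (W \<union> B) W (?P - A)\<bar> \<le> (\<Sum>p\<in>A. exp (- d p / 120))"
    by (rule ln_Z_ratio_remove) (use lip dB sub in auto)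
  have "Z (A \<union> X) (?P - A) = Z X (?P - A)" for X
  proof (rule Z_cong_Int)
    fix \<omega> assume "\<omega> \<subseteq> ?P - A"
    hence "\<omega> \<inter> (A \<union> X) = \<omega> \<inter> X" by auto
    thus "(-1) ^ card (\<omega> \<inter> (A \<union> X)) = ((-1) ^ card (\<omega> \<inter> X) :: real)" by simp
  qed
  from this[of "W \<union> B"] this[of W]
  have "Z (A \<union> W \<union> B) (?P - A) = Z (W \<union> B) (?P - A)" "Z (A \<union> W) (?P - A) = Z W (?P - A)"
    by (simp_all only: Un_assoc)
  hence main: "\<bar>?F (A \<union> W \<union> B) (A \<union> W) ?P - ?F (W \<union> B) W ?P\<bar> \<le> 2 * (real T * exp (- 1/120) ^ R)"
    using F1 F2 sumA by simp
  have Zp: "Z q ?P > 0" for q by (rule Z_pos[OF finite_plaqs2])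
  have lnE: "ln (expect \<beta> N (wilson (rect a i j n T))) = ln (Z (sq a i j n T) ?P) - ln (Z {} ?P)"
    if "n \<ge> 1" "sq a i j n T \<subseteq> ?P" for a n
    using expect_rect[OF ij that(1) RT(2) that(2)] Zp[of "sq a i j n T"] Zp[of "{}"]
    by (simp add: ln_div)
  have "ln (expect \<beta> N (wilson (rect 0 i j (R + 2) T))) = ln (Z (A \<union> W \<union> B) ?P) - ln (Z {} ?P)"
    "ln (expect \<beta> N (wilson (rect 0 i j (R + 1) T))) = ln (Z (A \<union> W) ?P) - ln (Z {} ?P)"
    "ln (expect \<beta> N (wilson (rect (off i 1) i j (R + 1) T))) = ln (Z (W \<union> B) ?P) - ln (Z {} ?P)"
    "ln (expect \<beta> N (wilson (rect (off i 1) i j R T))) = ln (Z W ?P) - ln (Z {} ?P)"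
    using lnE[of "R + 2" 0] lnE[of "R + 1" 0] lnE[of "R + 1" "off i 1"] lnE[of R "off i 1"] RT sub
    unfolding q by (auto simp flip: W_def)
  thus ?thesis using main by (simp add: mult.assoc abs_if split: if_splits)
qed

text \<open>A third direction k allows a tunnel over the loop. Plaquettes at height l are removed at
  cost exp (- l / 120), so the walls cost a geometric series per unit of perimeter. The lid closes
  the tunnel at the free boundary, where a closed set could otherwise escape; its cost vanishes as N
  grows.\<close>

lemma perimeter_bound:
  fixes i j k :: 'm
  assumes ijk: "i \<noteq> j" "k \<noteq> i" "k \<noteq> j" and RT: "R \<ge> 1" "T \<ge> 1" and N: "N \<ge> R" "N \<ge> T"
  shows "expect \<beta> N (wilson (rect 0 i j R T)) > 0"
    "- ln (expect \<beta> N (wilson (rect 0 i j R T)))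
      \<le> 2 / (1 - exp (- 1/120)) * real (R + T) + real R * real T * exp (- 1/120) ^ N"
proof -
  let ?P = "plaqs2 N :: ((int^'m) \<times> 'm set) set"
  let ?e = "exp (- 1/120) :: real"
  define q where "q = sq 0 i j R T"
  define top where "top = sq (off k (int N)) i j R T"
  define w1 where "w1 = sq 0 i k R N"
  define w2 where "w2 = sq (off j (int T)) i k R N"
  define w3 where "w3 = sq 0 j k T N"
  define w4 where "w4 = sq (off i (int R)) j k T N"
  define M where "M = top \<union> (w1 \<union> (w2 \<union> (w3 \<union> w4)))"
  have sub: "q \<subseteq> ?P" "top \<subseteq> ?P" "w1 \<subseteq> ?P" "w2 \<subseteq> ?P" "w3 \<subseteq> ?P" "w4 \<subseteq> ?P"
    unfolding q_def top_def w1_def w2_def w3_def w4_def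
    by (intro sq_subset_plaqs2; use ijk N in \<open>auto simp: off_nth\<close>)+
  define d :: "(int^'m) \<times> 'm set \<Rightarrow> real" where "d p = real_of_int (fst p $ k)" for p
  have lip: "d u \<le> d v + 1" if "adj u v" for u v
    using adj_coord[OF that, of k] unfolding d_def by linarith
  have dq: "d u \<le> 0" if "u \<in> q" for u
    using that ijk unfolding q_def sq_def d_def by (auto simp: off_nth)
  let ?h = "\<lambda>p. exp (- d p / 120)"
  have geom: "(\<Sum>l<N. exp (- real l / 120)) \<le> 1 / (1 - ?e)"
  proof -
    have "exp (- real l / 120) = ?e ^ l" for l
    proof -
      have "exp (- real l / 120) = exp (real l * (- 1/120))" by simp
      thus ?thesis by (simp only: exp_of_nat_mult)
    qed
    hence "(\<Sum>l<N. exp (- real l / 120)) = (\<Sum>l<N. ?e ^ l)" by simp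
    also have "\<dots> = (1 - ?e ^ N) / (1 - ?e)" by (rule sum_gp_strict[THEN trans]) simp
    also have "\<dots> \<le> 1 / (1 - ?e)" by (intro divide_right_mono) auto
    finally show ?thesis .
  qed
  have wall: "(\<Sum>p\<in>sq a c k n N. ?h p) \<le> real n * (1 / (1 - ?e))" if "a $ k = 0" "c \<noteq> k" for a c n
  proof -
    have "(\<Sum>p\<in>sq a c k n N. ?h p) = real n * (\<Sum>l<N. exp (- real l / 120))"
      unfolding sum_sq[OF that(2)] d_def using that by (simp add: off_nth)
    thus ?thesis using mult_left_mono[OF geom, of "real n"] by simp
  qed
  have sumw: "sum ?h w1 \<le> real R * (1 / (1 - ?e))" "sum ?h w2 \<le> real R * (1 / (1 - ?e))"
    "sum ?h w3 \<le> real T * (1 / (1 - ?e))" "sum ?h w4 \<le> real T * (1 / (1 - ?e))"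
    unfolding w1_def w2_def w3_def w4_def by (intro wall; use ijk in \<open>simp add: off_nth\<close>)+
  have sumtop: "sum ?h top = real R * real T * ?e ^ N"
  proof -
    have "sum ?h top = real R * real T * exp (real N * (- 1/120))"
      unfolding top_def sum_sq[OF ijk(1)] d_def using ijk by (simp add: off_nth)
    thus ?thesis by (simp only: exp_of_nat_mult)
  qed
  have un: "sum ?h (X \<union> Y) \<le> sum ?h X + sum ?h Y" if "finite X" "finite Y" for X Y
    using sum.union_inter[OF that, of ?h] sum_nonneg[of "X \<inter> Y" ?h] by simp
  have fin: "finite top" "finite w1" "finite w2" "finite w3" "finite w4"
    unfolding top_def w1_def w2_def w3_def w4_def by (rule finite_sq)+
  have "sum ?h M \<le> sum ?h top + (sum ?h w1 + (sum ?h w2 + (sum ?h w3 + sum ?h w4)))"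
    unfolding M_def
    using un[of top "w1 \<union> (w2 \<union> (w3 \<union> w4))"] un[of w1 "w2 \<union> (w3 \<union> w4)"] un[of w2 "w3 \<union> w4"] un[of w3 w4] fin
    by simp
  also have "\<dots> \<le> real R * real T * ?e ^ N + (real R * (1 / (1 - ?e)) + (real R * (1 / (1 - ?e)) + (real T * (1 / (1 - ?e)) + real T * (1 / (1 - ?e)))))"
    using sumw sumtop by (intro add_mono) auto
  also have "\<dots> = 2 / (1 - ?e) * real (R + T) + real R * real T * ?e ^ N"
    by (simp add: algebra_simps add_divide_distrib)
  finally have sumM: "sum ?h M \<le> 2 / (1 - ?e) * real (R + T) + real R * real T * ?e ^ N" .
  have rem: "\<bar>(ln (Z q ?P) - ln (Z {} ?P)) - (ln (Z q (?P - M)) - ln (Z {} (?P - M)))\<bar> \<le> sum ?h M"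
    by (rule ln_Z_ratio_remove) (use lip dq sub in \<open>auto simp: M_def\<close>)
  have Zeq: "Z q (?P - M) = Z {} (?P - M)"
  proof (rule Z_cong_Int)
    fix \<omega> assume \<omega>: "\<omega> \<subseteq> ?P - M" "even_on_cubes \<omega>"
    then obtain \<sigma> where \<sigma>: "flux N \<sigma> = \<omega>" using flux_surj[of \<omega> N] unfolding even_on_cubes_def by auto
    let ?\<Pi> = "\<lambda>s. \<Prod>(x, S)\<in>s. cob (edge_sign \<sigma>) x S"
    have one: "?\<Pi> s = 1" if "s \<subseteq> M" "s \<subseteq> ?P" for s
    proof -
      have "\<omega> \<inter> s = {}" using \<omega>(1) that(1) by auto
      thus ?thesis using prod_cob_flux[OF that(2), of \<sigma>] \<sigma> by simp
    qed
    have L: "line \<sigma> a c n * line \<sigma> a c n = 1" "line \<sigma> a c n * (line \<sigma> a c n * y) = y" for a c n y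
    proof -
      show "line \<sigma> a c n * line \<sigma> a c n = 1" unfolding line_def prod.distrib[symmetric] by simp
      thus "line \<sigma> a c n * (line \<sigma> a c n * y) = y" by (simp add: mult.assoc[symmetric])
    qed
    \<comment> \<open>Rectangle, lid and walls form the surface of a box, so by Stokes each boundary
      line occurs twice.\<close>
    have "?\<Pi> q * ?\<Pi> top * ?\<Pi> w1 * ?\<Pi> w2 * ?\<Pi> w3 * ?\<Pi> w4 = 1"
      unfolding q_def top_def w1_def w2_def w3_def w4_def
      using ijk by (simp add: stokes L mult_ac add_ac)
    moreover have "?\<Pi> top = 1" "?\<Pi> w1 = 1" "?\<Pi> w2 = 1" "?\<Pi> w3 = 1" "?\<Pi> w4 = 1"
      using sub by (intro one; auto simp: M_def)+
    ultimately have "?\<Pi> q = 1" by simp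
    thus "(-1) ^ card (\<omega> \<inter> q) = ((-1) ^ card (\<omega> \<inter> {}) :: real)"
      using prod_cob_flux[OF sub(1), of \<sigma>] \<sigma> by simp
  qed
  have Zp: "Z q ?P > 0" for q by (rule Z_pos[OF finite_plaqs2])
  have E: "expect \<beta> N (wilson (rect 0 i j R T)) = Z q ?P / Z {} ?P"
    using expect_rect[OF ijk(1) RT] sub(1) unfolding q_def by simp
  show "expect \<beta> N (wilson (rect 0 i j R T)) > 0" unfolding E using Zp by simp
  have "- ln (expect \<beta> N (wilson (rect 0 i j R T))) \<le> sum ?h M"
    using rem Zp[of q] Zp[of "{}"] unfolding E Zeq by (simp add: ln_div)
  thus "- ln (expect \<beta> N (wilson (rect 0 i j R T)))
      \<le> 2 / (1 - exp (- 1/120)) * real (R + T) + real R * real T * exp (- 1/120) ^ N"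
    using sumM by linarith
qed

end

section \<open>Infinite volume\<close>

definition boundary :: "(int^'m::finite) \<times> 'm \<times> 'm \<Rightarrow> ((int^'m) \<times> 'm) set" where
  "boundary p = (case p of (x, i, j) \<Rightarrow> {(x, i), (x + off i 1, j), (x + off j 1, i), (x, j)})"

abbreviation box_corr :: "real \<Rightarrow> ((int^'m::finite) \<times> 'm) set \<Rightarrow> ((int^'m) \<times> 'm \<times> 'm) set \<Rightarrow> ((int^'m) \<times> 'm) set \<Rightarrow> real" where
  "box_corr \<beta> E P A \<equiv> corr_sum E boundary (\<lambda>_. \<beta>) P A / corr_sum E boundary (\<lambda>_. \<beta>) P {}"

lemma chi_boundary:
  assumes "i \<noteq> j"
  shows "chi (boundary (x, i, j)) \<sigma> = rho (dsig \<sigma> (x, i, j))"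
proof -
  have "x \<noteq> x + off i 1" "x \<noteq> x + off j 1" using off_ne_0[of i] off_ne_0[of j] by simp_all
  hence "chi (boundary (x, i, j)) \<sigma> = rho (\<sigma> (x, i)) * (rho (\<sigma> (x + off i 1, j)) * (rho (\<sigma> (x + off j 1, i)) * rho (\<sigma> (x, j))))"
    using assms unfolding chi_def boundary_def by simp
  thus ?thesis unfolding dsig_def prod.case rho_xor by simp
qed

lemma expect_eq_box_corr:
  fixes A :: "((int^'m::finite) \<times> 'm) set"
  shows "expect \<beta> N (wilson A) = box_corr \<beta> (edges N) (plaqs N) A"
proof -
  have "gibbs_weight \<beta> N \<sigma> = exp (\<Sum>p\<in>plaqs N. \<beta> * chi (boundary p) \<sigma>)" for \<sigma> :: "(int^'m) \<times> 'm \<Rightarrow> bool"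
    unfolding gibbs_weight_def sum_distrib_left
    by (intro arg_cong[where f = exp] sum.cong refl) (auto simp: plaqs_iff chi_boundary)
  thus ?thesis unfolding expect_def corr_sum_def configs_eq wilson_eq by simp
qed

lemma boundary_subset: "p \<in> plaqs N \<Longrightarrow> boundary p \<subseteq> edges N"
  unfolding plaqs_def boundary_def edges_def by (auto simp: add_ac)

lemma lbox_mono: "N \<le> N' \<Longrightarrow> lbox N \<subseteq> lbox N'"
  unfolding lbox_def by (auto intro: order.trans)

lemma edges_mono: "N \<le> N' \<Longrightarrow> edges N \<subseteq> edges N'"
  and plaqs_mono: "N \<le> N' \<Longrightarrow> plaqs N \<subseteq> plaqs N'"
  using lbox_mono[of N N'] unfolding edges_def plaqs_def by auto

text \<open>Extra edges leave a correlation unchanged and extra plaquettes raise it. Since E and P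
  are arbitrary, displaced boxes can be compared as well.\<close>

lemma box_corr_le_expect:
  assumes "\<beta> \<ge> 0" "E \<subseteq> edges N" "P \<subseteq> plaqs N" "A \<subseteq> E" "\<And>p. p \<in> P \<Longrightarrow> boundary p \<subseteq> E"
  shows "box_corr \<beta> E P A \<le> expect \<beta> N (wilson A)"
proof -
  have "box_corr \<beta> E P A = box_corr \<beta> (edges N) P A"
    by (rule correlation_enlarge[symmetric]) (use assms finite_subset[OF assms(3) finite_plaqs] finite_edges in auto)
  also have "\<dots> \<le> box_corr \<beta> (edges N) (plaqs N) A"
    by (rule correlation_mono[OF finite_plaqs assms(3) finite_edges order.trans[OF assms(4,2)] boundary_subset assms(1)])
  finally show ?thesis unfolding expect_eq_box_corr .
qed

lemma expect_mono:
  assumes "\<beta> \<ge> 0" "N \<le> N'" "A \<subseteq> edges N"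
  shows "expect \<beta> N (wilson A) \<le> expect \<beta> N' (wilson A)"
  unfolding expect_eq_box_corr[of \<beta> N]
  by (rule box_corr_le_expect[OF assms(1) edges_mono[OF assms(2)] plaqs_mono[OF assms(2)] assms(3) boundary_subset])

lemma expect_le_1:
  fixes A :: "((int^'m::finite) \<times> 'm) set"
  shows "expect \<beta> N (wilson A) \<le> 1"
proof -
  have "corr_sum (edges N) boundary (\<lambda>_. \<beta>) (plaqs N) A \<le> corr_sum (edges N) boundary (\<lambda>_. \<beta>) (plaqs N) ({} :: ((int^'m) \<times> 'm) set)"
    unfolding corr_sum_def by (intro sum_mono mult_right_mono) (auto simp: chi_le_1)
  thus ?thesis unfolding expect_eq_box_corr by (simp add: divide_le_eq_1 corr_sum_pos finite_edges)
qed

lemma finite_subset_edges: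
  assumes "finite A" obtains N where "A \<subseteq> edges N"
proof -
  have "\<exists>N. A \<subseteq> edges N" using assms
  proof (induction A rule: finite_induct)
    case (insert e A)
    then obtain N where N: "A \<subseteq> edges N" by auto
    obtain x i where e: "e = (x, i)" by (cases e)
    define M where "M = nat (\<Sum>k\<in>UNIV. \<bar>x $ k\<bar>) + 1"
    have "\<bar>x $ k\<bar> \<le> (\<Sum>k\<in>UNIV. \<bar>x $ k\<bar>)" for k by (rule member_le_sum) auto
    hence "\<bar>x $ k\<bar> + 1 \<le> int M" for k unfolding M_def by (simp add: sum_nonneg)
    hence "cell M x {i}" unfolding cell_def by (smt (verit, best))
    hence "e \<in> edges M" unfolding e edges_iff .
    hence "insert e A \<subseteq> edges (max M N)" using N edges_mono[of M "max M N"] edges_mono[of N "max M N"] by auto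
    thus ?case by blast
  qed auto
  thus ?thesis using that by blast
qed

lemma expect_tendsto_wloop:
  assumes "\<beta> \<ge> 0" "finite A"
  shows "(\<lambda>N. expect \<beta> N (wilson A)) \<longlonglongrightarrow> wloop \<beta> A"
proof -
  obtain N0 where N0: "A \<subseteq> edges N0" using finite_subset_edges[OF assms(2)] .
  have inc: "incseq (\<lambda>N. expect \<beta> (N + N0) (wilson A))"
  proof (rule incseq_SucI)
    fix N
    have "A \<subseteq> edges (N + N0)" using N0 edges_mono[OF le_add2, of N0 N] by (rule order.trans)
    thus "expect \<beta> (N + N0) (wilson A) \<le> expect \<beta> (Suc N + N0) (wilson A)"
      using assms(1) by (intro expect_mono) auto
  qed
  have "\<forall>N. expect \<beta> (N + N0) (wilson A) \<le> 1" by (simp add: expect_le_1)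
  from incseq_convergent[OF inc this] obtain L where "(\<lambda>N. expect \<beta> (N + N0) (wilson A)) \<longlonglongrightarrow> L" .
  hence "(\<lambda>N. expect \<beta> N (wilson A)) \<longlonglongrightarrow> L" by (rule LIMSEQ_offset)
  thus ?thesis unfolding wloop_def by (simp add: limI)
qed

section \<open>Invariance under translations and permutations of the axes\<close>

lemma corr_sum_reindex:
  assumes g: "inj g" and h: "inj_on h P" and B: "\<And>p. p \<in> P \<Longrightarrow> B' (h p) = g ` B p"
  shows "corr_sum (g ` E) B' (\<lambda>_. \<beta>) (h ` P) (g ` A) = corr_sum E B (\<lambda>_. \<beta>) P A"
proof -
  have chi: "chi (g ` X) \<sigma> = chi X (\<sigma> \<circ> g)" for X \<sigma>
    unfolding chi_def using g by (subst prod.reindex) (auto intro: inj_on_subset)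
  have "(\<Sum>\<sigma>\<in>spins (g ` E). chi A (\<sigma> \<circ> g) * exp (\<Sum>p\<in>P. \<beta> * chi (B p) (\<sigma> \<circ> g)))
    = (\<Sum>\<sigma>\<in>spins E. chi A \<sigma> * exp (\<Sum>p\<in>P. \<beta> * chi (B p) \<sigma>))"
  proof (rule sum.reindex_bij_witness[where j = "\<lambda>\<sigma>. \<sigma> \<circ> g" and i = "\<lambda>\<sigma> e. e \<in> range g \<and> \<sigma> (inv g e)"])
    fix \<sigma> assume "\<sigma> \<in> spins (g ` E)"
    thus "(\<lambda>e. e \<in> range g \<and> (\<sigma> \<circ> g) (inv g e)) = \<sigma>"
      unfolding spins_def by (auto simp: fun_eq_iff f_inv_into_f) (metis f_inv_into_f imageE rangeI)
    show "\<sigma> \<circ> g \<in> spins E" using \<open>\<sigma> \<in> spins (g ` E)\<close> g unfolding spins_def by (auto simp: inj_image_mem_iff)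
  next
    fix \<sigma> assume "\<sigma> \<in> spins E"
    thus "(\<lambda>e. e \<in> range g \<and> \<sigma> (inv g e)) \<in> spins (g ` E)"
      using g unfolding spins_def by auto
    show "(\<lambda>e. e \<in> range g \<and> \<sigma> (inv g e)) \<circ> g = \<sigma>" using g by (auto simp: fun_eq_iff)
  qed simp
  thus ?thesis unfolding corr_sum_def chi sum.reindex[OF h] by (simp add: B chi)
qed

definition perm_vec :: "('m::finite \<Rightarrow> 'm) \<Rightarrow> int^'m \<Rightarrow> int^'m" where
  "perm_vec \<pi> x = (\<chi> k. x $ inv \<pi> k)"

lemma perm_vec_add: "perm_vec \<pi> (x + y) = perm_vec \<pi> x + perm_vec \<pi> y"
  by (simp add: perm_vec_def vec_eq_iff)

lemma perm_vec_off:
  assumes "bij \<pi>" shows "perm_vec \<pi> (off i k) = off (\<pi> i) k"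
proof -
  have "inv \<pi> c = i \<longleftrightarrow> c = \<pi> i" for c using assms by (metis bij_inv_eq_iff)
  thus ?thesis by (simp add: perm_vec_def vec_eq_iff off_nth)
qed

lemma perm_vec_inj: "bij \<pi> \<Longrightarrow> perm_vec \<pi> x = perm_vec \<pi> y \<Longrightarrow> x = y"
  unfolding perm_vec_def vec_eq_iff by simp (metis bij_inv_eq_iff)

lemma finite_rect: "finite (rect a i j R T)"
  unfolding rect_def by (simp add: setcompr_eq_image)

text \<open>A lattice symmetry carrying one loop to the other maps the box N into the box N + s,
  which need not equal its image. Griffiths then yields an inequality at each N, and the shift by s
  is lost in the limit; exchanging the loops gives equality.\<close>

lemma wloop_rect_le:
  fixes a a' :: "int^'m::finite"
  assumes \<beta>: "\<beta> \<ge> 0" and ij: "i \<noteq> j" "i' \<noteq> j'"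
  shows "wloop \<beta> (rect a i j R T) \<le> wloop \<beta> (rect a' i' j' R T)"
proof -
  \<comment> \<open>The first transposition sends i to i'; the second sends the image of j to j' and
    leaves i' fixed.\<close>
  define \<pi> where "\<pi> = Transposition.transpose (Transposition.transpose i i' j) j' \<circ> Transposition.transpose i i'"
  have bij: "bij \<pi>" unfolding \<pi>_def by (simp add: bij_comp)
  have "Transposition.transpose i i' j \<noteq> i'" using ij(1) by (metis transpose_apply_second transpose_eq_imp_eq transpose_apply_first)
  hence \<pi>i: "\<pi> i = i'" using ij(2) unfolding \<pi>_def by (simp add: transpose_def)
  have \<pi>j: "\<pi> j = j'" unfolding \<pi>_def by simp
  define b where "b = a' - perm_vec \<pi> a"
  define \<tau> where "\<tau> x = b + perm_vec \<pi> x" for x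
  define g where "g = (\<lambda>(x, c). (\<tau> x, \<pi> c))"
  define h where "h = (\<lambda>(x, c, d). (\<tau> x, \<pi> c, \<pi> d))"
  have \<pi>_inj: "\<pi> c = \<pi> d \<longleftrightarrow> c = d" for c d using bij by (simp add: bij_is_inj inj_eq)
  have \<tau>_inj: "\<tau> x = \<tau> y \<longleftrightarrow> x = y" for x y using perm_vec_inj[OF bij] unfolding \<tau>_def by auto
  have \<tau>_off: "\<tau> (x + off c s) = \<tau> x + off (\<pi> c) s" for x c s
    unfolding \<tau>_def perm_vec_add perm_vec_off[OF bij] by (simp add: add.assoc)
  have \<tau>a: "\<tau> a = a'" unfolding \<tau>_def b_def by simp
  define s where "s = nat (\<Sum>k\<in>UNIV. \<bar>b $ k\<bar>)"
  have bs: "\<bar>b $ k\<bar> \<le> int s" for k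
  proof -
    have "\<bar>b $ k\<bar> \<le> (\<Sum>k\<in>UNIV. \<bar>b $ k\<bar>)" by (rule member_le_sum) auto
    thus ?thesis unfolding s_def by (simp add: sum_nonneg)
  qed
  have \<tau>_box: "\<tau> x \<in> lbox (N + s)" if "x \<in> lbox N" for x N
    unfolding lbox_def
  proof (clarify)
    fix k
    have "\<bar>x $ inv \<pi> k\<bar> \<le> int N" using that unfolding lbox_def by blast
    moreover have "\<tau> x $ k = b $ k + x $ inv \<pi> k" unfolding \<tau>_def perm_vec_def by simp
    ultimately show "\<bar>\<tau> x $ k\<bar> \<le> int (N + s)" using bs[of k] by simp
  qed
  have g_rect: "g ` rect a i j R T = rect a' i' j' R T"
  proof -
    have "g (a + off i u, i) = (a' + off i' u, i')" "g (a + off j u, j) = (a' + off j' u, j')"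
      "g (a + off i u + off j w, j) = (a' + off i' u + off j' w, j')"
      "g (a + off j u + off i w, i) = (a' + off j' u + off i' w, i')" for u w
      unfolding g_def by (simp_all add: \<tau>_off \<tau>a \<pi>i \<pi>j)
    thus ?thesis unfolding rect_def setcompr_eq_image image_Un image_image by (simp only:)
  qed
  obtain N0 where N0: "rect a i j R T \<subseteq> edges N0" using finite_subset_edges[OF finite_rect] .
  have inj_g: "inj g" unfolding g_def by (auto simp: inj_def \<pi>_inj \<tau>_inj)
  have inj_h: "inj_on h P" for P unfolding h_def by (auto simp: inj_on_def \<pi>_inj \<tau>_inj)
  have bd: "boundary (h p) = g ` boundary p" for p
    unfolding boundary_def h_def g_def by (auto simp: \<tau>_off split: prod.splits)
  have le: "expect \<beta> N (wilson (rect a i j R T)) \<le> expect \<beta> (N + s) (wilson (rect a' i' j' R T))" if "N \<ge> N0" for N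
  proof -
    have "expect \<beta> N (wilson (rect a i j R T)) = box_corr \<beta> (g ` edges N) (h ` plaqs N) (g ` rect a i j R T)"
    proof -
      have "corr_sum (g ` edges N) boundary (\<lambda>_. \<beta>) (h ` plaqs N) (g ` A)
        = corr_sum (edges N) boundary (\<lambda>_. \<beta>) (plaqs N) A" for A
        by (rule corr_sum_reindex[OF inj_g inj_h]) (rule bd)
      from this[of "rect a i j R T"] this[of "{}"] show ?thesis unfolding expect_eq_box_corr by simp
    qed
    also have "\<dots> \<le> expect \<beta> (N + s) (wilson (g ` rect a i j R T))"
    proof (rule box_corr_le_expect[OF \<beta>])
      show "g ` edges N \<subseteq> edges (N + s)"
        unfolding edges_def g_def by (auto simp flip: \<tau>_off intro: \<tau>_box)
      show "h ` plaqs N \<subseteq> plaqs (N + s)"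
        unfolding plaqs_def h_def by (auto simp: \<pi>_inj simp flip: \<tau>_off intro: \<tau>_box)
      show "g ` rect a i j R T \<subseteq> g ` edges N" using N0 edges_mono[OF that] by auto
      show "boundary p \<subseteq> g ` edges N" if "p \<in> h ` plaqs N" for p
        using that bd boundary_subset by fastforce
    qed
    finally show ?thesis unfolding g_rect .
  qed
  have lim: "(\<lambda>N. expect \<beta> (N + s) (wilson (rect a' i' j' R T))) \<longlonglongrightarrow> wloop \<beta> (rect a' i' j' R T)"
    by (rule LIMSEQ_ignore_initial_segment[OF expect_tendsto_wloop[OF \<beta> finite_rect]])
  show ?thesis
    by (rule LIMSEQ_le[OF expect_tendsto_wloop[OF \<beta> finite_rect] lim]) (use le in blast)
qed

lemma wloop_rect_eq:
  fixes a a' :: "int^'m::finite"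
  assumes "\<beta> \<ge> 0" "i \<noteq> j" "i' \<noteq> j'"
  shows "wloop \<beta> (rect a i j R T) = wloop \<beta> (rect a' i' j' R T)"
  using assms by (intro order.antisym wloop_rect_le)

lemma rect_swap: "rect a i j R T = rect a j i T R"
  unfolding rect_def by (simp only: Un_ac)

lemma dirs_distinct:
  assumes "CARD('m::finite) \<ge> 3"
  shows "fst (dirs :: 'm \<times> 'm) \<noteq> snd (dirs :: 'm \<times> 'm)"
proof -
  have "\<exists>p :: 'm \<times> 'm. case p of (i, j) \<Rightarrow> i \<noteq> j"
  proof (rule ccontr)
    assume "\<not> ?thesis"
    hence "UNIV \<subseteq> {undefined :: 'm}" by auto
    hence "CARD('m) \<le> card {undefined :: 'm}" by (intro card_mono) auto
    thus False using assms by simp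
  qed
  from someI_ex[OF this] show ?thesis unfolding dirs_def by (simp add: case_prod_unfold)
qed


theorem theorem4:
  fixes \<beta> :: real and r t :: nat
    and a :: "nat \<Rightarrow> int^'m::finite" and i j :: "nat \<Rightarrow> 'm"
  assumes "CARD('m) \<ge> 3"
    and "\<beta> > 1/2 * ln (10 * (real CARD('m) - 2)) + 1/6"
    and "r \<ge> 1" and "t \<ge> 1"
    and "\<forall>n. i n \<noteq> j n"
  shows "(\<forall>R\<ge>1. convergent (\<lambda>T. - ln (wloop \<beta> (ref_rect R T :: ((int^'m) \<times> 'm) set)) / real T))
    \<and> convergent (Vpot_R TYPE('m) \<beta>)
    \<and> (\<lambda>n. - ln (wloop \<beta> (rect (a n) (i n) (j n) (r * n) (t * n)))
            / real (r * n + t * n)) \<longlonglongrightarrow> Vpot TYPE('m) \<beta>"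
proof -
  note gas = parity_gas_cubes[OF assms(1,2)]
  have "ln (10 * (real CARD('m) - 2)) \<ge> 0" using assms(1) by (intro ln_ge_zero) simp
  hence \<beta>: "\<beta> \<ge> 0" using assms(2) by linarith
  define i0 :: 'm where "i0 = fst dirs"
  define j0 :: 'm where "j0 = snd dirs"
  have ij: "i0 \<noteq> j0" unfolding i0_def j0_def using dirs_distinct[OF assms(1)] .
  \<comment> \<open>The hypothesis m \<ge> 3 provides the direction in which the walls over the loop
    are raised.\<close>
  have "card {i0, j0} < CARD('m)" using ij assms(1) by simp
  hence "{i0, j0} \<noteq> UNIV" by (metis less_irrefl)
  then obtain k where k: "k \<noteq> i0" "k \<noteq> j0" by auto
  define w where "w R T = wloop \<beta> (rect 0 i0 j0 R T)" for R T
  define f where "f R T = - ln (w R T)" for R T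
  have w_eq: "wloop \<beta> (rect b c d R T) = w R T" if "c \<noteq> d" for b :: "int^'m" and c d R T
    unfolding w_def using wloop_rect_eq[OF \<beta> that ij] .
  have ref: "wloop \<beta> (ref_rect R T :: ((int^'m) \<times> 'm) set) = w R T" for R T
    unfolding w_def ref_rect_def i0_def j0_def ..
  have tends: "(\<lambda>N. expect \<beta> N (wilson (rect b i0 j0 R T))) \<longlonglongrightarrow> w R T" for b R T
    using expect_tendsto_wloop[OF \<beta> finite_rect, of b i0 j0 R T] w_eq[OF ij] by simp
  define e :: real where "e = exp (- 1/120)"
  have e: "0 < e" "e < 1" unfolding e_def by auto
  define K where "K = 2 / (1 - e)"
  have bound: "expect \<beta> N (wilson (rect 0 i0 j0 R T)) > 0"
      "- ln (expect \<beta> N (wilson (rect 0 i0 j0 R T))) \<le> K * real (R + T) + real R * real T * e ^ N"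
    if "R \<ge> 1" "T \<ge> 1" "N \<ge> R" "N \<ge> T" for R T N
    using perimeter_bound[OF gas ij k that] unfolding K_def e_def by auto
  \<comment> \<open>Positivity in each box could be lost in the limit; a lower bound uniform in N
    prevents this.\<close>
  have w_pos: "w R T > 0" if RT: "R \<ge> 1" "T \<ge> 1" for R T
  proof -
    define C where "C = K * real (R + T) + real R * real T"
    have "expect \<beta> N (wilson (rect 0 i0 j0 R T)) \<ge> exp (- C)" if N: "N \<ge> max R T" for N
    proof -
      have "real R * real T * e ^ N \<le> real R * real T * 1" using e by (intro mult_left_mono power_le_one) auto
      hence "ln (expect \<beta> N (wilson (rect 0 i0 j0 R T))) \<ge> - C"
        using bound(2)[OF RT, of N] N unfolding C_def by simp
      thus ?thesis using bound(1)[OF RT, of N] N by (simp add: ln_ge_iff)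
    qed
    hence "w R T \<ge> exp (- C)" by (intro LIMSEQ_le_const[OF tends]) blast
    thus ?thesis by (rule less_le_trans[OF exp_gt_zero])
  qed
  have tends_ln: "(\<lambda>N. ln (expect \<beta> N (wilson (rect b i0 j0 R T)))) \<longlonglongrightarrow> - f R T"
    if "R \<ge> 1" "T \<ge> 1" for b R T
    unfolding f_def using tendsto_ln[OF tends] w_pos[OF that] by simp
  have f_sym: "f R T = f T R" for R T
  proof -
    have "w R T = wloop \<beta> (rect 0 j0 i0 T R)" unfolding w_def by (subst rect_swap) (rule refl)
    thus ?thesis unfolding f_def using w_eq[of j0 i0 0 T R] ij by simp
  qed
  have f_nonneg: "0 \<le> f R T" if "R \<ge> 1" "T \<ge> 1" for R T
  proof -
    have "w R T \<le> 1" by (rule LIMSEQ_le_const2[OF tends]) (use expect_le_1 in blast)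
    thus ?thesis unfolding f_def using w_pos[OF that] by simp
  qed
  have f_perim: "f R T \<le> K * real (R + T)" if RT: "R \<ge> 1" "T \<ge> 1" for R T
  proof -
    have "(\<lambda>N. e ^ N) \<longlonglongrightarrow> 0" using LIMSEQ_power_zero[of e] e by simp
    hence l1: "(\<lambda>N. K * real (R + T) + real R * real T * e ^ N) \<longlonglongrightarrow> K * real (R + T) + real R * real T * 0"
      by (intro tendsto_add tendsto_mult tendsto_const)
    have l2: "(\<lambda>N. - ln (expect \<beta> N (wilson (rect 0 i0 j0 R T)))) \<longlonglongrightarrow> f R T"
      using tendsto_minus[OF tends_ln[OF RT, of 0]] by simp
    have l3: "\<exists>M. \<forall>N\<ge>M. - ln (expect \<beta> N (wilson (rect 0 i0 j0 R T))) \<le> K * real (R + T) + real R * real T * e ^ N"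
      using bound(2)[OF RT] by (intro exI[of _ "max R T"]) auto
    show ?thesis using LIMSEQ_le[OF l2 l1 l3] by simp
  qed
  have f_second: "\<bar>f (R + 2) T - 2 * f (R + 1) T + f R T\<bar> \<le> 2 * real T * e ^ R" if RT: "R \<ge> 1" "T \<ge> 1" for R T
  proof -
    \<comment> \<open>In the limit the loops based at 0 and at \<open>off i0 1\<close> have equal
      values, and the two middle terms merge into 2 f (R + 1) T.\<close>
    have "(\<lambda>N. \<bar>ln (expect \<beta> N (wilson (rect 0 i0 j0 (R + 2) T))) - ln (expect \<beta> N (wilson (rect 0 i0 j0 (R + 1) T)))
       - ln (expect \<beta> N (wilson (rect (off i0 1) i0 j0 (R + 1) T))) + ln (expect \<beta> N (wilson (rect (off i0 1) i0 j0 R T)))\<bar>)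
      \<longlonglongrightarrow> \<bar>- f (R + 2) T - (- f (R + 1) T) - (- f (R + 1) T) + (- f R T)\<bar>"
      using RT by (intro tendsto_intros tends_ln) auto
    moreover have "\<exists>M. \<forall>N\<ge>M. \<bar>ln (expect \<beta> N (wilson (rect 0 i0 j0 (R + 2) T))) - ln (expect \<beta> N (wilson (rect 0 i0 j0 (R + 1) T)))
       - ln (expect \<beta> N (wilson (rect (off i0 1) i0 j0 (R + 1) T))) + ln (expect \<beta> N (wilson (rect (off i0 1) i0 j0 R T)))\<bar>
       \<le> 2 * real T * e ^ R"
      using second_difference[OF gas ij RT] unfolding e_def by (intro exI[of _ "max (R + 2) T"]) auto
    ultimately have "\<bar>- f (R + 2) T - (- f (R + 1) T) - (- f (R + 1) T) + (- f R T)\<bar> \<le> 2 * real T * e ^ R"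
      by (rule LIMSEQ_le_const2)
    thus ?thesis by linarith
  qed
  obtain v V where v: "\<And>T. T \<ge> 1 \<Longrightarrow> (\<lambda>R. f T R / real R) \<longlonglongrightarrow> v T" and V: "v \<longlonglongrightarrow> V"
    and rt: "\<And>r t. r \<ge> 1 \<Longrightarrow> t \<ge> 1 \<Longrightarrow> (\<lambda>n. f (r * n) (t * n) / real (r * n + t * n)) \<longlonglongrightarrow> V"
    by (rule perimeter_asymptotics[where f = f, OF e f_sym f_nonneg f_perim f_second]) (assumption | rule that)+
  have vR: "(\<lambda>T. - ln (wloop \<beta> (ref_rect R T :: ((int^'m) \<times> 'm) set)) / real T) \<longlonglongrightarrow> v R" if "R \<ge> 1" for R
    using v[OF that] unfolding ref f_def .
  have "Vpot_R TYPE('m) \<beta> R = v R" if "R \<ge> 1" for R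
    unfolding Vpot_R_def using limI[OF vR[OF that]] .
  \<comment> \<open>The identification is available for R \<ge> 1, which suffices for the
    limit.\<close>
  hence "\<forall>\<^sub>F R in sequentially. v R = Vpot_R TYPE('m) \<beta> R"
    unfolding eventually_sequentially by metis
  hence VpotR: "Vpot_R TYPE('m) \<beta> \<longlonglongrightarrow> V" using Lim_transform_eventually[OF V] by blast
  hence "Vpot TYPE('m) \<beta> = V" unfolding Vpot_def by (rule limI)
  moreover have "wloop \<beta> (rect (a n) (i n) (j n) (r * n) (t * n)) = w (r * n) (t * n)" for n
    using w_eq assms(5) by blast
  ultimately have "(\<lambda>n. - ln (wloop \<beta> (rect (a n) (i n) (j n) (r * n) (t * n))) / real (r * n + t * n))
      \<longlonglongrightarrow> Vpot TYPE('m) \<beta>"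
    using rt[OF assms(3,4)] unfolding f_def by simp
  thus ?thesis using vR VpotR unfolding convergent_def by blast
qed

end
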